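(* Let $\{Z_t\}$ be a mean-zero, unit-variance stationary Gaussian sequence and let $G:\mathbb{R}\to\mathbb{R}$ satisfy $\mathrm{E}[G(Z_0)]^2<\infty$, $\mathrm{Var}[G(Z_0)]>0$, with Hermite rank $m\ge 1$ and 2nd Hermite rank $m_2$ (so $m_2>m$, possibly $m_2=\infty$). Suppose that for some $\alpha\in(0,1/m)$, $C_0>0$, $\tau\in(1-\alpha m,\infty)$ and some slowly varying $L:\mathbb{R}^+\to\mathbb{R}^+$ (i.e. $\lim_{x\to\infty}L(ax)/L(x)=1$ for every $a>0$), $$\gamma_Z(k)\equiv\mathrm{Cov}(Z_0,Z_k)=C_0k^{-\alpha}\bigl(1+k^{-\tau}L(k)\bigr),\qquad k>0 .$$ Let $X_t\equiv G(Z_t)$ and let $\widehat V_{\ell,\alpha m}$ denote either the overlapping-block estimator $\widehat V_{\ell,\alpha m,OL}$ or the non-overlapping-block estimator $\widehat V_{\ell,\alpha m,NOL}$ of $v_{n,\alpha m}=n^{\alpha m}\mathrm{Var}(\bar X_n)$, based on $X_1,\dots,X_n$ and block length $\ell=\ell_n$. If $\ell^{-1}+\ell/n\to 0$ as $n\to\infty$, then $$\mathrm{E}\widehat V_{\ell,\alpha m}-v_{n,\alpha m}=\mathcal B_0(m)\Bigl(\frac{\ell^{\alpha m}}{\ell}\Bigr)(1+o(1))-v_{\infty,\alpha m}\Bigl(\frac{\ell}{n}\Bigr)^{\alpha m}(1+o(1))+I(m_2<\infty)\,\mathcal B_1(m_2)\Bigl(\frac{\ell^{\alpha m}}{\ell^{\min\{1,\alpha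 m_2\}}}\Bigr)[\log\ell]^{I(\alpha m_2=1)}(1+o(1)),$$ where $I(\cdot)$ is the indicator function and $$v_{\infty,\alpha m}\equiv\frac{2J_m^2C_0^m}{m!(1-\alpha m)(2-\alpha m)} .$$
   Context: Hermite polynomials: $H_k(z)=(-1)^ke^{z^2/2}\frac{d^k}{dz^k}e^{-z^2/2}$. Hermite coefficients: $J_k\equiv\mathrm{E}[G(Z_0)H_k(Z_0)]$, $k\ge0$, with $Z_0$ standard normal, so $G(Z_0)=\sum_{k\ge0}\frac{J_k}{k!}H_k(Z_0)$. Hermite rank: $m\equiv\min\{j\ge1:J_j\ne0\}$. 2nd Hermite rank: $m_2\equiv\min\{k>m:J_k\ne0\}$, with $m_2=\infty$ if this set is empty. Block estimators. $\bar X_n=n^{-1}\sum_{t=1}^nX_t$ and $\bar X_{i,\ell}=\ell^{-1}\sum_{j=i}^{i+\ell-1}X_j$. Then $$\widehat V_{\ell,\alpha m,OL}=\frac1{n-\ell+1}\sum_{i=1}^{n-\ell+1}\ell^{\alpha m}(\bar X_{i,\ell}-\widehat\mu_{n,OL})^2,\quad \widehat\mu_{n,OL}=\frac1{n-\ell+1}\sum_{i=1}^{n-\ell+1}\bar X_{i,\ell},$$ and, with $b=\lfloor n/\ell\rfloor$, $$\widehat V_{\ell,\alpha m,NOL}=\frac1b\sum_{i=1}^b\ell^{\alpha m}(\bar X_{1+(i-1)\ell,\ell}-\widehat\mu_{n,NOL})^2,\quad\widehat\mu_{n,NOL}=\frac1b\sum_{i=1}^b\bar X_{1+(i-1)\ell,\ell}.$$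 Constants: $$\mathcal B_0(m)\equiv2C_0^m\frac{J_m^2}{m!}\Bigl\{\mathcal I_{\alpha m}+\sum_{k=1}^\infty k^{-\alpha m}\sum_{j=1}^m\binom mj[L(k)k^{-\tau}]^j\Bigr\}+\sum_{k=m}^\infty\frac{J_k^2}{k!},$$ with $\mathcal I_{\alpha m}\equiv\lim_{k\to\infty}\bigl(\sum_{j=1}^kj^{-\alpha m}-\int_0^kx^{-\alpha m}dx\bigr)\in(-\infty,0)$. For $m_2<\infty$: $\mathcal B_1(m_2)\equiv2\sum_{j=m_2}^\infty(J_j^2/j!)\sum_{k=1}^\infty[\gamma_Z(k)]^j$ if $\alpha m_2>1$; $\mathcal B_1(m_2)\equiv2C_0^{m_2}J_{m_2}^2/m_2!$ if $\alpha m_2=1$; $\mathcal B_1(m_2)\equiv2J_{m_2}^2C_0^{m_2}/[m_2!(1-\alpha m_2)(2-\alpha m_2)]$ if $\alpha m_2<1$.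
   Formalization: If B_0(m)=0 and m_2=∞, the first term is read as o(ℓ^{αm}/ℓ), since the literal claim can fail there (e.g. G(x)=x with suitable C_0); slowly varying L is taken Borel measurable, as in Karamata's notion. *)

theory Defs
  imports "HOL-Probability.Probability" "HOL-Library.Extended_Nat"
begin

section \<open>Gaussian stationary sequences\<close>

text \<open>A one-dimensional Gaussian variable; point masses count as (degenerate) Gaussian laws.\<close>

definition gaussian_rv :: "'a measure \<Rightarrow> ('a \<Rightarrow> real) \<Rightarrow> bool" where
  "gaussian_rv M Y \<longleftrightarrow> Y \<in> borel_measurable M \<and>
     ((\<exists>\<mu>. AE \<omega> in M. Y \<omega> = \<mu>) \<or>
      (\<exists>\<mu> \<sigma>. 0 < \<sigma> \<and> distributed M lborel Y (\<lambda>x. ennreal (normal_density \<mu> \<sigma> x))))"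

definition gaussian_sequence :: "'a measure \<Rightarrow> (nat \<Rightarrow> 'a \<Rightarrow> real) \<Rightarrow> bool" where
  "gaussian_sequence M Z \<longleftrightarrow> (\<forall>n c. gaussian_rv M (\<lambda>\<omega>. \<Sum>t<n. c t * Z t \<omega>))"

definition stationary :: "'a measure \<Rightarrow> (nat \<Rightarrow> 'a \<Rightarrow> real) \<Rightarrow> bool" where
  "stationary M Z \<longleftrightarrow> (\<forall>t. Z t \<in> borel_measurable M) \<and>
     (\<forall>s. distr M (PiM UNIV (\<lambda>_. borel)) (\<lambda>\<omega> t. Z (t + s) \<omega>) =
          distr M (PiM UNIV (\<lambda>_. borel)) (\<lambda>\<omega> t. Z t \<omega>))"

definition covariance :: "'a measure \<Rightarrow> ('a \<Rightarrow> real) \<Rightarrow> ('a \<Rightarrow> real) \<Rightarrow> real" where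
  "covariance M X Y =
     prob_space.expectation M (\<lambda>\<omega>. (X \<omega> - prob_space.expectation M X) * (Y \<omega> - prob_space.expectation M Y))"

definition autocov :: "'a measure \<Rightarrow> (nat \<Rightarrow> 'a \<Rightarrow> real) \<Rightarrow> nat \<Rightarrow> real" where
  "autocov M Z k = covariance M (Z 0) (Z k)"

text \<open>
  Only the values on the positive half-line matter. Borel measurability is part of Karamata's
  notion of slow variation; the limit condition alone does not give locally uniform
  convergence or the bounds \<open>L x = o(x powr \<delta>)\<close>.
\<close>

definition slowly_varying :: "(real \<Rightarrow> real) \<Rightarrow> bool" where
  "slowly_varying L \<longleftrightarrow>
     L \<in> borel_measurable (restrict_space borel {0<..}) \<and>
     (\<forall>x>0. 0 < L x) \<and>
     (\<forall>a>0. ((\<lambda>x. L (a * x) / L x) \<longlongrightarrow> 1) at_top)"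


section \<open>Hermite expansions\<close>

definition hermite :: "nat \<Rightarrow> real \<Rightarrow> real" where
  "hermite k z = (-1) ^ k * exp (z\<^sup>2 / 2) * (deriv ^^ k) (\<lambda>x. exp (- x\<^sup>2 / 2)) z"

definition hermite_coeff :: "'a measure \<Rightarrow> (nat \<Rightarrow> 'a \<Rightarrow> real) \<Rightarrow> (real \<Rightarrow> real) \<Rightarrow> nat \<Rightarrow> real" where
  "hermite_coeff M Z G k = prob_space.expectation M (\<lambda>\<omega>. G (Z 0 \<omega>) * hermite k (Z 0 \<omega>))"

text \<open>Both ranks are infima in \<^typ>\<open>enat\<close>, so that an empty set yields \<open>\<infinity>\<close>.\<close>

definition hermite_rank :: "(nat \<Rightarrow> real) \<Rightarrow> enat" where
  "hermite_rank J = Inf {enat j | j. 1 \<le> j \<and> J j \<noteq> 0}"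

definition hermite_rank2 :: "(nat \<Rightarrow> real) \<Rightarrow> enat" where
  "hermite_rank2 J = Inf {enat k | k. hermite_rank J < enat k \<and> J k \<noteq> 0}"


section \<open>Block estimators\<close>

text \<open>In all of the following, \<open>a\<close> stands for the product \<open>\<alpha> * m\<close>.\<close>

definition sample_mean :: "(nat \<Rightarrow> 'a \<Rightarrow> real) \<Rightarrow> nat \<Rightarrow> 'a \<Rightarrow> real" where
  "sample_mean X n \<omega> = (\<Sum>t=1..n. X t \<omega>) / real n"

definition block_mean :: "(nat \<Rightarrow> 'a \<Rightarrow> real) \<Rightarrow> nat \<Rightarrow> nat \<Rightarrow> 'a \<Rightarrow> real" where
  "block_mean X i l \<omega> = (\<Sum>j=i..i+l-1. X j \<omega>) / real l"

definition target_var :: "'a measure \<Rightarrow> (nat \<Rightarrow> 'a \<Rightarrow> real) \<Rightarrow> real \<Rightarrow> nat \<Rightarrow> real" where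
  "target_var M X a n = real n powr a * prob_space.variance M (sample_mean X n)"

definition mu_OL :: "(nat \<Rightarrow> 'a \<Rightarrow> real) \<Rightarrow> nat \<Rightarrow> nat \<Rightarrow> 'a \<Rightarrow> real" where
  "mu_OL X n l \<omega> = (\<Sum>i=1..n-l+1. block_mean X i l \<omega>) / real (n - l + 1)"

definition V_OL :: "(nat \<Rightarrow> 'a \<Rightarrow> real) \<Rightarrow> real \<Rightarrow> nat \<Rightarrow> nat \<Rightarrow> 'a \<Rightarrow> real" where
  "V_OL X a n l \<omega> =
     (\<Sum>i=1..n-l+1. real l powr a * (block_mean X i l \<omega> - mu_OL X n l \<omega>)\<^sup>2) / real (n - l + 1)"

definition mu_NOL :: "(nat \<Rightarrow> 'a \<Rightarrow> real) \<Rightarrow> nat \<Rightarrow> nat \<Rightarrow> 'a \<Rightarrow> real" where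
  "mu_NOL X n l \<omega> = (\<Sum>i=1..n div l. block_mean X (1 + (i - 1) * l) l \<omega>) / real (n div l)"

definition V_NOL :: "(nat \<Rightarrow> 'a \<Rightarrow> real) \<Rightarrow> real \<Rightarrow> nat \<Rightarrow> nat \<Rightarrow> 'a \<Rightarrow> real" where
  "V_NOL X a n l \<omega> =
     (\<Sum>i=1..n div l. real l powr a * (block_mean X (1 + (i - 1) * l) l \<omega> - mu_NOL X n l \<omega>)\<^sup>2)
       / real (n div l)"


section \<open>Constants\<close>

definition I_const :: "real \<Rightarrow> real" where
  "I_const a = lim (\<lambda>k::nat. (\<Sum>j=1..k. real j powr - a) - integral {0..real k} (\<lambda>x. x powr - a))"

text \<open>The library sums series from \<open>0\<close>, hence the index shifts below.\<close>

definition B0 :: "(nat \<Rightarrow> real) \<Rightarrow> real \<Rightarrow> real \<Rightarrow> real \<Rightarrow> (real \<Rightarrow> real) \<Rightarrow> nat \<Rightarrow> real" where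
  "B0 J \<alpha> C0 \<tau> L m =
     2 * C0 ^ m * ((J m)\<^sup>2 / fact m) *
       (I_const (\<alpha> * real m) +
        (\<Sum>k. real (Suc k) powr - (\<alpha> * real m) *
              (\<Sum>j=1..m. real (m choose j) * (L (real (Suc k)) * real (Suc k) powr - \<tau>) ^ j)))
     + (\<Sum>k. (J (k + m))\<^sup>2 / fact (k + m))"

text \<open>
  \<open>B0\<close> can vanish (for fractional Gaussian noise and \<open>G x = x\<close>, for instance). A term
  \<open>B0 * x n * (1 + o(1))\<close> of an expansion is then to be read as \<open>o(x n)\<close>, unless it is
  dominated by a further nonzero term anyway. The coefficients \<open>v_inf\<close> and \<open>B1\<close> are positive
  when the covariances of lag at least 1 are positive.
\<close>

definition B1 :: "(nat \<Rightarrow> real) \<Rightarrow> (nat \<Rightarrow> real) \<Rightarrow> real \<Rightarrow> real \<Rightarrow> nat \<Rightarrow> real" where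
  "B1 J \<gamma> \<alpha> C0 m2 =
     (if \<alpha> * real m2 > 1 then
        2 * (\<Sum>j. (J (j + m2))\<^sup>2 / fact (j + m2) * (\<Sum>k. \<gamma> (Suc k) ^ (j + m2)))
      else if \<alpha> * real m2 = 1 then
        2 * C0 ^ m2 * (J m2)\<^sup>2 / fact m2
      else
        2 * (J m2)\<^sup>2 * C0 ^ m2 / (fact m2 * (1 - \<alpha> * real m2) * (2 - \<alpha> * real m2)))"

definition v_inf :: "(nat \<Rightarrow> real) \<Rightarrow> real \<Rightarrow> real \<Rightarrow> nat \<Rightarrow> real" where
  "v_inf J \<alpha> C0 m =
     2 * (J m)\<^sup>2 * C0 ^ m / (fact m * (1 - \<alpha> * real m) * (2 - \<alpha> * real m))"

end

theory Submission
  imports Defs "HOL-Real_Asymp.Real_Asymp"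
begin

text \<open>
  By Mehler's formula the covariances of \<open>X t = G (Z t)\<close> are \<open>r d = (\<Sum>j\<ge>m. q j * \<gamma> d ^ j)\<close> with
  \<open>q j = (J j)\<^sup>2 / fact j\<close>. Writing \<open>S k\<close> for the variance of the mean of \<open>k\<close> consecutive observations,
  the block estimator has expectation \<open>l powr a * (S l - W)\<close>, where \<open>a = \<alpha> * m\<close> and \<open>W\<close> is the variance
  of the mean of the block means, so the bias is \<open>v l - v n - l powr a * W\<close> for
  \<open>v k = k powr a * S k\<close>. Since \<open>r \<ge> 0\<close>, \<open>W\<close> is squeezed between multiples of variances of block sums of
  length asymptotic to \<open>n\<close>, whence \<open>W \<sim> v_inf * n powr - a\<close>. The summand \<open>j = m\<close> of \<open>r\<close> and the value
  \<open>r 0\<close> contribute \<open>v_inf + B0 * k powr (a - 1)\<close> to \<open>v k\<close>, and the remaining summands, governed by the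
  second Hermite rank, contribute the \<open>B1\<close> term; in \<open>v l - v n\<close> the terms in \<open>n\<close> are of lower order.
\<close>


section \<open>Hermite polynomials\<close>

text \<open>Mehler's formula must hold for every square-integrable \<open>G\<close>, so it rests on
  the completeness of the Hermite polynomials; pairs of the sequence enter through their moment
  generating function alone, which covers singular pairs such as lag 0. Slow variation controls only
  ratios of \<open>L\<close>; Karamata's uniform convergence argument turns this into a power bound,
  and \<open>1 - \<alpha> * m < \<tau>\<close> then makes the correction to the leading covariance
  summable, so that it contributes a constant to \<open>B0\<close>. The scale \<open>rate\<close>
  measures all second-order terms: it has the order of the \<open>B0\<close> term if
  \<open>\<alpha> * m2 > 1\<close> and exceeds it otherwise. Hence for finite \<open>m2\<close> all
  second-order errors can be charged to the \<open>B1\<close> term, whose coefficient is nonzero,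
  and \<open>B0 = 0\<close> does no harm; only for \<open>m2 = \<infinity>\<close> must that case be
  distinguished. \<open>W\<close> matters to leading order only, since its relative error is
  absorbed in \<open>1 + e1\<close>; for overlapping blocks, monotonicity in the index set therefore
  replaces an exact evaluation.\<close>

text \<open>The formal power series of \<open>exp (- x\<^sup>2 / 2)\<close>; multiplied by that of \<open>exp (z * x)\<close> it is the
  exponential generating function of the Hermite polynomials at \<open>z\<close>.\<close>

definition gauss_fps :: "real fps" where
  "gauss_fps = Abs_fps (\<lambda>n. if even n then (-1/2) ^ (n div 2) / fact (n div 2) else 0)"

definition hermite_fps :: "real \<Rightarrow> real fps" where
  "hermite_fps z = fps_exp z * gauss_fps"

lemma fps_deriv_gauss_fps: "fps_deriv gauss_fps = - fps_X * gauss_fps"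
proof (rule fps_ext)
  fix n
  show "fps_nth (fps_deriv gauss_fps) n = fps_nth (- fps_X * gauss_fps) n"
  proof (cases n)
    case (Suc k)
    show ?thesis
    proof (cases "even k")
      case True
      then obtain i where "k = 2 * i" by blast
      then show ?thesis using Suc
        by (simp add: gauss_fps_def divide_simps)
    qed (use Suc in \<open>simp add: gauss_fps_def\<close>)
  qed (simp add: gauss_fps_def)
qed

lemma fps_deriv_hermite_fps: "fps_deriv (hermite_fps z) = (fps_const z - fps_X) * hermite_fps z"
  by (simp add: hermite_fps_def fps_deriv_gauss_fps algebra_simps)

text \<open>Coefficient comparison in the differential equation of the generating function gives the
  three-term recurrence. The guard stands for the coefficient of index -1, since
  \<open>k - 1\<close> is \<open>0\<close> at \<open>k = 0\<close>.\<close>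

lemma hermite_fps_Suc:
  "real (Suc k) * fps_nth (hermite_fps z) (Suc k)
     = z * fps_nth (hermite_fps z) k - (if k = 0 then 0 else fps_nth (hermite_fps z) (k - 1))"
  using arg_cong[OF fps_deriv_hermite_fps[of z], of "\<lambda>f. fps_nth f k"]
  by (cases k) (simp_all add: algebra_simps)

lemma hermite_fps_nth:
  "fps_nth (hermite_fps z) k = (\<Sum>i\<le>k. z ^ i / fact i * fps_nth gauss_fps (k - i))"
  by (simp add: hermite_fps_def fps_mult_nth atLeast0AtMost)

text \<open>Differentiating \<open>exp (z * x - x\<^sup>2 / 2)\<close> in \<open>z\<close>
  multiplies it by \<open>x\<close>, which shifts the coefficients by one (the Appell property). The
  proof does this termwise on the explicit polynomial.\<close>

lemma has_field_derivative_hermite_fps: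
  "((\<lambda>z. fps_nth (hermite_fps z) k) has_real_derivative (if k = 0 then 0 else fps_nth (hermite_fps z) (k - 1))) (at z)"
proof (cases k)
  case 0
  then show ?thesis by (simp add: hermite_fps_nth)
next
  case (Suc j)
  have eq: "(\<lambda>z. fps_nth (hermite_fps z) k) =
      (\<lambda>z. fps_nth gauss_fps k + (\<Sum>i\<le>j. z ^ Suc i / fact (Suc i) * fps_nth gauss_fps (j - i)))"
    by (simp add: hermite_fps_nth Suc sum.atMost_Suc_shift del: sum.atMost_Suc fact_Suc)
  have "((\<lambda>z. z ^ Suc i / fact (Suc i) * fps_nth gauss_fps (j - i)) has_real_derivative
      z ^ i / fact i * fps_nth gauss_fps (j - i)) (at z)" for i
    by (rule derivative_eq_intros refl | simp)+
  then have "((\<lambda>z. fps_nth gauss_fps k + (\<Sum>i\<le>j. z ^ Suc i / fact (Suc i) * fps_nth gauss_fps (j - i)))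
     has_real_derivative (0 + (\<Sum>i\<le>j. z ^ i / fact i * fps_nth gauss_fps (j - i)))) (at z)"
    by (intro DERIV_add DERIV_const DERIV_sum)
  then show ?thesis by (simp only: eq) (simp add: Suc hermite_fps_nth)
qed

text \<open>The product rule produces the previous and the current polynomial; the recurrence
  combines them into the next one, and its factor \<open>k + 1\<close> completes the
  factorial.\<close>

lemma deriv_exp_hermite:
  "(deriv ^^ k) (\<lambda>x::real. exp (- x\<^sup>2 / 2))
     = (\<lambda>x. (-1) ^ k * fact k * fps_nth (hermite_fps x) k * exp (- x\<^sup>2 / 2))"
proof (induction k)
  case 0
  then show ?case by (simp add: hermite_fps_nth gauss_fps_def)
next
  case (Suc k)
  have "deriv (\<lambda>x. (-1) ^ k * fact k * fps_nth (hermite_fps x) k * exp (- x\<^sup>2 / 2)) x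
      = (-1) ^ Suc k * fact (Suc k) * fps_nth (hermite_fps x) (Suc k) * exp (- x\<^sup>2 / 2)" for x :: real
  proof (rule DERIV_imp_deriv)
    have "((\<lambda>x. (-1) ^ k * fact k * fps_nth (hermite_fps x) k * exp (- x\<^sup>2 / 2)) has_real_derivative
       (-1) ^ k * fact k * (if k = 0 then 0 else fps_nth (hermite_fps x) (k - 1)) * exp (- x\<^sup>2 / 2)
       + (-1) ^ k * fact k * fps_nth (hermite_fps x) k * (- x * exp (- x\<^sup>2 / 2))) (at x)"
      by (rule derivative_eq_intros has_field_derivative_hermite_fps refl | simp)+
    also have "(-1) ^ k * fact k * (if k = 0 then 0 else fps_nth (hermite_fps x) (k - 1)) * exp (- x\<^sup>2 / 2)
       + (-1) ^ k * fact k * fps_nth (hermite_fps x) k * (- x * exp (- x\<^sup>2 / 2))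
       = (-1) ^ Suc k * fact k * (x * fps_nth (hermite_fps x) k - (if k = 0 then 0 else fps_nth (hermite_fps x) (k - 1)))
          * exp (- x\<^sup>2 / 2)"
      by (simp add: algebra_simps)
    also have "\<dots> = (-1) ^ Suc k * fact (Suc k) * fps_nth (hermite_fps x) (Suc k) * exp (- x\<^sup>2 / 2)"
      unfolding hermite_fps_Suc[symmetric] by (simp add: algebra_simps)
    finally show "((\<lambda>x. (-1) ^ k * fact k * fps_nth (hermite_fps x) k * exp (- x\<^sup>2 / 2)) has_real_derivative
       (-1) ^ Suc k * fact (Suc k) * fps_nth (hermite_fps x) (Suc k) * exp (- x\<^sup>2 / 2)) (at x)" .
  qed
  then show ?case unfolding funpow.simps(2) o_apply Suc.IH by (intro ext)
qed

lemma hermite_eq: "hermite k z = fact k * fps_nth (hermite_fps z) k"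
proof -
  have "exp (z\<^sup>2 / 2) * exp (- z\<^sup>2 / 2) = 1"
    by (simp flip: exp_add)
  then have *: "exp (z\<^sup>2 / 2) * ((-1) ^ k * fact k * fps_nth (hermite_fps z) k * exp (- z\<^sup>2 / 2))
      = (-1) ^ k * (fact k * fps_nth (hermite_fps z) k)"
    by (metis (no_types, lifting) mult.assoc mult.left_commute mult.right_neutral)
  show ?thesis
    unfolding hermite_def deriv_exp_hermite mult.assoc[of "(-1) ^ k" "exp (z\<^sup>2 / 2)"] *
    by (simp flip: power_mult_distrib mult.assoc)
qed

lemma hermite_0 [simp]: "hermite 0 z = 1"
  by (simp add: hermite_eq hermite_fps_nth gauss_fps_def)

lemma borel_measurable_hermite [measurable]: "hermite k \<in> borel_measurable borel"
  unfolding hermite_eq[abs_def] hermite_fps_nth by measurable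

section \<open>Convergence of the generating function and integral transforms\<close>

lemma gauss_fps_sums:
  fixes c :: "'a :: {banach, real_normed_field}"
  shows "(\<lambda>n. of_real (fps_nth gauss_fps n) * c ^ n) sums exp (- (c\<^sup>2 / 2))"
    and "summable (\<lambda>n. norm (of_real (fps_nth gauss_fps n) * c ^ n))"
proof -
  have eq: "of_real (fps_nth gauss_fps (2 * n)) * c ^ (2 * n) = (- (c\<^sup>2 / 2)) ^ n /\<^sub>R fact n" for n
    by (simp add: gauss_fps_def power_mult power_minus' scaleR_conv_of_real field_simps)
       (simp add: power2_eq_square power_mult_distrib)
  have sm: "strict_mono ((*) (2::nat))"
    by (simp add: strict_mono_def)
  have z: "of_real (fps_nth gauss_fps n) * c ^ n = 0" if "n \<notin> range ((*) 2)" for n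
    using that by (auto simp: gauss_fps_def)
  show "(\<lambda>n. of_real (fps_nth gauss_fps n) * c ^ n) sums exp (- (c\<^sup>2 / 2))"
    using exp_converges[of "- (c\<^sup>2 / 2)"]
    by (subst sums_mono_reindex[OF sm, symmetric]) (use z eq in auto)
  have "summable (\<lambda>n. norm (of_real (fps_nth gauss_fps (2 * n)) * c ^ (2 * n)))"
    unfolding eq by (rule summable_norm_exp)
  then show "summable (\<lambda>n. norm (of_real (fps_nth gauss_fps n) * c ^ n))"
    using summable_mono_reindex[OF sm, of "\<lambda>n. norm (of_real (fps_nth gauss_fps n) * c ^ n)"] z by simp
qed

text \<open>Taking absolute values of the coefficients only flips the sign in the exponent. This
  series is the majorant behind \<open>hermite_sum_bound\<close>.\<close>

lemma abs_gauss_fps_sums: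
  fixes c :: real
  shows "(\<lambda>n. \<bar>fps_nth gauss_fps n\<bar> * c ^ n) sums exp (c\<^sup>2 / 2)"
proof -
  have eq: "\<bar>fps_nth gauss_fps (2 * n)\<bar> * c ^ (2 * n) = (c\<^sup>2 / 2) ^ n /\<^sub>R fact n" for n
    by (simp add: gauss_fps_def power_mult power_divide abs_mult power_abs[symmetric] field_simps)
       (simp add: power2_eq_square power_mult_distrib)
  have sm: "strict_mono ((*) (2::nat))"
    by (simp add: strict_mono_def)
  have z: "\<bar>fps_nth gauss_fps n\<bar> * c ^ n = 0" if "n \<notin> range ((*) 2)" for n
    using that by (auto simp: gauss_fps_def)
  show ?thesis
    using exp_converges[of "c\<^sup>2 / 2"]
    by (subst sums_mono_reindex[OF sm, symmetric]) (use z eq in auto)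
qed

text \<open>Cauchy product of the series of the two exponential factors. A general normed field is
  allowed because completeness evaluates it at the imaginary point
  \<open>c = \<i> * t\<close>.\<close>

lemma hermite_generating_function:
  fixes c :: "'a :: {banach, real_normed_field}"
  shows "(\<lambda>k. of_real (hermite k z / fact k) * c ^ k) sums exp (c * of_real z - c\<^sup>2 / 2)"
proof -
  let ?A = "\<lambda>k. (c * of_real z) ^ k /\<^sub>R fact k" and ?B = "\<lambda>k. of_real (fps_nth gauss_fps k) * c ^ k"
  have "(\<lambda>k. \<Sum>i\<le>k. ?A i * ?B (k - i)) sums ((\<Sum>k. ?A k) * (\<Sum>k. ?B k))"
    by (intro Cauchy_product_sums summable_norm_exp gauss_fps_sums)
  also have "(\<Sum>k. ?A k) * (\<Sum>k. ?B k) = exp (c * of_real z) * exp (- (c\<^sup>2 / 2))"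
    using gauss_fps_sums(1)[of c] exp_converges[of "c * of_real z"] by (simp add: sums_iff)
  also have "(\<lambda>k. \<Sum>i\<le>k. ?A i * ?B (k - i)) = (\<lambda>k. of_real (hermite k z / fact k) * c ^ k)"
  proof
    fix k
    have "(\<Sum>i\<le>k. ?A i * ?B (k - i))
        = (\<Sum>i\<le>k. of_real (z ^ i / fact i * fps_nth gauss_fps (k - i)) * c ^ k)"
    proof (intro sum.cong refl)
      fix i assume "i \<in> {..k}"
      then have "c ^ k = c ^ i * c ^ (k - i)"
        by (simp flip: power_add)
      then show "?A i * ?B (k - i) = of_real (z ^ i / fact i * fps_nth gauss_fps (k - i)) * c ^ k"
        by (simp add: scaleR_conv_of_real power_mult_distrib field_simps)
    qed
    also have "\<dots> = of_real (hermite k z / fact k) * c ^ k"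
      by (simp add: hermite_eq hermite_fps_nth sum_distrib_right)
    finally show "(\<Sum>i\<le>k. ?A i * ?B (k - i)) = of_real (hermite k z / fact k) * c ^ k" .
  qed
  finally show ?thesis
    by (simp flip: exp_add)
qed

text \<open>One bound for all partial sums of absolute values, of a form that Gaussian weights
  integrate: it justifies exchanging the Hermite series with an integral in
  \<open>hermite_transform\<close>.\<close>

lemma hermite_sum_bound:
  assumes "0 \<le> r"
  shows "(\<Sum>k<n. \<bar>hermite k z\<bar> / fact k * r ^ k) \<le> exp (r * \<bar>z\<bar> + r\<^sup>2 / 2)"
proof -
  let ?A = "\<lambda>k. (r * \<bar>z\<bar>) ^ k /\<^sub>R fact k" and ?B = "\<lambda>k. \<bar>fps_nth gauss_fps k\<bar> * r ^ k"
  have B: "?B sums exp (r\<^sup>2 / 2)"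
    by (rule abs_gauss_fps_sums)
  have "(\<lambda>k. \<Sum>i\<le>k. ?A i * ?B (k - i)) sums ((\<Sum>k. ?A k) * (\<Sum>k. ?B k))"
    using sums_summable[OF B] assms
    by (intro Cauchy_product_sums summable_norm_exp) simp
  also have "(\<Sum>k. ?A k) * (\<Sum>k. ?B k) = exp (r * \<bar>z\<bar>) * exp (r\<^sup>2 / 2)"
    using B exp_converges[of "r * \<bar>z\<bar>"] by (simp add: sums_iff)
  finally have S: "(\<lambda>k. \<Sum>i\<le>k. ?A i * ?B (k - i)) sums exp (r * \<bar>z\<bar> + r\<^sup>2 / 2)"
    by (simp add: exp_add)
  have le: "\<bar>hermite k z\<bar> / fact k * r ^ k \<le> (\<Sum>i\<le>k. ?A i * ?B (k - i))" for k
  proof -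
    have "\<bar>hermite k z\<bar> / fact k * r ^ k = \<bar>\<Sum>i\<le>k. z ^ i / fact i * fps_nth gauss_fps (k - i)\<bar> * r ^ k"
      by (simp add: hermite_eq hermite_fps_nth abs_mult)
    also have "\<dots> \<le> (\<Sum>i\<le>k. \<bar>z ^ i / fact i * fps_nth gauss_fps (k - i)\<bar>) * r ^ k"
      using assms by (intro mult_right_mono sum_abs) simp
    also have "\<dots> = (\<Sum>i\<le>k. ?A i * ?B (k - i))"
      unfolding sum_distrib_right
    proof (intro sum.cong refl)
      fix i assume "i \<in> {..k}"
      then have "r ^ k = r ^ i * r ^ (k - i)"
        by (simp flip: power_add)
      then show "\<bar>z ^ i / fact i * fps_nth gauss_fps (k - i)\<bar> * r ^ k = ?A i * ?B (k - i)"
        by (simp add: abs_mult power_abs power_mult_distrib field_simps)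
    qed
    finally show ?thesis .
  qed
  have "(\<Sum>k<n. \<bar>hermite k z\<bar> / fact k * r ^ k) \<le> (\<Sum>k<n. \<Sum>i\<le>k. ?A i * ?B (k - i))"
    by (intro sum_mono le)
  also have "\<dots> \<le> (\<Sum>k. \<Sum>i\<le>k. ?A i * ?B (k - i))"
    using S assms by (intro sum_le_suminf sums_summable[OF S]) (auto intro!: sum_nonneg)
  finally show ?thesis using S by (simp add: sums_iff)
qed

lemma hermite_bound: "\<bar>hermite k z\<bar> \<le> fact k * exp (\<bar>z\<bar> + 1 / 2)"
proof -
  have "\<bar>hermite k z\<bar> / fact k * 1 ^ k \<le> (\<Sum>k<Suc k. \<bar>hermite k z\<bar> / fact k * 1 ^ k)"
    by (intro member_le_sum) auto
  also have "\<dots> \<le> exp (1 * \<bar>z\<bar> + 1\<^sup>2 / 2)"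
    by (rule hermite_sum_bound) simp
  finally show ?thesis by (simp add: field_simps)
qed

text \<open>Integrates the generating function against a weight \<open>W\<close>: up to factorials,
  the Hermite moments of \<open>W\<close> are the Taylor coefficients of an exponential transform of
  \<open>W\<close>. It is applied with exponentials, with Hermite polynomials and with a function
  orthogonal to all of them.\<close>

lemma hermite_transform:
  fixes W :: "'a \<Rightarrow> 'b :: {banach, real_normed_field, second_countable_topology}"
  assumes [measurable]: "W \<in> borel_measurable M" "Y \<in> borel_measurable M"
    and int: "\<And>r. 0 \<le> r \<Longrightarrow> integrable M (\<lambda>\<omega>. norm (W \<omega>) * exp (r * \<bar>Y \<omega>\<bar>))"
  shows "integrable M (\<lambda>\<omega>. W \<omega> * of_real (hermite k (Y \<omega>)))"
    and "(\<lambda>k. (\<integral>\<omega>. W \<omega> * of_real (hermite k (Y \<omega>)) \<partial>M) / fact k * c ^ k)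
           sums (\<integral>\<omega>. W \<omega> * exp (c * of_real (Y \<omega>) - c\<^sup>2 / 2) \<partial>M)"
proof -
  show int1: "integrable M (\<lambda>\<omega>. W \<omega> * of_real (hermite k (Y \<omega>)))" for k
  proof (rule Bochner_Integration.integrable_bound)
    show "integrable M (\<lambda>\<omega>. fact k * exp (1/2) * (norm (W \<omega>) * exp (1 * \<bar>Y \<omega>\<bar>)))"
      by (intro integrable_mult_right int) simp
    have "norm (W \<omega> * of_real (hermite k (Y \<omega>))) \<le> norm (W \<omega>) * (fact k * exp (\<bar>Y \<omega>\<bar> + 1 / 2))" for \<omega>
      using hermite_bound[of k "Y \<omega>"] by (simp add: norm_mult mult_left_mono)
    then show "AE \<omega> in M. norm (W \<omega> * of_real (hermite k (Y \<omega>)))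
        \<le> norm (fact k * exp (1/2) * (norm (W \<omega>) * exp (1 * \<bar>Y \<omega>\<bar>)))"
      by (auto simp: exp_add mult_ac)
  qed measurable
  let ?f = "\<lambda>k \<omega>. W \<omega> * of_real (hermite k (Y \<omega>)) / fact k * c ^ k"
  have intf: "integrable M (?f k)" for k
    using int1[of k] by simp
  have ptw: "(\<lambda>k. ?f k \<omega>) sums (W \<omega> * exp (c * of_real (Y \<omega>) - c\<^sup>2 / 2))" for \<omega>
    using sums_mult[OF hermite_generating_function[of "Y \<omega>" c], of "W \<omega>"] by (simp add: mult_ac)
  have nrm: "(\<Sum>k<n. norm (?f k \<omega>)) \<le> norm (W \<omega>) * exp (norm c * \<bar>Y \<omega>\<bar>) * exp ((norm c)\<^sup>2 / 2)" for n \<omega>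
  proof -
    have "(\<Sum>k<n. norm (?f k \<omega>)) = norm (W \<omega>) * (\<Sum>k<n. \<bar>hermite k (Y \<omega>)\<bar> / fact k * norm c ^ k)"
      by (simp add: sum_distrib_left norm_mult norm_divide norm_power mult_ac)
    also have "\<dots> \<le> norm (W \<omega>) * exp (norm c * \<bar>Y \<omega>\<bar> + (norm c)\<^sup>2 / 2)"
      by (intro mult_left_mono hermite_sum_bound) auto
    finally show ?thesis by (simp add: exp_add mult.assoc)
  qed
  have "(\<lambda>k. integral\<^sup>L M (?f k)) sums (\<integral>\<omega>. (\<Sum>k. ?f k \<omega>) \<partial>M)"
  proof (rule sums_integral)
    show "AE \<omega> in M. summable (\<lambda>k. norm (?f k \<omega>))"
      by (intro AE_I2 summableI_nonneg_bounded[OF _ nrm]) auto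
    have "(\<Sum>k<n. \<integral>\<omega>. norm (?f k \<omega>) \<partial>M) \<le> (\<integral>\<omega>. norm (W \<omega>) * exp (norm c * \<bar>Y \<omega>\<bar>) * exp ((norm c)\<^sup>2 / 2) \<partial>M)" for n
    proof -
      have "(\<Sum>k<n. \<integral>\<omega>. norm (?f k \<omega>) \<partial>M) = (\<integral>\<omega>. (\<Sum>k<n. norm (?f k \<omega>)) \<partial>M)"
        using intf by (intro Bochner_Integration.integral_sum[symmetric] integrable_norm)
      also have "\<dots> \<le> (\<integral>\<omega>. norm (W \<omega>) * exp (norm c * \<bar>Y \<omega>\<bar>) * exp ((norm c)\<^sup>2 / 2) \<partial>M)"
        by (intro integral_mono nrm Bochner_Integration.integrable_sum integrable_norm intf integrable_mult_left int) auto
      finally show ?thesis .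
    qed
    then show "summable (\<lambda>k. \<integral>\<omega>. norm (?f k \<omega>) \<partial>M)"
      by (intro summableI_nonneg_bounded) auto
  qed (rule intf)
  also have "(\<integral>\<omega>. (\<Sum>k. ?f k \<omega>) \<partial>M) = (\<integral>\<omega>. W \<omega> * exp (c * of_real (Y \<omega>) - c\<^sup>2 / 2) \<partial>M)"
    using ptw by (simp add: sums_iff)
  also have "(\<lambda>k. integral\<^sup>L M (?f k)) = (\<lambda>k. (\<integral>\<omega>. W \<omega> * of_real (hermite k (Y \<omega>)) \<partial>M) / fact k * c ^ k)"
    by simp
  finally show "(\<lambda>k. (\<integral>\<omega>. W \<omega> * of_real (hermite k (Y \<omega>)) \<partial>M) / fact k * c ^ k)
           sums (\<integral>\<omega>. W \<omega> * exp (c * of_real (Y \<omega>) - c\<^sup>2 / 2) \<partial>M)" .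
qed

text \<open>Once the lower coefficients of the difference vanish, division by \<open>c ^ n\<close>
  leaves a series that is zero for all \<open>c \<noteq> 0\<close> and whose limit at
  \<open>0\<close> is the coefficient in question.\<close>

lemma powser_coeff_unique:
  fixes f g :: "nat \<Rightarrow> real"
  assumes "\<And>c. (\<lambda>k. f k * c ^ k) sums h c" and "\<And>c. (\<lambda>k. g k * c ^ k) sums h c"
  shows "f n = g n"
proof -
  define d where "d k = f k - g k" for k
  have d: "(\<lambda>k. d k * c ^ k) sums 0" for c
    using sums_diff[OF assms, of c c] by (simp add: d_def algebra_simps)
  have "d n = 0"
  proof (induction n rule: less_induct)
    case (less n)
    have "(\<lambda>k. d (k + n) * c ^ k) sums 0" if "c \<noteq> 0" for c
    proof -
      have "(\<lambda>k. d (k + n) * c ^ (k + n)) sums (0 - (\<Sum>i<n. d i * c ^ i))"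
        using d[of c] by (rule sums_split_initial_segment)
      then have "(\<lambda>k. c ^ n * (d (k + n) * c ^ k)) sums 0"
        using less by (simp add: power_add mult_ac)
      then show ?thesis
        using that sums_mult_iff[of "c ^ n" "\<lambda>k. d (k + n) * c ^ k" 0] by simp
    qed
    then have "((\<lambda>x::real. 0::real) \<longlongrightarrow> d (0 + n)) (at 0)"
      by (intro powser_limit_0_strong[of 1 "\<lambda>k. d (k + n)" "\<lambda>_. 0"]) auto
    then have "((\<lambda>x::real. 0::real) \<longlongrightarrow> d n) (at 0)" by simp
    from LIM_const_eq[OF this] show ?case by simp
  qed
  then show ?thesis by (simp add: d_def)
qed

lemma exp_abs_le: "exp (r * \<bar>x\<bar>) \<le> exp (r * x) + exp (- r * x)" for r x :: real
  by (cases "0 \<le> x") simp_all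

text \<open>Turns two-sided exponential moments, which the moment generating function provides, into
  the moments with \<open>\<bar>X \<omega>\<bar>\<close> that \<open>hermite_transform\<close>
  demands.\<close>

lemma integrable_exp_abs:
  fixes X :: "'a \<Rightarrow> real"
  assumes [measurable]: "X \<in> borel_measurable M" "W \<in> borel_measurable M"
    and "integrable M (\<lambda>\<omega>. \<bar>W \<omega>\<bar> * exp (r * X \<omega>))" "integrable M (\<lambda>\<omega>. \<bar>W \<omega>\<bar> * exp (- r * X \<omega>))"
  shows "integrable M (\<lambda>\<omega>. \<bar>W \<omega>\<bar> * exp (r * \<bar>X \<omega>\<bar>))"
proof (rule Bochner_Integration.integrable_bound[OF Bochner_Integration.integrable_add[OF assms(3,4)]])
  have "norm (\<bar>W \<omega>\<bar> * exp (r * \<bar>X \<omega>\<bar>)) \<le> norm (\<bar>W \<omega>\<bar> * exp (r * X \<omega>) + \<bar>W \<omega>\<bar> * exp (- r * X \<omega>))" for \<omega>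
  proof -
    have "norm (\<bar>W \<omega>\<bar> * exp (r * \<bar>X \<omega>\<bar>)) = \<bar>W \<omega>\<bar> * exp (r * \<bar>X \<omega>\<bar>)"
      by (simp only: real_norm_def abs_mult abs_exp_cancel abs_abs)
    also have "\<dots> \<le> \<bar>W \<omega>\<bar> * (exp (r * X \<omega>) + exp (- r * X \<omega>))"
      by (intro mult_left_mono exp_abs_le abs_ge_zero)
    also have "\<dots> = \<bar>W \<omega>\<bar> * exp (r * X \<omega>) + \<bar>W \<omega>\<bar> * exp (- r * X \<omega>)"
      by (rule distrib_left)
    also have "\<dots> \<le> norm \<dots>"
      by (simp only: real_norm_def abs_ge_self)
    finally show ?thesis .
  qed
  then show "AE \<omega> in M. norm (\<bar>W \<omega>\<bar> * exp (r * \<bar>X \<omega>\<bar>))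
      \<le> norm (\<bar>W \<omega>\<bar> * exp (r * X \<omega>) + \<bar>W \<omega>\<bar> * exp (- r * X \<omega>))"
    by (rule AE_I2)
  show "(\<lambda>\<omega>. \<bar>W \<omega>\<bar> * exp (r * \<bar>X \<omega>\<bar>)) \<in> borel_measurable M"
    using assms(1,2) by simp
qed

text \<open>Compares coefficients in the generating function of the pair, one variable at a time.
  Only the moment generating function is assumed, so that singular pairs, in particular
  \<open>X = Y\<close> with \<open>\<rho> = 1\<close>, are included.\<close>

lemma hermite_product_moments:
  fixes X Y :: "'a \<Rightarrow> real"
  assumes [measurable]: "X \<in> borel_measurable M" "Y \<in> borel_measurable M"
    and int: "\<And>a b. integrable M (\<lambda>\<omega>. exp (a * X \<omega> + b * Y \<omega>))"
    and mgf: "\<And>a b. (\<integral>\<omega>. exp (a * X \<omega> + b * Y \<omega>) \<partial>M) = exp ((a\<^sup>2 + b\<^sup>2 + 2 * \<rho> * a * b) / 2)"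
  shows "integrable M (\<lambda>\<omega>. hermite j (X \<omega>) * hermite k (Y \<omega>))"
    and "(\<integral>\<omega>. hermite j (X \<omega>) * hermite k (Y \<omega>) \<partial>M) = (if j = k then fact k * \<rho> ^ k else 0)"
proof -
  have int1: "integrable M (\<lambda>\<omega>. \<bar>exp (b * Y \<omega> - b\<^sup>2 / 2)\<bar> * exp (r * X \<omega>))" for b r
  proof -
    have eq: "\<bar>exp (b * Y \<omega> - b\<^sup>2 / 2)\<bar> * exp (r * X \<omega>) = exp (- (b\<^sup>2 / 2)) * exp (r * X \<omega> + b * Y \<omega>)" for \<omega>
      by (simp flip: exp_add add: algebra_simps)
    show ?thesis
      unfolding eq by (intro integrable_mult_right int)
  qed
  \<comment> \<open>With an exponential weight in \<open>Y\<close> the generating function in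
    \<open>c\<close> is \<open>exp (c * (b * \<rho>))\<close>, after the normalising factors have
    cancelled.\<close>
  have E1: "(\<integral>\<omega>. exp (b * Y \<omega> - b\<^sup>2 / 2) * hermite j (X \<omega>) \<partial>M) / fact j = (b * \<rho>) ^ j / fact j" for b j
  proof (rule powser_coeff_unique)
    fix c
    have "(\<lambda>k. (\<integral>\<omega>. exp (b * Y \<omega> - b\<^sup>2 / 2) * hermite k (X \<omega>) \<partial>M) / fact k * c ^ k)
       sums (\<integral>\<omega>. exp (b * Y \<omega> - b\<^sup>2 / 2) * exp (c * X \<omega> - c\<^sup>2 / 2) \<partial>M)"
      using hermite_transform(2)[of "\<lambda>\<omega>. exp (b * Y \<omega> - b\<^sup>2 / 2)" M X c] integrable_exp_abs[OF _ _ int1 int1]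
      by simp
    also have "(\<integral>\<omega>. exp (b * Y \<omega> - b\<^sup>2 / 2) * exp (c * X \<omega> - c\<^sup>2 / 2) \<partial>M)
        = (\<integral>\<omega>. exp (- (b\<^sup>2 + c\<^sup>2) / 2) * exp (c * X \<omega> + b * Y \<omega>) \<partial>M)"
      by (intro Bochner_Integration.integral_cong refl) (simp flip: exp_add add: field_simps)
    also have "\<dots> = exp (- (b\<^sup>2 + c\<^sup>2) / 2) * exp ((c\<^sup>2 + b\<^sup>2 + 2 * \<rho> * c * b) / 2)"
      by (simp add: mgf)
    also have "\<dots> = exp (c * (b * \<rho>))"
      by (simp flip: exp_add add: field_simps)
    finally show "(\<lambda>k. (\<integral>\<omega>. exp (b * Y \<omega> - b\<^sup>2 / 2) * hermite k (X \<omega>) \<partial>M) / fact k * c ^ k) sums exp (c * (b * \<rho>))" .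
    show "(\<lambda>k. (b * \<rho>) ^ k / fact k * c ^ k) sums exp (c * (b * \<rho>))"
      using exp_converges[of "c * (b * \<rho>)"] by (simp add: power_mult_distrib field_simps)
  qed
  have int2: "integrable M (\<lambda>\<omega>. \<bar>hermite j (X \<omega>)\<bar> * exp (r * Y \<omega>))" for j r
  proof (rule Bochner_Integration.integrable_bound)
    have "integrable M (\<lambda>\<omega>. \<bar>exp (r * Y \<omega>)\<bar> * exp (s * X \<omega>))" for s
      using int[of s r] by (simp add: exp_add mult.commute)
    then show "integrable M (\<lambda>\<omega>. fact j * exp (1/2) * (\<bar>exp (r * Y \<omega>)\<bar> * exp (1 * \<bar>X \<omega>\<bar>)))"
      by (intro integrable_mult_right integrable_exp_abs) measurable
    have "\<bar>hermite j (X \<omega>)\<bar> * exp (r * Y \<omega>) \<le> fact j * exp (\<bar>X \<omega>\<bar> + 1/2) * exp (r * Y \<omega>)" for \<omega>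
      by (intro mult_right_mono hermite_bound) simp
    then show "AE \<omega> in M. norm (\<bar>hermite j (X \<omega>)\<bar> * exp (r * Y \<omega>))
        \<le> norm (fact j * exp (1/2) * (\<bar>exp (r * Y \<omega>)\<bar> * exp (1 * \<bar>X \<omega>\<bar>)))"
      by (simp add: exp_add mult_ac abs_mult)
  qed measurable
  have int3: "integrable M (\<lambda>\<omega>. norm (hermite j (X \<omega>)) * exp (r * \<bar>Y \<omega>\<bar>))" for j r
    using integrable_exp_abs[OF _ _ int2 int2] by simp
  show "integrable M (\<lambda>\<omega>. hermite j (X \<omega>) * hermite k (Y \<omega>))"
    using hermite_transform(1)[of "\<lambda>\<omega>. hermite j (X \<omega>)" M Y k] int3 by simp
  \<comment> \<open>By \<open>E1\<close> the generating function in the second variable is the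
    single monomial \<open>(c * \<rho>) ^ j\<close>, whence the orthogonality.\<close>
  have "(\<integral>\<omega>. hermite j (X \<omega>) * hermite k (Y \<omega>) \<partial>M) / fact k = (if k = j then \<rho> ^ j else 0)"
  proof (rule powser_coeff_unique[where n = k and h = "\<lambda>c. (c * \<rho>) ^ j"
        and f = "\<lambda>k. (\<integral>\<omega>. hermite j (X \<omega>) * hermite k (Y \<omega>) \<partial>M) / fact k"
        and g = "\<lambda>k. if k = j then \<rho> ^ j else 0"])
    fix c
    have "(\<lambda>k. (\<integral>\<omega>. hermite j (X \<omega>) * hermite k (Y \<omega>) \<partial>M) / fact k * c ^ k)
       sums (\<integral>\<omega>. hermite j (X \<omega>) * exp (c * Y \<omega> - c\<^sup>2 / 2) \<partial>M)"
      using hermite_transform(2)[of "\<lambda>\<omega>. hermite j (X \<omega>)" M Y c] int3 by simp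
    also have "(\<integral>\<omega>. hermite j (X \<omega>) * exp (c * Y \<omega> - c\<^sup>2 / 2) \<partial>M) = (c * \<rho>) ^ j"
      using E1[of c j] by (simp add: mult.commute)
    finally show "(\<lambda>k. (\<integral>\<omega>. hermite j (X \<omega>) * hermite k (Y \<omega>) \<partial>M) / fact k * c ^ k) sums ((c * \<rho>) ^ j)" .
    show "(\<lambda>k. (if k = j then \<rho> ^ j else 0) * c ^ k) sums ((c * \<rho>) ^ j)"
    proof -
      have "(\<lambda>k. (if k = j then \<rho> ^ j else 0) * c ^ k) = (\<lambda>k. if k = j then (c * \<rho>) ^ k else 0)"
        by (auto simp: power_mult_distrib)
      then show ?thesis
        using sums_single[of j "\<lambda>k. (c * \<rho>) ^ k"] by simp
    qed
  qed
  then show "(\<integral>\<omega>. hermite j (X \<omega>) * hermite k (Y \<omega>) \<partial>M) = (if j = k then fact k * \<rho> ^ k else 0)"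
    by (auto simp: field_simps split: if_splits)
qed


section \<open>Completeness in the Gaussian space\<close>

interpretation std_normal: real_distribution std_normal_distribution
  by (rule real_dist_normal_dist)

lemma std_normal_exp:
  "integrable std_normal_distribution (\<lambda>x. exp (r * x))"
  "(\<integral>x. exp (r * x) \<partial>std_normal_distribution) = exp (r\<^sup>2 / 2)"
proof -
  have eq: "std_normal_density x * exp (r * x) = exp (r\<^sup>2 / 2) * normal_density r 1 x" for x
    by (simp add: normal_density_def power2_diff exp_add[symmetric] diff_divide_distrib add_divide_distrib algebra_simps)
  show "integrable std_normal_distribution (\<lambda>x. exp (r * x))"
    by (subst integrable_real_density) (auto simp: eq)
  show "(\<integral>x. exp (r * x) \<partial>std_normal_distribution) = exp (r\<^sup>2 / 2)"
    by (subst integral_real_density) (auto simp: eq)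
qed

lemma std_normal_exp_abs: "integrable std_normal_distribution (\<lambda>x. exp (r * \<bar>x\<bar>))"
proof -
  have "integrable std_normal_distribution (\<lambda>x. \<bar>1\<bar> * exp (r * \<bar>x\<bar>))"
    by (rule integrable_exp_abs) (simp_all only: abs_one mult_1_left std_normal_exp borel_measurable_const, simp)
  then show ?thesis by simp
qed

text \<open>The pair \<open>(x, x)\<close> has correlation 1; the factor \<open>1\<close> in the
  exponent makes the statement fit \<open>hermite_product_moments\<close>.\<close>

lemma std_normal_exp2:
  "integrable std_normal_distribution (\<lambda>x. exp (a * x + b * x))"
  "(\<integral>x. exp (a * x + b * x) \<partial>std_normal_distribution) = exp ((a\<^sup>2 + b\<^sup>2 + 2 * 1 * a * b) / 2)"
proof -
  have eq: "a * x + b * x = (a + b) * x" for x :: real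
    by (simp add: algebra_simps)
  show "integrable std_normal_distribution (\<lambda>x. exp (a * x + b * x))"
    unfolding eq by (rule std_normal_exp)
  show "(\<integral>x. exp (a * x + b * x) \<partial>std_normal_distribution) = exp ((a\<^sup>2 + b\<^sup>2 + 2 * 1 * a * b) / 2)"
    unfolding eq std_normal_exp by (simp add: power2_sum)
qed

lemma std_normal_hermite:
  shows "integrable std_normal_distribution (\<lambda>x. hermite j x * hermite k x)"
    and "(\<integral>x. hermite j x * hermite k x \<partial>std_normal_distribution) = (if j = k then fact k else 0)"
proof -
  have "(\<lambda>x::real. x) \<in> borel_measurable std_normal_distribution" by measurable
  note * = hermite_product_moments[OF this this std_normal_exp2]
  show "integrable std_normal_distribution (\<lambda>x. hermite j x * hermite k x)"
    by (rule *(1))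
  show "(\<integral>x. hermite j x * hermite k x \<partial>std_normal_distribution) = (if j = k then fact k else 0)"
    using *(2)[of j k] by (simp only: power_one mult_1_right)
qed

section \<open>Products of square-integrable functions and completeness\<close>

lemma integrable_mult_L2:
  fixes f g :: "'a \<Rightarrow> real"
  assumes [measurable]: "f \<in> borel_measurable M" "g \<in> borel_measurable M"
    and "integrable M (\<lambda>x. (f x)\<^sup>2)" "integrable M (\<lambda>x. (g x)\<^sup>2)"
  shows "integrable M (\<lambda>x. f x * g x)"
proof (rule Bochner_Integration.integrable_bound[OF Bochner_Integration.integrable_add[OF assms(3,4)]])
  have "\<bar>f x * g x\<bar> \<le> (f x)\<^sup>2 + (g x)\<^sup>2" for x
    using sum_squares_bound[of "\<bar>f x\<bar>" "\<bar>g x\<bar>"] abs_ge_zero[of "f x * g x"]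
    unfolding abs_mult power2_abs by linarith
  then show "AE x in M. norm (f x * g x) \<le> norm ((f x)\<^sup>2 + (g x)\<^sup>2)"
    by (intro AE_I2) simp
qed measurable

lemma Cauchy_Schwarz_integral:
  fixes f g :: "'a \<Rightarrow> real"
  assumes [measurable]: "f \<in> borel_measurable M" "g \<in> borel_measurable M"
    and f: "integrable M (\<lambda>x. (f x)\<^sup>2)" and g: "integrable M (\<lambda>x. (g x)\<^sup>2)"
  shows "(\<integral>x. f x * g x \<partial>M)\<^sup>2 \<le> (\<integral>x. (f x)\<^sup>2 \<partial>M) * (\<integral>x. (g x)\<^sup>2 \<partial>M)"
proof -
  define A B C where "A = (\<integral>x. (f x)\<^sup>2 \<partial>M)" and "B = (\<integral>x. f x * g x \<partial>M)" and "C = (\<integral>x. (g x)\<^sup>2 \<partial>M)"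
  have fg: "integrable M (\<lambda>x. f x * g x)"
    by (rule integrable_mult_L2) fact+
  have pos: "0 \<le> A - 2 * t * B + t\<^sup>2 * C" for t
  proof -
    have "0 \<le> (\<integral>x. (f x - t * g x)\<^sup>2 \<partial>M)" by simp
    also have "\<dots> = (\<integral>x. (f x)\<^sup>2 - 2 * t * (f x * g x) + t\<^sup>2 * (g x)\<^sup>2 \<partial>M)"
      by (intro Bochner_Integration.integral_cong refl) (simp add: power2_eq_square algebra_simps)
    also have "\<dots> = A - 2 * t * B + t\<^sup>2 * C"
      using f g fg by (simp add: A_def B_def C_def)
    finally show ?thesis .
  qed
  show ?thesis
  proof (cases "C = 0")
    case True
    have "B = 0"
    proof (rule ccontr)
      assume "B \<noteq> 0"
      \<comment> \<open>At this point the quadratic, which is linear because \<open>C = 0\<close>,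
        has the value \<open>-1\<close>.\<close>
      then show False using pos[of "(A + 1) / (2 * B)"] True by simp
    qed
    then show ?thesis using True by (simp add: B_def C_def)
  next
    case False
    then have "C > 0" by (simp add: C_def less_le)
    \<comment> \<open>\<open>B / C\<close> minimises the quadratic.\<close>
    then have "B\<^sup>2 \<le> A * C"
      using pos[of "B / C"] by (simp add: field_simps power2_eq_square)
    then show ?thesis by (simp add: A_def B_def C_def)
  qed
qed

lemma (in prob_space) integrable_L2_exp:
  fixes h Y :: "'a \<Rightarrow> real"
  assumes [measurable]: "h \<in> borel_measurable M" "Y \<in> borel_measurable M"
    and "integrable M (\<lambda>x. (h x)\<^sup>2)" and e: "\<And>r. integrable M (\<lambda>x. exp (r * \<bar>Y x\<bar>))"
  shows "integrable M (\<lambda>x. \<bar>h x\<bar> * exp (r * \<bar>Y x\<bar>))"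
proof (rule integrable_mult_L2)
  show "integrable M (\<lambda>x. (exp (r * \<bar>Y x\<bar>))\<^sup>2)"
    using e[of "2 * r"] by (simp add: power2_eq_square exp_add[symmetric] algebra_simps)
qed (use assms in auto)

lemma char_density:
  fixes p :: "real \<Rightarrow> real"
  assumes [measurable]: "p \<in> borel_measurable borel" and "\<And>x. 0 \<le> p x"
  shows "char (density std_normal_distribution p) t = (\<integral>x. of_real (p x) * iexp (t * x) \<partial>std_normal_distribution)"
  unfolding char_def using assms(2)
  by (subst integral_density) (auto simp: scaleR_conv_of_real)

text \<open>If all Hermite coefficients of \<open>h\<close> vanish, so does the Fourier transform of \<open>h\<close> times the
  normal density; hence its positive and its negative part have the same Fourier transform.\<close>

lemma hermite_complete:
  assumes [measurable]: "h \<in> borel_measurable borel"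
    and h2: "integrable std_normal_distribution (\<lambda>x. (h x)\<^sup>2)" and orth: "\<And>k. (\<integral>x. h x * hermite k x \<partial>std_normal_distribution) = 0"
  shows "AE x in std_normal_distribution. h x = 0"
proof -
  have h: "integrable std_normal_distribution h"
    using std_normal.square_integrable_imp_integrable[of h] h2 by simp
  have he: "integrable std_normal_distribution (\<lambda>x. \<bar>h x\<bar> * exp (r * \<bar>x\<bar>))" for r
    using h2 by (intro std_normal.integrable_L2_exp std_normal_exp_abs) auto
  \<comment> \<open>At the imaginary point \<open>c = \<i> * t\<close> all Taylor coefficients
    vanish, and the constant factor \<open>exp (t\<^sup>2 / 2)\<close> can be divided out.\<close>
  have four: "(\<integral>x. of_real (h x) * iexp (t * x) \<partial>std_normal_distribution) = 0" for t
  proof -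
    have "(\<lambda>k. (\<integral>x. of_real (h x) * of_real (hermite k x) \<partial>std_normal_distribution) / fact k * (\<i> * of_real t) ^ k)
      sums (\<integral>x. of_real (h x) * exp ((\<i> * of_real t) * of_real x - (\<i> * of_real t)\<^sup>2 / 2) \<partial>std_normal_distribution)"
      by (rule hermite_transform(2)) (use he in auto)
    moreover have "(\<integral>x. of_real (h x) * of_real (hermite k x) \<partial>std_normal_distribution) = (0::complex)" for k
      using orth[of k] by (simp flip: of_real_mult)
    ultimately have "(\<integral>x. of_real (h x) * exp ((\<i> * of_real t) * of_real x - (\<i> * of_real t)\<^sup>2 / 2) \<partial>std_normal_distribution) = 0"
      using sums_unique2[OF sums_zero] by simp
    also have "(\<integral>x. of_real (h x) * exp ((\<i> * of_real t) * of_real x - (\<i> * of_real t)\<^sup>2 / 2) \<partial>std_normal_distribution)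
        = (\<integral>x. (of_real (h x) * iexp (t * x)) * exp (- (\<i> * of_real t)\<^sup>2 / 2) \<partial>std_normal_distribution)"
      by (intro Bochner_Integration.integral_cong refl) (auto simp: power_mult_distrib mult_ac simp flip: exp_add)
    finally show ?thesis by simp
  qed
  define p n where "p x = max 0 (h x)" and "n x = max 0 (- h x)" for x
  have [measurable]: "p \<in> borel_measurable borel" "n \<in> borel_measurable borel"
    by (simp_all add: p_def[abs_def] n_def[abs_def])
  have pn: "0 \<le> p x" "0 \<le> n x" "h x = p x - n x" "p x * n x = 0" for x
    by (auto simp: p_def n_def)
  have int: "integrable std_normal_distribution p" "integrable std_normal_distribution n"
    using h by (simp_all add: p_def[abs_def] n_def[abs_def])
  define C where "C = (\<integral>x. p x \<partial>std_normal_distribution)"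
  \<comment> \<open>\<open>hermite 0\<close> is constant, so orthogonality at \<open>k = 0\<close>
    gives both parts the same mass. If it is positive, dividing by it yields two probability laws to
    which Levy's uniqueness theorem applies.\<close>
  have C': "C = (\<integral>x. n x \<partial>std_normal_distribution)"
    using orth[of 0] int by (simp add: C_def pn(3))
  have bound: "integrable std_normal_distribution (\<lambda>x. complex_of_real (u x) * iexp (t * x))" if "integrable std_normal_distribution u" for u t
  proof (rule Bochner_Integration.integrable_bound[OF that])
    show "(\<lambda>x. complex_of_real (u x) * iexp (t * x)) \<in> borel_measurable std_normal_distribution"
      using borel_measurable_integrable[OF that] by simp
  qed (simp add: norm_mult)
  show ?thesis
  proof (cases "C = 0")
    case True
    have "AE x in std_normal_distribution. p x = 0"
      using integral_nonneg_eq_0_iff_AE[OF int(1)] pn(1) True by (simp add: C_def)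
    moreover have "AE x in std_normal_distribution. n x = 0"
      using integral_nonneg_eq_0_iff_AE[OF int(2)] pn(2) True C' by simp
    ultimately show ?thesis by eventually_elim (simp add: pn)
  next
    case False
    moreover have "C \<ge> 0" using pn by (simp add: C_def)
    ultimately have C: "C > 0" by simp
    have prob: "real_distribution (density std_normal_distribution (\<lambda>x. u x / C))"
      if "integrable std_normal_distribution u" "\<And>x. 0 \<le> u x" "(\<integral>x. u x \<partial>std_normal_distribution) = C" "u \<in> borel_measurable borel" for u
    proof -
      have "emeasure (density std_normal_distribution (\<lambda>x. u x / C)) (space (density std_normal_distribution (\<lambda>x. u x / C))) = (\<integral>\<^sup>+x. ennreal (u x / C) \<partial>std_normal_distribution)"
        using that by (subst emeasure_density) (auto intro!: nn_integral_cong)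
      also have "\<dots> = ennreal (\<integral>x. u x / C \<partial>std_normal_distribution)"
        using that C by (intro nn_integral_eq_integral) auto
      also have "\<dots> = 1" using that C by simp
      finally have "prob_space (density std_normal_distribution (\<lambda>x. u x / C))" by (rule prob_spaceI)
      then show ?thesis
        by (simp add: real_distribution_def real_distribution_axioms_def)
    qed
    have "char (density std_normal_distribution (\<lambda>x. p x / C)) = char (density std_normal_distribution (\<lambda>x. n x / C))"
    proof
      fix t
      have "(\<integral>x. of_real (p x) * iexp (t * x) \<partial>std_normal_distribution) - (\<integral>x. of_real (n x) * iexp (t * x) \<partial>std_normal_distribution) = 0"
        using four[of t] bound[OF int(1), of t] bound[OF int(2), of t]
        by (simp add: pn(3) left_diff_distrib)
      then have "(\<integral>x. of_real (p x) * iexp (t * x) / of_real C \<partial>std_normal_distribution) = (\<integral>x. of_real (n x) * iexp (t * x) / of_real C \<partial>std_normal_distribution)"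
        by simp
      then show "char (density std_normal_distribution (\<lambda>x. p x / C)) t = char (density std_normal_distribution (\<lambda>x. n x / C)) t"
        using pn C by (subst (1 2) char_density) (auto simp: field_simps)
    qed
    with prob int pn C' have "density std_normal_distribution (\<lambda>x. p x / C) = density std_normal_distribution (\<lambda>x. n x / C)"
      by (intro Levy_uniqueness) (auto simp: C_def)
    then have "AE x in std_normal_distribution. ennreal (p x / C) = ennreal (n x / C)"
      using prob[OF int(1) pn(1)] int C pn
      by (subst (asm) finite_density_unique) (auto simp: nn_integral_eq_integral)
    then show ?thesis
      by eventually_elim (use pn C in \<open>auto simp: ennreal_inj\<close>)
  qed
qed

section \<open>Hermite expansions of square-integrable functions\<close>

lemma L2_diff:
  fixes f g :: "'a \<Rightarrow> real"
  assumes [measurable]: "f \<in> borel_measurable M" "g \<in> borel_measurable M"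
    and "integrable M (\<lambda>x. (f x)\<^sup>2)" "integrable M (\<lambda>x. (g x)\<^sup>2)"
  shows "integrable M (\<lambda>x. (f x - g x)\<^sup>2)"
proof -
  have "integrable M (\<lambda>x. (f x)\<^sup>2 + (g x)\<^sup>2 - 2 * (f x * g x))"
    using assms integrable_mult_L2[OF assms] by simp
  then show ?thesis by (simp add: power2_diff algebra_simps)
qed

lemma hermite_sum_sq:
  assumes "finite A"
  shows "integrable std_normal_distribution (\<lambda>x. (\<Sum>k\<in>A. u k * hermite k x)\<^sup>2)"
    and "(\<integral>x. (\<Sum>k\<in>A. u k * hermite k x)\<^sup>2 \<partial>std_normal_distribution) = (\<Sum>k\<in>A. (u k)\<^sup>2 * fact k)"
proof -
  have eq: "(\<lambda>x. (\<Sum>k\<in>A. u k * hermite k x)\<^sup>2)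
      = (\<lambda>x. \<Sum>j\<in>A. \<Sum>k\<in>A. u j * u k * (hermite j x * hermite k x))"
    by (simp add: power2_eq_square sum_product mult_ac)
  show "integrable std_normal_distribution (\<lambda>x. (\<Sum>k\<in>A. u k * hermite k x)\<^sup>2)"
    unfolding eq by (intro Bochner_Integration.integrable_sum integrable_mult_right std_normal_hermite)
  have "(\<integral>x. (\<Sum>k\<in>A. u k * hermite k x)\<^sup>2 \<partial>std_normal_distribution)
      = (\<Sum>j\<in>A. \<Sum>k\<in>A. \<integral>x. u j * u k * (hermite j x * hermite k x) \<partial>std_normal_distribution)"
    unfolding eq by (subst Bochner_Integration.integral_sum;
        intro Bochner_Integration.integrable_sum integrable_mult_right std_normal_hermite sum.cong refl)
       (intro Bochner_Integration.integral_sum integrable_mult_right std_normal_hermite)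
  also have "\<dots> = (\<Sum>j\<in>A. \<Sum>k\<in>A. if j = k then (u k)\<^sup>2 * fact k else 0)"
    by (intro sum.cong refl) (simp add: std_normal_hermite power2_eq_square)
  also have "\<dots> = (\<Sum>k\<in>A. (u k)\<^sup>2 * fact k)"
    using assms by (simp add: sum.delta)
  finally show "(\<integral>x. (\<Sum>k\<in>A. u k * hermite k x)\<^sup>2 \<partial>std_normal_distribution) = (\<Sum>k\<in>A. (u k)\<^sup>2 * fact k)" .
qed

lemma std_normal_abs_le:
  assumes [measurable]: "g \<in> borel_measurable borel"
    and "integrable std_normal_distribution (\<lambda>x. (g x)\<^sup>2)"
  shows "(\<integral>x. \<bar>g x\<bar> \<partial>std_normal_distribution) \<le> sqrt (\<integral>x. (g x)\<^sup>2 \<partial>std_normal_distribution)"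
  using Cauchy_Schwarz_integral[of "\<lambda>x. \<bar>g x\<bar>" std_normal_distribution "\<lambda>_. 1"] assms std_normal.prob_space
  by (intro real_le_rsqrt) simp

text \<open>The partial sums are Cauchy by Bessel's inequality and hence have an L2 limit
  \<open>s\<close>. All Hermite coefficients of \<open>f - s\<close> vanish, so completeness
  identifies \<open>s\<close> with \<open>f\<close>.\<close>

lemma hermite_L2_approx:
  assumes [measurable]: "f \<in> borel_measurable borel"
    and f2: "integrable std_normal_distribution (\<lambda>x. (f x)\<^sup>2)"
  defines "c \<equiv> \<lambda>k. \<integral>x. f x * hermite k x \<partial>std_normal_distribution"
  shows "(\<lambda>n. \<integral>x. (f x - (\<Sum>k<n. c k / fact k * hermite k x))\<^sup>2 \<partial>std_normal_distribution) \<longlonglongrightarrow> 0"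
    and "summable (\<lambda>k. (c k)\<^sup>2 / fact k)"
proof -
  let ?N = std_normal_distribution
  define S where "S n x = (\<Sum>k<n. c k / fact k * hermite k x)" for n x
  define q where "q k = (c k)\<^sup>2 / fact k" for k
  have [measurable]: "S n \<in> borel_measurable borel" for n
    unfolding S_def by measurable
  have q: "(c k / fact k)\<^sup>2 * fact k = q k" for k
    by (simp add: q_def power2_eq_square)
  have S2: "integrable ?N (\<lambda>x. (S n x)\<^sup>2)" "(\<integral>x. (S n x)\<^sup>2 \<partial>?N) = (\<Sum>k<n. q k)" for n
    using hermite_sum_sq[of "{..<n}" "\<lambda>k. c k / fact k"] by (simp_all only: S_def q finite_lessThan)
  have H2: "integrable ?N (\<lambda>x. (hermite k x)\<^sup>2)" "(\<integral>x. (hermite k x)\<^sup>2 \<partial>?N) = fact k" for k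
    using std_normal_hermite[of k k] by (simp_all add: power2_eq_square)
  have fH: "integrable ?N (\<lambda>x. f x * hermite k x)" for k
    using f2 H2 by (intro integrable_mult_L2) auto
  have SS: "(\<integral>x. (S n x - S m x)\<^sup>2 \<partial>?N) = (\<Sum>k\<in>{m..<n}. q k)" if "m \<le> n" for m n
  proof -
    have "S n x - S m x = (\<Sum>k\<in>{m..<n}. c k / fact k * hermite k x)" for x
      unfolding S_def using that by (simp add: sum_diff_nat_ivl flip: atLeast0LessThan)
    then show ?thesis
      using hermite_sum_sq(2)[of "{m..<n}" "\<lambda>k. c k / fact k"] by (simp only: q finite_atLeastLessThan)
  qed
  have bessel: "(\<Sum>k<n. q k) \<le> (\<integral>x. (f x)\<^sup>2 \<partial>?N)" for n
  proof -
    have fS: "f x * S n x = (\<Sum>k<n. c k / fact k * (f x * hermite k x))" for x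
      by (simp add: S_def sum_distrib_left mult_ac)
    have "(\<integral>x. f x * S n x \<partial>?N) = (\<Sum>k<n. \<integral>x. c k / fact k * (f x * hermite k x) \<partial>?N)"
      unfolding fS by (intro Bochner_Integration.integral_sum integrable_mult_right fH)
    also have "\<dots> = (\<Sum>k<n. c k / fact k * c k)"
      by (simp add: c_def)
    finally have "(\<integral>x. f x * S n x \<partial>?N) = (\<Sum>k<n. c k / fact k * c k)" .
    then have fS': "(\<integral>x. f x * S n x \<partial>?N) = (\<Sum>k<n. q k)"
      by (simp add: q_def power2_eq_square)
    have "0 \<le> (\<integral>x. (f x - S n x)\<^sup>2 \<partial>?N)" by simp
    also have "\<dots> = (\<integral>x. (f x)\<^sup>2 + (S n x)\<^sup>2 - 2 * (f x * S n x) \<partial>?N)"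
      by (simp add: power2_diff mult.assoc)
    also have "\<dots> = (\<integral>x. (f x)\<^sup>2 \<partial>?N) + (\<Sum>k<n. q k) - 2 * (\<Sum>k<n. q k)"
      using f2 S2 integrable_mult_L2[of f ?N "S n"] fS' by simp
    finally show ?thesis by simp
  qed
  have q0: "q k \<ge> 0" for k by (simp add: q_def)
  show sq: "summable (\<lambda>k. (c k)\<^sup>2 / fact k)"
    using summableI_nonneg_bounded[of q, OF q0 bessel] by (simp add: q_def[abs_def])
  then have sumq: "summable q" by (simp add: q_def[abs_def])
  define tl where "tl n = (\<Sum>k. q (k + n))" for n
  have tl0: "tl \<longlonglongrightarrow> 0"
    unfolding tl_def by (rule suminf_exist_split2) (rule sumq)
  have tl_nonneg: "tl n \<ge> 0" for n
    unfolding tl_def using q0 sumq by (intro suminf_nonneg) (auto simp: summable_iff_shift)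
  have SS_le: "(\<integral>x. (S n x - S m x)\<^sup>2 \<partial>?N) \<le> tl m" if "m \<le> n" for m n
  proof -
    have "(\<Sum>k\<in>{m..<n}. q k) = (\<Sum>k<n-m. q (k + m))"
      using that sum.shift_bounds_nat_ivl[of q 0 m "n - m"] by (simp add: atLeast0LessThan)
    also have "\<dots> \<le> tl m"
      unfolding tl_def using q0 sumq by (intro sum_le_suminf) (auto simp: summable_iff_shift)
    finally show ?thesis using SS[OF that] by simp
  qed
  have intS: "integrable ?N (S n)" for n
    using std_normal.square_integrable_imp_integrable[of "S n"] S2 by simp
  have abs_le: "(\<integral>x. norm (S i x - S j x) \<partial>?N) \<le> sqrt (tl (min i j))" for i j
  proof -
    have "(\<integral>x. norm (S i x - S j x) \<partial>?N) \<le> sqrt (\<integral>x. (S i x - S j x)\<^sup>2 \<partial>?N)"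
      using std_normal_abs_le[of "\<lambda>x. S i x - S j x"] L2_diff[OF _ _ S2(1) S2(1)] by simp
    also have "(\<integral>x. (S i x - S j x)\<^sup>2 \<partial>?N) \<le> tl (min i j)"
      using SS_le[of i j] SS_le[of j i] by (cases "i \<le> j") (auto simp: min_def power2_commute)
    finally show ?thesis by simp
  qed
  \<comment> \<open>L1 control, which the L2 bound gives on a probability space, provides a
    subsequence converging almost everywhere and with it a measurable candidate for the
    limit.\<close>
  obtain r where r: "strict_mono r" "AE x in ?N. Cauchy (\<lambda>i. S (r i) x)"
  proof (rule cauchy_L1_AE_cauchy_subseq[of ?N S])
    fix e :: real assume "e > 0"
    moreover have "(\<lambda>n. sqrt (tl n)) \<longlonglongrightarrow> 0" using tendsto_real_sqrt[OF tl0] by simp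
    ultimately obtain n0 where n0: "\<And>n. n \<ge> n0 \<Longrightarrow> sqrt (tl n) < e"
      using order_tendstoD(2)[of _ 0 sequentially e] by (auto simp: eventually_sequentially)
    show "\<exists>N. \<forall>i\<ge>N. \<forall>j\<ge>N. (\<integral>x. norm (S i x - S j x) \<partial>?N) < e"
      using le_less_trans[OF abs_le n0] by (intro exI[of _ n0]) simp
  qed (use intS in auto)
  define s where "s x = lim (\<lambda>i. S (r i) x)" for x
  have [measurable]: "s \<in> borel_measurable borel"
    unfolding s_def by measurable
  have lim: "AE x in ?N. (\<lambda>i. S (r i) x) \<longlonglongrightarrow> s x"
    using r(2) by eventually_elim (simp add: s_def Cauchy_convergent_iff convergent_LIMSEQ_iff)
  \<comment> \<open>Fatou along the subsequence carries the tail bound over from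
    \<open>S (r i) - S n\<close> to \<open>s - S n\<close>, so that the partial sums converge to
    \<open>s\<close> in L2.\<close>
  have fatou: "(\<integral>\<^sup>+x. ennreal ((s x - S n x)\<^sup>2) \<partial>?N) \<le> ennreal (tl n)" for n
  proof -
    have "(\<integral>\<^sup>+x. ennreal ((s x - S n x)\<^sup>2) \<partial>?N) = (\<integral>\<^sup>+x. liminf (\<lambda>i. ennreal ((S (r i) x - S n x)\<^sup>2)) \<partial>?N)"
    proof (rule nn_integral_cong_AE)
      show "AE x in ?N. ennreal ((s x - S n x)\<^sup>2) = liminf (\<lambda>i. ennreal ((S (r i) x - S n x)\<^sup>2))"
        using lim
      proof eventually_elim
        case (elim x)
        then have "(\<lambda>i. ennreal ((S (r i) x - S n x)\<^sup>2)) \<longlonglongrightarrow> ennreal ((s x - S n x)\<^sup>2)"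
          by (intro tendsto_ennrealI tendsto_intros)
        from lim_imp_Liminf[OF sequentially_bot this] show ?case by (rule sym)
      qed
    qed
    also have "\<dots> \<le> liminf (\<lambda>i. \<integral>\<^sup>+x. ennreal ((S (r i) x - S n x)\<^sup>2) \<partial>?N)"
      by (rule nn_integral_liminf) measurable
    also have "\<dots> \<le> ennreal (tl n)"
    proof (rule Liminf_le)
      show "\<forall>\<^sub>F i in sequentially. (\<integral>\<^sup>+x. ennreal ((S (r i) x - S n x)\<^sup>2) \<partial>?N) \<le> ennreal (tl n)"
        using eventually_ge_at_top[of n]
      proof eventually_elim
        case (elim i)
        then have "n \<le> r i" using seq_suble[OF r(1), of i] by simp
        then show ?case
          using SS_le[of n "r i"] L2_diff[OF _ _ S2(1) S2(1), of "r i" n]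
          by (subst nn_integral_eq_integral) (auto intro: ennreal_leI)
      qed
    qed simp
    finally show ?thesis .
  qed
  have sS: "integrable ?N (\<lambda>x. (s x - S n x)\<^sup>2)" for n
  proof (rule integrableI_bounded)
    have "(\<integral>\<^sup>+x. ennreal (norm ((s x - S n x)\<^sup>2)) \<partial>?N) \<le> ennreal (tl n)"
      using fatou[of n] by simp
    also have "\<dots> < \<infinity>" by simp
    finally show "(\<integral>\<^sup>+x. ennreal (norm ((s x - S n x)\<^sup>2)) \<partial>?N) < \<infinity>" .
  qed measurable
  have sS_le: "(\<integral>x. (s x - S n x)\<^sup>2 \<partial>?N) \<le> tl n" for n
    using fatou[of n] sS[of n] tl_nonneg[of n]
    by (subst (asm) nn_integral_eq_integral) (auto simp: ennreal_le_iff)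
  have fS2: "integrable ?N (\<lambda>x. (f x - S n x)\<^sup>2)" for n
    by (rule L2_diff) (use f2 S2 in auto)
  have orth: "(\<integral>x. (f x - s x) * hermite k x \<partial>?N) = 0" for k
  proof -
    have split: "(f x - s x) * hermite k x = (f x - S n x) * hermite k x - (s x - S n x) * hermite k x" for x n
      by (simp add: algebra_simps)
    have i1: "integrable ?N (\<lambda>x. (f x - S n x) * hermite k x)" for n
      by (rule integrable_mult_L2) (use fS2 H2 in auto)
    have i2: "integrable ?N (\<lambda>x. (s x - S n x) * hermite k x)" for n
      by (rule integrable_mult_L2) (use sS H2 in auto)
    have z: "(\<integral>x. (f x - S n x) * hermite k x \<partial>?N) = 0" if "k < n" for n
    proof -
      have eq: "(f x - S n x) * hermite k x = f x * hermite k x - (\<Sum>j<n. c j / fact j * (hermite j x * hermite k x))" for x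
        by (simp add: S_def left_diff_distrib sum_distrib_right mult.assoc)
      have "(\<integral>x. (f x - S n x) * hermite k x \<partial>?N)
          = c k - (\<Sum>j<n. c j / fact j * (\<integral>x. hermite j x * hermite k x \<partial>?N))"
        unfolding eq c_def using fH std_normal_hermite(1)
        by (subst Bochner_Integration.integral_diff) (auto simp: Bochner_Integration.integral_sum)
      also have "\<dots> = 0"
        using that by (simp add: std_normal_hermite if_distrib cong: if_cong)
      finally show ?thesis .
    qed
    \<comment> \<open>The left-hand side does not depend on \<open>n\<close>, while for
      \<open>n > k\<close> the contribution of \<open>f - S n\<close> has dropped out; letting
      \<open>n\<close> grow forces the coefficient to be zero.\<close>
    have bd: "(\<integral>x. (f x - s x) * hermite k x \<partial>?N)\<^sup>2 \<le> tl n * fact k" if "k < n" for n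
    proof -
      have "(\<integral>x. (f x - s x) * hermite k x \<partial>?N)\<^sup>2 = (\<integral>x. (s x - S n x) * hermite k x \<partial>?N)\<^sup>2"
        unfolding split[of _ n] using i1 i2 z[OF that] by simp
      also have "\<dots> \<le> (\<integral>x. (s x - S n x)\<^sup>2 \<partial>?N) * (\<integral>x. (hermite k x)\<^sup>2 \<partial>?N)"
        by (rule Cauchy_Schwarz_integral) (use sS H2 in auto)
      also have "\<dots> \<le> tl n * fact k"
        using sS_le by (simp add: H2)
      finally show ?thesis .
    qed
    have "(\<lambda>n. tl n * fact k) \<longlonglongrightarrow> 0 * fact k"
      by (intro tendsto_intros tl0)
    then have "(\<integral>x. (f x - s x) * hermite k x \<partial>?N)\<^sup>2 \<le> 0 * fact k"
      by (rule tendsto_lowerbound) (use bd in \<open>auto intro: eventually_mono[OF eventually_gt_at_top[of k]]\<close>)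
    then show ?thesis by simp
  qed
  have "AE x in ?N. f x - s x = 0"
  proof (rule hermite_complete[OF _ _ orth])
    show "integrable ?N (\<lambda>x. (f x - s x)\<^sup>2)"
      using L2_diff[OF _ _ fS2[of 0] sS[of 0]] by (simp add: S_def)
  qed measurable
  then have "(\<integral>x. (f x - S n x)\<^sup>2 \<partial>?N) = (\<integral>x. (s x - S n x)\<^sup>2 \<partial>?N)" for n
    by (intro integral_cong_AE) (auto elim: eventually_mono)
  then have "(\<integral>x. (f x - S n x)\<^sup>2 \<partial>?N) \<le> tl n" for n
    using sS_le by simp
  then have "(\<lambda>n. \<integral>x. (f x - S n x)\<^sup>2 \<partial>?N) \<longlonglongrightarrow> 0"
    by (intro tendsto_sandwich[OF _ _ tendsto_const tl0]) auto
  then show "(\<lambda>n. \<integral>x. (f x - (\<Sum>k<n. c k / fact k * hermite k x))\<^sup>2 \<partial>?N) \<longlonglongrightarrow> 0"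
    by (simp add: S_def)
qed


section \<open>Mehler's formula for Gaussian sequences\<close>

text \<open>Truncates the Hermite expansion in both factors. The truncated product has a known
  expectation, and the errors are controlled by L2 norms under the marginals alone.\<close>

lemma gaussian_pair_product_sums:
  fixes X Y :: "'a \<Rightarrow> real"
  assumes [measurable]: "X \<in> borel_measurable M" "Y \<in> borel_measurable M" "f \<in> borel_measurable borel"
    and int: "\<And>a b. integrable M (\<lambda>\<omega>. exp (a * X \<omega> + b * Y \<omega>))"
    and mgf: "\<And>a b. (\<integral>\<omega>. exp (a * X \<omega> + b * Y \<omega>) \<partial>M) = exp ((a\<^sup>2 + b\<^sup>2 + 2 * \<rho> * a * b) / 2)"
    and X: "distr M borel X = std_normal_distribution" and Y: "distr M borel Y = std_normal_distribution"
    and f2: "integrable std_normal_distribution (\<lambda>x. (f x)\<^sup>2)"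
  defines "c \<equiv> \<lambda>k. \<integral>x. f x * hermite k x \<partial>std_normal_distribution"
  shows "(\<lambda>k. (c k)\<^sup>2 / fact k * \<rho> ^ k) sums (\<integral>\<omega>. f (X \<omega>) * f (Y \<omega>) \<partial>M)"
proof -
  let ?N = std_normal_distribution
  define S where "S n x = (\<Sum>k<n. c k / fact k * hermite k x)" for n x
  define e where "e n = (\<integral>x. (f x - S n x)\<^sup>2 \<partial>?N)" for n
  define F where "F = (\<integral>x. (f x)\<^sup>2 \<partial>?N)"
  have [measurable]: "S n \<in> borel_measurable borel" for n
    unfolding S_def by measurable
  have e: "e \<longlonglongrightarrow> 0"
    unfolding e_def[abs_def] S_def c_def by (rule hermite_L2_approx(1)[OF assms(3) f2])
  have S2: "integrable ?N (\<lambda>x. (S n x)\<^sup>2)" for n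
    unfolding S_def by (rule hermite_sum_sq) simp
  have d2: "integrable ?N (\<lambda>x. (f x - S n x)\<^sup>2)" for n
    by (rule L2_diff) (use f2 S2 in auto)
  have tX: "integrable M (\<lambda>\<omega>. g (X \<omega>)) = integrable ?N g" "(\<integral>\<omega>. g (X \<omega>) \<partial>M) = integral\<^sup>L ?N g"
    and tY: "integrable M (\<lambda>\<omega>. g (Y \<omega>)) = integrable ?N g" "(\<integral>\<omega>. g (Y \<omega>) \<partial>M) = integral\<^sup>L ?N g"
    if "g \<in> borel_measurable borel" for g :: "real \<Rightarrow> real"
    using integrable_distr_eq[OF assms(1) that] integral_distr[OF assms(1) that]
      integrable_distr_eq[OF assms(2) that] integral_distr[OF assms(2) that] unfolding X Y by simp_all
  have cs: "integrable M (\<lambda>\<omega>. u (X \<omega>) * v (Y \<omega>))"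
      "\<bar>\<integral>\<omega>. u (X \<omega>) * v (Y \<omega>) \<partial>M\<bar> \<le> sqrt ((\<integral>x. (u x)\<^sup>2 \<partial>?N) * (\<integral>x. (v x)\<^sup>2 \<partial>?N))"
    if [measurable]: "u \<in> borel_measurable borel" "v \<in> borel_measurable borel"
      and uv: "integrable ?N (\<lambda>x. (u x)\<^sup>2)" "integrable ?N (\<lambda>x. (v x)\<^sup>2)" for u v
  proof -
    have i: "integrable M (\<lambda>\<omega>. (u (X \<omega>))\<^sup>2)" "integrable M (\<lambda>\<omega>. (v (Y \<omega>))\<^sup>2)"
      using tX(1)[of "\<lambda>x. (u x)\<^sup>2"] tY(1)[of "\<lambda>x. (v x)\<^sup>2"] uv by simp_all
    show "integrable M (\<lambda>\<omega>. u (X \<omega>) * v (Y \<omega>))"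
      by (rule integrable_mult_L2) (use i in auto)
    have "(\<integral>\<omega>. u (X \<omega>) * v (Y \<omega>) \<partial>M)\<^sup>2 \<le> (\<integral>\<omega>. (u (X \<omega>))\<^sup>2 \<partial>M) * (\<integral>\<omega>. (v (Y \<omega>))\<^sup>2 \<partial>M)"
      by (rule Cauchy_Schwarz_integral) (use i in auto)
    also have "\<dots> = (\<integral>x. (u x)\<^sup>2 \<partial>?N) * (\<integral>x. (v x)\<^sup>2 \<partial>?N)"
      using tX(2)[of "\<lambda>x. (u x)\<^sup>2"] tY(2)[of "\<lambda>x. (v x)\<^sup>2"] by simp
    finally show "\<bar>\<integral>\<omega>. u (X \<omega>) * v (Y \<omega>) \<partial>M\<bar> \<le> sqrt ((\<integral>x. (u x)\<^sup>2 \<partial>?N) * (\<integral>x. (v x)\<^sup>2 \<partial>?N))"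
      by (intro real_le_rsqrt) simp
  qed
  have "(\<lambda>\<omega>. S n (X \<omega>) * S n (Y \<omega>))
      = (\<lambda>\<omega>. \<Sum>j<n. \<Sum>k<n. c j / fact j * (c k / fact k) * (hermite j (X \<omega>) * hermite k (Y \<omega>)))" for n
    unfolding S_def sum_product by (simp add: mult_ac)
  note SS = this
  note hm = hermite_product_moments[OF assms(1,2) int mgf]
  have iSS: "integrable M (\<lambda>\<omega>. S n (X \<omega>) * S n (Y \<omega>))" for n
    unfolding SS by (intro Bochner_Integration.integrable_sum integrable_mult_right hm)
  have ESS: "(\<integral>\<omega>. S n (X \<omega>) * S n (Y \<omega>) \<partial>M) = (\<Sum>k<n. (c k)\<^sup>2 / fact k * \<rho> ^ k)" for n
  proof -
    have "(\<integral>\<omega>. S n (X \<omega>) * S n (Y \<omega>) \<partial>M)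
       = (\<Sum>j<n. \<integral>\<omega>. (\<Sum>k<n. c j / fact j * (c k / fact k) * (hermite j (X \<omega>) * hermite k (Y \<omega>))) \<partial>M)"
      unfolding SS
      by (intro Bochner_Integration.integral_sum Bochner_Integration.integrable_sum integrable_mult_right hm)
    also have "\<dots> = (\<Sum>j<n. \<Sum>k<n. \<integral>\<omega>. c j / fact j * (c k / fact k) * (hermite j (X \<omega>) * hermite k (Y \<omega>)) \<partial>M)"
      by (intro sum.cong refl Bochner_Integration.integral_sum integrable_mult_right hm)
    also have "\<dots> = (\<Sum>j<n. \<Sum>k<n. if j = k then (c k)\<^sup>2 / fact k * \<rho> ^ k else 0)"
      by (intro sum.cong refl) (simp add: hm power2_eq_square)
    also have "\<dots> = (\<Sum>k<n. (c k)\<^sup>2 / fact k * \<rho> ^ k)"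
      by (simp add: sum.delta)
    finally show ?thesis .
  qed
  have bound: "\<bar>(\<Sum>k<n. (c k)\<^sup>2 / fact k * \<rho> ^ k) - (\<integral>\<omega>. f (X \<omega>) * f (Y \<omega>) \<partial>M)\<bar> \<le> sqrt (e n * F) + sqrt (F * e n) + sqrt (e n * e n)" for n
  proof -
    \<comment> \<open>Every error term is a product with \<open>f\<close> or with
      \<open>f - S n\<close>, so that its bound involves only the fixed norm \<open>F\<close> and
      the small \<open>e n\<close>.\<close>
    have eq: "f (X \<omega>) * f (Y \<omega>) = S n (X \<omega>) * S n (Y \<omega>) + (f (X \<omega>) - S n (X \<omega>)) * f (Y \<omega>)
        + f (X \<omega>) * (f (Y \<omega>) - S n (Y \<omega>)) - (f (X \<omega>) - S n (X \<omega>)) * (f (Y \<omega>) - S n (Y \<omega>))" for \<omega>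
      by (simp add: algebra_simps)
    have c1: "integrable M (\<lambda>\<omega>. (f (X \<omega>) - S n (X \<omega>)) * f (Y \<omega>))"
        "\<bar>\<integral>\<omega>. (f (X \<omega>) - S n (X \<omega>)) * f (Y \<omega>) \<partial>M\<bar> \<le> sqrt (e n * F)"
      using cs[of "\<lambda>x. f x - S n x" f] d2[of n] f2 by (simp_all add: e_def F_def)
    have c2: "integrable M (\<lambda>\<omega>. f (X \<omega>) * (f (Y \<omega>) - S n (Y \<omega>)))"
        "\<bar>\<integral>\<omega>. f (X \<omega>) * (f (Y \<omega>) - S n (Y \<omega>)) \<partial>M\<bar> \<le> sqrt (F * e n)"
      using cs[of f "\<lambda>x. f x - S n x"] d2[of n] f2 by (simp_all add: e_def F_def)
    have c3: "integrable M (\<lambda>\<omega>. (f (X \<omega>) - S n (X \<omega>)) * (f (Y \<omega>) - S n (Y \<omega>)))"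
        "\<bar>\<integral>\<omega>. (f (X \<omega>) - S n (X \<omega>)) * (f (Y \<omega>) - S n (Y \<omega>)) \<partial>M\<bar> \<le> sqrt (e n * e n)"
      using cs[of "\<lambda>x. f x - S n x" "\<lambda>x. f x - S n x"] d2[of n] by (simp_all add: e_def)
    have "(\<integral>\<omega>. f (X \<omega>) * f (Y \<omega>) \<partial>M) = (\<Sum>k<n. (c k)\<^sup>2 / fact k * \<rho> ^ k)
        + (\<integral>\<omega>. (f (X \<omega>) - S n (X \<omega>)) * f (Y \<omega>) \<partial>M) + (\<integral>\<omega>. f (X \<omega>) * (f (Y \<omega>) - S n (Y \<omega>)) \<partial>M)
        - (\<integral>\<omega>. (f (X \<omega>) - S n (X \<omega>)) * (f (Y \<omega>) - S n (Y \<omega>)) \<partial>M)"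
      unfolding eq
      by (subst Bochner_Integration.integral_diff Bochner_Integration.integral_add;
          (intro Bochner_Integration.integrable_add c1 c2 c3 iSS)?)+ (simp add: ESS)
    then show ?thesis using c1(2) c2(2) c3(2) by linarith
  qed
  have "(\<lambda>n. sqrt (e n * F) + sqrt (F * e n) + sqrt (e n * e n)) \<longlonglongrightarrow> sqrt (0 * F) + sqrt (F * 0) + sqrt (0 * 0)"
    by (intro tendsto_intros e)
  then have L: "(\<lambda>n. sqrt (e n * F) + sqrt (F * e n) + sqrt (e n * e n)) \<longlonglongrightarrow> 0"
    by (simp only: mult_zero_left mult_zero_right real_sqrt_zero add_0)
  have "(\<lambda>n. (\<Sum>k<n. (c k)\<^sup>2 / fact k * \<rho> ^ k) - (\<integral>\<omega>. f (X \<omega>) * f (Y \<omega>) \<partial>M)) \<longlonglongrightarrow> 0"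
    by (rule Lim_null_comparison[OF always_eventually L]) (simp only: real_norm_def bound simp_thms)
  then show ?thesis
    by (simp add: sums_def LIM_zero_iff)
qed

text \<open>Point masses are treated separately because they have no density; a centred one is zero
  almost surely and satisfies the same formula. They occur as combinations of linearly dependent
  variables.\<close>

lemma (in prob_space) centred_gaussian_rv:
  assumes "gaussian_rv M Y" and "expectation Y = 0"
  shows "integrable M (\<lambda>\<omega>. exp (Y \<omega>))"
    and "expectation (\<lambda>\<omega>. exp (Y \<omega>)) = exp (expectation (\<lambda>\<omega>. (Y \<omega>)\<^sup>2) / 2)"
    and "expectation (\<lambda>\<omega>. (Y \<omega>)\<^sup>2) = 1 \<Longrightarrow> distr M borel Y = std_normal_distribution"
proof -
  have [measurable]: "Y \<in> borel_measurable M"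
    using assms by (simp add: gaussian_rv_def)
  have "integrable M (\<lambda>\<omega>. exp (Y \<omega>)) \<and> expectation (\<lambda>\<omega>. exp (Y \<omega>)) = exp (expectation (\<lambda>\<omega>. (Y \<omega>)\<^sup>2) / 2)
     \<and> (expectation (\<lambda>\<omega>. (Y \<omega>)\<^sup>2) = 1 \<longrightarrow> distr M borel Y = std_normal_distribution)"
  proof (cases "\<exists>\<mu>. AE \<omega> in M. Y \<omega> = \<mu>")
    case True
    then obtain \<mu> where \<mu>: "AE \<omega> in M. Y \<omega> = \<mu>" by blast
    have "expectation Y = expectation (\<lambda>_. \<mu>)"
      using \<mu> by (intro integral_cong_AE) auto
    with assms(2) have "\<mu> = 0" by (simp add: prob_space)
    with \<mu> have Y0: "AE \<omega> in M. Y \<omega> = 0" by simp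
    have "integrable M (\<lambda>\<omega>. exp (Y \<omega>)) = integrable M (\<lambda>_. 1::real)"
      using Y0 by (intro integrable_cong_AE) (auto elim: eventually_mono)
    moreover have "expectation (\<lambda>\<omega>. exp (Y \<omega>)) = expectation (\<lambda>_. 1)"
      using Y0 by (intro integral_cong_AE) (auto elim: eventually_mono)
    moreover have "expectation (\<lambda>\<omega>. (Y \<omega>)\<^sup>2) = expectation (\<lambda>_. 0)"
      using Y0 by (intro integral_cong_AE) (auto elim: eventually_mono)
    ultimately show ?thesis by (simp add: prob_space)
  next
    case False
    with assms(1) obtain \<mu> \<sigma> where \<sigma>: "0 < \<sigma>" and D: "distributed M lborel Y (normal_density \<mu> \<sigma>)"
      by (auto simp: gaussian_rv_def)
    have "\<mu> = 0"
      using normal_distributed_expectation[OF \<sigma> D] assms(2) by simp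
    have v: "expectation (\<lambda>\<omega>. (Y \<omega>)\<^sup>2) = \<sigma>\<^sup>2"
      using normal_distributed_variance[OF \<sigma> D] assms(2) by simp
    \<comment> \<open>Completing the square: the exponential tilts the centred density to mean
      \<open>\<sigma>\<^sup>2\<close>.\<close>
    have eq: "normal_density 0 \<sigma> x * exp x = exp (\<sigma>\<^sup>2 / 2) * normal_density (\<sigma>\<^sup>2) \<sigma> x" for x
    proof -
      have "- x\<^sup>2 / (2 * \<sigma>\<^sup>2) + x = \<sigma>\<^sup>2 / 2 + - (x - \<sigma>\<^sup>2)\<^sup>2 / (2 * \<sigma>\<^sup>2)"
        using \<sigma> by (simp add: field_simps power2_eq_square)
      then show ?thesis
        by (simp add: normal_density_def mult_ac flip: exp_add)
    qed
    have "integrable M (\<lambda>\<omega>. exp (Y \<omega>))"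
      using distributed_integrable[OF D, of exp] \<sigma> \<open>\<mu> = 0\<close> by (simp add: eq)
    moreover have "expectation (\<lambda>\<omega>. exp (Y \<omega>)) = exp (\<sigma>\<^sup>2 / 2)"
      using distributed_integral[OF D, of exp] \<sigma> \<open>\<mu> = 0\<close> by (simp add: eq)
    moreover have "distr M borel Y = std_normal_distribution" if "\<sigma>\<^sup>2 = 1"
    proof -
      have "\<sigma> = 1" using that \<sigma> by (simp add: power2_eq_1_iff)
      have "distr M borel Y = distr M lborel Y" by (intro distr_cong) auto
      with distributed_distr_eq_density[OF D] \<open>\<mu> = 0\<close> \<open>\<sigma> = 1\<close> show ?thesis by simp
    qed
    ultimately show ?thesis by (simp add: v)
  qed
  then show "integrable M (\<lambda>\<omega>. exp (Y \<omega>))"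
    and "expectation (\<lambda>\<omega>. exp (Y \<omega>)) = exp (expectation (\<lambda>\<omega>. (Y \<omega>)\<^sup>2) / 2)"
    and "expectation (\<lambda>\<omega>. (Y \<omega>)\<^sup>2) = 1 \<Longrightarrow> distr M borel Y = std_normal_distribution"
    by blast+
qed

section \<open>Standard Gaussian sequences and functions of them\<close>

locale standard_gaussian_sequence = prob_space M for M :: "'a measure" +
  fixes Z :: "nat \<Rightarrow> 'a \<Rightarrow> real"
  assumes gaussian: "gaussian_sequence M Z" and stat: "stationary M Z"
    and mean_0: "expectation (Z t) = 0" and var_1: "variance (Z t) = 1"
begin

lemma Z_measurable [measurable]: "Z t \<in> borel_measurable M"
  using stat by (simp add: stationary_def)

lemma gaussian_rv_pair: "gaussian_rv M (\<lambda>\<omega>. a * Z s \<omega> + b * Z t \<omega>)"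
proof -
  \<comment> \<open>The indicators are added, not nested, so that the coefficients add up when
    \<open>s = t\<close>.\<close>
  define c where "c i = (if i = s then a else 0) + (if i = t then b else 0)" for i
  have eq: "(\<Sum>i<Suc (max s t). c i * Z i \<omega>) = a * Z s \<omega> + b * Z t \<omega>" for \<omega>
    unfolding c_def distrib_right sum.distrib
    by (simp add: if_distrib[of "\<lambda>x. x * _"] less_Suc_eq_le cong: if_cong del: sum.lessThan_Suc)
  have "gaussian_rv M (\<lambda>\<omega>. \<Sum>i<Suc (max s t). c i * Z i \<omega>)"
    using gaussian unfolding gaussian_sequence_def by blast
  then show ?thesis by (simp only: eq)
qed

lemma Z_sq: "expectation (\<lambda>\<omega>. (Z t \<omega>)\<^sup>2) = 1"
  using var_1[of t] by (simp add: mean_0)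

lemma Z_distr: "distr M borel (Z t) = std_normal_distribution"
  using centred_gaussian_rv(3)[of "Z t"] gaussian_rv_pair[of 1 t 0 t] Z_sq mean_0 by simp

lemma Z_transfer:
  assumes "g \<in> borel_measurable borel"
  shows "integrable M (\<lambda>\<omega>. g (Z t \<omega>)) \<longleftrightarrow> integrable std_normal_distribution (g :: real \<Rightarrow> real)"
    and "expectation (\<lambda>\<omega>. g (Z t \<omega>)) = integral\<^sup>L std_normal_distribution g"
  using assms unfolding Z_distr[of t, symmetric]
  by (simp_all add: integrable_distr_eq integral_distr)

lemma Z_sq_integrable: "integrable M (\<lambda>\<omega>. (Z t \<omega>)\<^sup>2)"
  using Z_transfer(1)[of "\<lambda>x. x\<^sup>2" t] integrable_std_normal_distribution_moment[of 2] by simp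

lemma Z_integrable: "integrable M (Z t)"
  using square_integrable_imp_integrable[of "Z t"] Z_sq_integrable by simp

lemma Z_prod_integrable: "integrable M (\<lambda>\<omega>. Z s \<omega> * Z t \<omega>)"
  by (intro integrable_mult_L2 Z_sq_integrable) auto

lemma autocov_0: "autocov M Z 0 = 1"
  using Z_sq[of 0] by (simp add: autocov_def covariance_def mean_0 power2_eq_square)

lemma autocov_abs_le_1: "\<bar>autocov M Z k\<bar> \<le> 1"
proof -
  have "(expectation (\<lambda>\<omega>. Z 0 \<omega> * Z k \<omega>))\<^sup>2 \<le> 1"
    using Cauchy_Schwarz_integral[of "Z 0" M "Z k"] Z_sq_integrable by (simp add: Z_sq)
  then show ?thesis
    by (simp add: autocov_def covariance_def mean_0 abs_square_le_1)
qed

text \<open>Stationarity is equality of the laws of whole paths; it is applied to the functional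
  \<open>w 0 * w k\<close>.\<close>

lemma Z_prod: "expectation (\<lambda>\<omega>. Z s \<omega> * Z t \<omega>) = autocov M Z (nat \<bar>int s - int t\<bar>)"
proof -
  have *: "expectation (\<lambda>\<omega>. Z s \<omega> * Z (s + k) \<omega>) = autocov M Z k" for s k
  proof -
    let ?P = "PiM UNIV (\<lambda>_::nat. borel :: real measure)"
    have meas: "(\<lambda>\<omega> t. Z (t + s) \<omega>) \<in> measurable M ?P" for s
      by (rule measurable_PiM_single') auto
    have g [measurable]: "(\<lambda>w. w 0 * w k) \<in> borel_measurable ?P"
      by measurable
    have "expectation (\<lambda>\<omega>. Z (0 + s) \<omega> * Z (k + s) \<omega>)
        = integral\<^sup>L (distr M ?P (\<lambda>\<omega> t. Z (t + s) \<omega>)) (\<lambda>w. w 0 * w k)"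
      by (subst integral_distr[OF meas g]) (rule refl)
    also have "distr M ?P (\<lambda>\<omega> t. Z (t + s) \<omega>) = distr M ?P (\<lambda>\<omega> t. Z (t + 0) \<omega>)"
      using stat by (simp add: stationary_def)
    also have "integral\<^sup>L (distr M ?P (\<lambda>\<omega> t. Z (t + 0) \<omega>)) (\<lambda>w. w 0 * w k) = expectation (\<lambda>\<omega>. Z (0 + 0) \<omega> * Z (k + 0) \<omega>)"
      by (subst integral_distr[OF meas g]) (rule refl)
    finally show ?thesis
      by (simp add: autocov_def covariance_def mean_0 add.commute)
  qed
  show ?thesis
    using *[of s "t - s"] *[of t "s - t"] by (cases "s \<le> t") (auto simp: nat_diff_distrib' mult.commute abs_if)
qed

lemma Z_pair_exp:
  defines "\<rho> s t \<equiv> autocov M Z (nat \<bar>int s - int t\<bar>)"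
  shows "integrable M (\<lambda>\<omega>. exp (a * Z s \<omega> + b * Z t \<omega>))"
    and "expectation (\<lambda>\<omega>. exp (a * Z s \<omega> + b * Z t \<omega>)) = exp ((a\<^sup>2 + b\<^sup>2 + 2 * \<rho> s t * a * b) / 2)"
proof -
  have E0: "expectation (\<lambda>\<omega>. a * Z s \<omega> + b * Z t \<omega>) = 0"
    by (simp add: Z_integrable mean_0)
  have "expectation (\<lambda>\<omega>. (a * Z s \<omega> + b * Z t \<omega>)\<^sup>2)
     = expectation (\<lambda>\<omega>. a\<^sup>2 * (Z s \<omega>)\<^sup>2 + b\<^sup>2 * (Z t \<omega>)\<^sup>2 + 2 * a * b * (Z s \<omega> * Z t \<omega>))"
    by (intro Bochner_Integration.integral_cong refl) (simp add: power2_eq_square algebra_simps)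
  also have "\<dots> = a\<^sup>2 + b\<^sup>2 + 2 * \<rho> s t * a * b"
    by (simp add: Z_sq Z_sq_integrable Z_prod_integrable Z_prod \<rho>_def)
  finally have E2: "expectation (\<lambda>\<omega>. (a * Z s \<omega> + b * Z t \<omega>)\<^sup>2) = a\<^sup>2 + b\<^sup>2 + 2 * \<rho> s t * a * b" .
  show "integrable M (\<lambda>\<omega>. exp (a * Z s \<omega> + b * Z t \<omega>))"
    by (rule centred_gaussian_rv[OF gaussian_rv_pair E0])
  show "expectation (\<lambda>\<omega>. exp (a * Z s \<omega> + b * Z t \<omega>)) = exp ((a\<^sup>2 + b\<^sup>2 + 2 * \<rho> s t * a * b) / 2)"
    using centred_gaussian_rv(2)[OF gaussian_rv_pair E0] E2 by simp
qed

context
  fixes G :: "real \<Rightarrow> real"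
  assumes G [measurable]: "G \<in> borel_measurable borel"
    and G2: "integrable M (\<lambda>\<omega>. (G (Z 0 \<omega>))\<^sup>2)"
begin

lemma G_sq: "integrable std_normal_distribution (\<lambda>x. (G x)\<^sup>2)"
  using Z_transfer(1)[of "\<lambda>x. (G x)\<^sup>2" 0] G2 by simp

lemma GZ_sq_integrable: "integrable M (\<lambda>\<omega>. (G (Z t \<omega>))\<^sup>2)"
  using Z_transfer(1)[of "\<lambda>x. (G x)\<^sup>2" t] G_sq by simp

lemma GZ_integrable: "integrable M (\<lambda>\<omega>. G (Z t \<omega>))"
  using square_integrable_imp_integrable[of "\<lambda>\<omega>. G (Z t \<omega>)"] GZ_sq_integrable by simp

lemma hermite_coeff_eq: "hermite_coeff M Z G k = (\<integral>x. G x * hermite k x \<partial>std_normal_distribution)"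
  using Z_transfer(2)[of "\<lambda>x. G x * hermite k x" 0] by (simp add: hermite_coeff_def)

lemma GZ_mean: "expectation (\<lambda>\<omega>. G (Z t \<omega>)) = hermite_coeff M Z G 0"
  using Z_transfer(2)[of G t] by (simp add: hermite_coeff_eq)

lemma summable_hermite_coeff: "summable (\<lambda>k. (hermite_coeff M Z G k)\<^sup>2 / fact k)"
  using hermite_L2_approx(2)[OF G G_sq] by (simp add: hermite_coeff_eq)

lemma GZ_prod_sums:
  "(\<lambda>k. (hermite_coeff M Z G k)\<^sup>2 / fact k * autocov M Z (nat \<bar>int s - int t\<bar>) ^ k)
     sums expectation (\<lambda>\<omega>. G (Z s \<omega>) * G (Z t \<omega>))"
  unfolding hermite_coeff_eq
  by (rule gaussian_pair_product_sums[OF Z_measurable Z_measurable G Z_pair_exp Z_distr Z_distr G_sq])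

end

end


section \<open>Slowly varying functions\<close>

text \<open>Pointwise convergence makes these sets increase to \<open>{0..2}\<close>. The threshold
  \<open>3 / 2\<close> is what forces two measurable subsets of an interval of length 3 to
  meet.\<close>

lemma eventually_small_increments_measure:
  fixes f :: "real \<Rightarrow> real"
  assumes [measurable]: "f \<in> borel_measurable borel"
    and lim: "\<And>s. ((\<lambda>u. f (u + s) - f u) \<longlongrightarrow> 0) at_top"
    and v: "filterlim v at_top sequentially" and "0 < e"
  shows "\<forall>\<^sub>F n in sequentially. {y \<in> {0..2}. \<forall>k\<ge>n. \<bar>f (v k + y) - f (v k)\<bar> < e} \<in> lmeasurable \<and>
     3 / 2 < measure lebesgue {y \<in> {0..2}. \<forall>k\<ge>n. \<bar>f (v k + y) - f (v k)\<bar> < e}"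
proof -
  define V where "V n = {y \<in> {0..2}. \<forall>k\<ge>n. \<bar>f (v k + y) - f (v k)\<bar> < e}" for n
  have sub: "V n \<subseteq> {0..2}" for n by (auto simp: V_def)
  have "V n \<in> sets borel" for n
    unfolding V_def by measurable
  then have meas: "V n \<in> lmeasurable" for n
    using fmeasurableI2[of "{0..2}" lebesgue "V n"] sub by simp
  have "(\<Union>n. V n) = {0..2}"
  proof (intro equalityI subsetI)
    fix y :: real assume y: "y \<in> {0..2}"
    have "((\<lambda>k. f (v k + y) - f (v k)) \<longlongrightarrow> 0) sequentially"
      by (rule filterlim_compose[OF lim v])
    then have "\<forall>\<^sub>F k in sequentially. \<bar>f (v k + y) - f (v k)\<bar> < e"
      using \<open>0 < e\<close> tendstoD by fastforce
    then show "y \<in> (\<Union>n. V n)"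
      using y by (auto simp: V_def eventually_sequentially)
  qed (use sub in blast)
  moreover have "incseq V"
    by (auto simp: V_def incseq_def)
  moreover have "range V \<subseteq> sets lebesgue"
    using meas by (auto dest: fmeasurableD)
  ultimately have "(\<lambda>n. measure lebesgue (V n)) \<longlonglongrightarrow> measure lebesgue {0..2::real}"
    using Lim_measure_incseq[of V lebesgue] by simp
  then have "(\<lambda>n. measure lebesgue (V n)) \<longlonglongrightarrow> 2" by simp
  then have "\<forall>\<^sub>F n in sequentially. 3 / 2 < measure lebesgue (V n)"
    by (rule order_tendstoD) simp
  then show ?thesis
    using meas by (auto simp: V_def elim: eventually_mono)
qed

text \<open>Two subsets of \<open>{0..3}\<close> of measure above \<open>3/2\<close> intersect; a common point compares
  \<open>f (u + s)\<close> and \<open>f u\<close> with the same third value.\<close>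

lemma uniform_small_increments:
  fixes f :: "real \<Rightarrow> real"
  assumes f: "f \<in> borel_measurable borel"
    and lim: "\<And>s. ((\<lambda>u. f (u + s) - f u) \<longlongrightarrow> 0) at_top" and "0 < e"
  shows "\<exists>U. \<forall>u\<ge>U. \<forall>s\<in>{0..1}. \<bar>f (u + s) - f u\<bar> < e"
proof (rule ccontr)
  assume "\<not> ?thesis"
  then have "\<forall>n::nat. \<exists>u s. real n \<le> u \<and> s \<in> {0..1} \<and> e \<le> \<bar>f (u + s) - f u\<bar>"
    by (meson linorder_not_less)
  then obtain u s where us: "\<And>n::nat. real n \<le> u n" "\<And>n. s n \<in> {0..1}"
      "\<And>n. e \<le> \<bar>f (u n + s n) - f (u n)\<bar>"
    by metis
  define w where "w n = u n + s n" for n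
  have u: "filterlim u at_top sequentially"
    by (rule filterlim_at_top_mono[OF filterlim_real_sequentially]) (simp add: us)
  have w: "filterlim w at_top sequentially"
  proof (rule filterlim_at_top_mono[OF filterlim_real_sequentially], intro always_eventually allI)
    fix n show "real n \<le> w n" using us(1)[of n] us(2)[of n] by (simp add: w_def)
  qed
  define V W where "V n = {y \<in> {0..2}. \<forall>k\<ge>n. \<bar>f (u k + y) - f (u k)\<bar> < e / 2}"
    and "W n = {y \<in> {0..2}. \<forall>k\<ge>n. \<bar>f (w k + y) - f (w k)\<bar> < e / 2}" for n
  have "0 < e / 2" using \<open>0 < e\<close> by simp
  note ev = eventually_conj[OF eventually_small_increments_measure[OF f lim u this]
      eventually_small_increments_measure[OF f lim w this], folded V_def W_def]
  from eventually_happens'[OF sequentially_bot ev] obtain n where n: "V n \<in> lmeasurable" "3 / 2 < measure lebesgue (V n)"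
      "W n \<in> lmeasurable" "3 / 2 < measure lebesgue (W n)"
    by blast
  define W' where "W' = (+) (s n) ` W n"
  have W': "W' \<in> lmeasurable" "measure lebesgue W' = measure lebesgue (W n)"
    unfolding W'_def using n by (auto intro: measurable_translation measure_translation)
  have sub: "V n \<union> W' \<subseteq> {0..3}"
    using us(2)[of n] by (auto simp: V_def W_def W'_def)
  have "V n \<inter> W' \<noteq> {}"
  proof
    assume "V n \<inter> W' = {}"
    then have "measure lebesgue (V n \<union> W') = measure lebesgue (V n) + measure lebesgue W'"
      using measure_Un3[OF n(1) W'(1)] by simp
    moreover have "measure lebesgue (V n \<union> W') \<le> measure lebesgue {0..3::real}"
      using sub n W' by (intro measure_mono_fmeasurable) auto
    ultimately show False using n W' by simp
  qed
  then have "\<exists>z. z \<in> W n \<and> s n + z \<in> V n" by (auto simp: W'_def)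
  then obtain z where "\<bar>f (w n + z) - f (w n)\<bar> < e / 2" "\<bar>f (u n + (s n + z)) - f (u n)\<bar> < e / 2"
    by (auto simp: V_def W_def)
  then have "\<bar>f (u n + s n) - f (u n)\<bar> < e"
    unfolding w_def add.assoc by linarith
  with us(3)[of n] show False by simp
qed

text \<open>On the logarithmic scale \<open>f u = ln (L (exp u))\<close> increments over steps of
  length at most 1 stay below \<open>\<delta>\<close> beyond some \<open>U\<close>, so
  \<open>f\<close> grows at most linearly with slope \<open>\<delta>\<close>, which is a power bound
  for \<open>L\<close>.\<close>

lemma slowly_varying_bound:
  assumes L: "slowly_varying L" and "0 < \<delta>"
  shows "\<exists>C. \<forall>\<^sub>F x in at_top. L x \<le> C * x powr \<delta>"
proof -
  have pos: "0 < L x" if "0 < x" for x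
    using L that by (simp add: slowly_varying_def)
  define f where "f u = ln (L (exp u))" for u
  have "(\<lambda>u::real. L (exp u)) \<in> borel_measurable borel"
  proof (rule measurable_compose[of exp _ "restrict_space borel {0<..}" L])
    show "exp \<in> measurable borel (restrict_space borel {0::real<..})"
      by (intro measurable_restrict_space2) auto
  qed (use L in \<open>simp add: slowly_varying_def\<close>)
  then have f: "f \<in> borel_measurable borel"
    unfolding f_def[abs_def] by measurable
  have lim: "((\<lambda>u. f (u + s) - f u) \<longlongrightarrow> 0) at_top" for s
  proof -
    have "((\<lambda>x. L (exp s * x) / L x) \<longlongrightarrow> 1) at_top"
      using L by (simp add: slowly_varying_def)
    then have "((\<lambda>u. L (exp s * exp u) / L (exp u)) \<longlongrightarrow> 1) at_top"
      by (rule filterlim_compose[OF _ exp_at_top])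
    then have "((\<lambda>u. ln (L (exp s * exp u) / L (exp u))) \<longlongrightarrow> ln 1) at_top"
      by (intro tendsto_ln) auto
    moreover have "L (exp u * exp s) \<noteq> 0" "L (exp u) \<noteq> 0" for u
      using pos[of "exp u * exp s"] pos[of "exp u"] by auto
    ultimately show ?thesis
      by (simp add: f_def exp_add mult.commute ln_div)
  qed
  obtain U where U: "\<And>u s. U \<le> u \<Longrightarrow> 0 \<le> s \<Longrightarrow> s \<le> 1 \<Longrightarrow> \<bar>f (u + s) - f u\<bar> < \<delta>"
    using uniform_small_increments[OF f lim \<open>0 < \<delta>\<close>] by (auto simp: Ball_def)
  have grow: "f (U + t) \<le> f U + \<delta> * real n" if "0 \<le> t" "t \<le> real n" for t n
    using that
  proof (induction n arbitrary: t)
    case 0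
    then show ?case by simp
  next
    case (Suc n)
    show ?case
    proof (cases "t \<le> 1")
      case True
      then have "f (U + t) \<le> f U + \<delta>" using U[of U t] Suc.prems by simp
      moreover have "\<delta> * real n \<ge> 0" using \<open>0 < \<delta>\<close> by simp
      ultimately show ?thesis by (simp add: algebra_simps)
    next
      case False
      then have "f (U + (t - 1) + 1) \<le> f (U + (t - 1)) + \<delta>" using U[of "U + (t - 1)" 1] by simp
      moreover have "f (U + (t - 1)) \<le> f U + \<delta> * real n" using Suc False by auto
      ultimately show ?thesis by (simp add: algebra_simps)
    qed
  qed
  have "L x \<le> exp (f U + \<delta> * (1 - U)) * x powr \<delta>" if "exp U \<le> x" for x
  proof -
    have x: "0 < x" using that by (smt (verit) exp_gt_zero)
    have t: "0 \<le> ln x - U" using that x by (simp add: ln_ge_iff)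
    have "f (U + (ln x - U)) \<le> f U + \<delta> * real (nat \<lceil>ln x - U\<rceil>)"
      using t by (intro grow) linarith+
    \<comment> \<open>Rounding up to whole steps costs at most one more, which accounts for the
      \<open>1\<close> in the constant \<open>exp (f U + \<delta> * (1 - U))\<close>.\<close>
    also have "\<dots> \<le> f U + \<delta> * (ln x - U + 1)"
      using t \<open>0 < \<delta>\<close> by (intro add_left_mono mult_left_mono) linarith+
    finally have "ln (L x) \<le> f U + \<delta> * (1 - U) + \<delta> * ln x"
      using x by (simp add: f_def algebra_simps)
    then have "L x \<le> exp (f U + \<delta> * (1 - U) + \<delta> * ln x)"
      using pos[OF x] by (simp add: ln_le_cancel_iff[symmetric] del: ln_le_cancel_iff)
    then show ?thesis using x by (simp add: powr_def exp_add)
  qed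
  then show ?thesis
    by (intro exI eventually_mono[OF eventually_ge_at_top[of "exp U"]])
qed


section \<open>Expectations of the block estimators\<close>

text \<open>Isolates the second-order structure: the expectations of both estimators are computed
  from the common mean and the covariances alone.\<close>

locale weakly_stationary = prob_space M for M :: "'a measure" +
  fixes X :: "nat \<Rightarrow> 'a \<Rightarrow> real" and \<mu> :: real and r :: "nat \<Rightarrow> real"
  assumes X_measurable [measurable]: "\<And>t. X t \<in> borel_measurable M"
    and X_integrable: "\<And>t. integrable M (X t)"
    and X_mean: "\<And>t. expectation (X t) = \<mu>"
    and XX_integrable: "\<And>s t. integrable M (\<lambda>\<omega>. (X s \<omega> - \<mu>) * (X t \<omega> - \<mu>))"
    and X_cov: "\<And>s t. expectation (\<lambda>\<omega>. (X s \<omega> - \<mu>) * (X t \<omega> - \<mu>)) = r (nat \<bar>int s - int t\<bar>)"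
begin

definition cov_sum :: "nat set \<Rightarrow> nat set \<Rightarrow> real" where
  "cov_sum A B = (\<Sum>s\<in>A. \<Sum>t\<in>B. r (nat \<bar>int s - int t\<bar>))"

text \<open>Variance of a sum of \<open>k\<close> consecutive observations.\<close>

definition Q :: "nat \<Rightarrow> real" where
  "Q k = cov_sum {..<k} {..<k}"

lemma Q_0 [simp]: "Q 0 = 0"
  by (simp add: Q_def cov_sum_def)

lemma Q_Suc: "Q (Suc n) = Q n + r 0 + 2 * (\<Sum>k=1..n. r k)"
proof -
  have *: "(\<Sum>s<n. r (nat (int n - int s))) = (\<Sum>k=1..n. r k)"
    by (rule sum.reindex_bij_witness[of _ "\<lambda>k. n - k" "\<lambda>s. n - s"]) (auto simp: of_nat_diff nat_diff_distrib')
  have "(\<Sum>s<n. r (nat \<bar>int s - int n\<bar>)) = (\<Sum>k=1..n. r k)" "(\<Sum>t<n. r (nat \<bar>int n - int t\<bar>)) = (\<Sum>k=1..n. r k)"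
    unfolding *[symmetric] by (auto intro!: sum.cong)
  then show ?thesis
    unfolding Q_def cov_sum_def sum.lessThan_Suc sum.distrib by simp
qed

text \<open>Collects the lags in an iterated sum, to which the Stolz-Cesaro theorem can be applied
  twice.\<close>

lemma Q_eq: "Q n = real n * r 0 + 2 * (\<Sum>i<n. \<Sum>k=1..i. r k)"
  by (induction n) (simp_all add: Q_Suc algebra_simps)

lemma cov_sum_shift: "cov_sum {i..<i+k} {i..<i+k} = Q k"
proof -
  have *: "sum f {i..<i+k} = (\<Sum>s<k. f (s + i))" for f :: "nat \<Rightarrow> real"
    using sum.shift_bounds_nat_ivl[of f 0 i k] by (simp add: add.commute atLeast0LessThan)
  show ?thesis
    unfolding cov_sum_def Q_def * by simp
qed

text \<open>Nonnegative covariances make the double sum monotone in both index sets; this stands in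
  for an exact count of lags when blocks overlap.\<close>

lemma cov_sum_mono:
  assumes "\<And>k. 0 \<le> r k" "A \<subseteq> A'" "B \<subseteq> B'" "finite A'" "finite B'"
  shows "cov_sum A B \<le> cov_sum A' B'"
proof -
  have "cov_sum A B \<le> (\<Sum>s\<in>A. \<Sum>t\<in>B'. r (nat \<bar>int s - int t\<bar>))"
    unfolding cov_sum_def using assms by (intro sum_mono sum_mono2) auto
  also have "\<dots> \<le> cov_sum A' B'"
    unfolding cov_sum_def using assms by (intro sum_mono2 sum_nonneg) auto
  finally show ?thesis .
qed

lemma expectation_sum_mult:
  shows "integrable M (\<lambda>\<omega>. (\<Sum>s\<in>A. X s \<omega> - \<mu>) * (\<Sum>t\<in>B. X t \<omega> - \<mu>))"
    and "expectation (\<lambda>\<omega>. (\<Sum>s\<in>A. X s \<omega> - \<mu>) * (\<Sum>t\<in>B. X t \<omega> - \<mu>)) = cov_sum A B"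
  unfolding sum_product cov_sum_def
  by (simp_all add: XX_integrable X_cov)

lemma expectation_block_sq:
  "integrable M (\<lambda>\<omega>. (\<Sum>s\<in>{i..<i+k}. X s \<omega> - \<mu>)\<^sup>2)"
  "expectation (\<lambda>\<omega>. (\<Sum>s\<in>{i..<i+k}. X s \<omega> - \<mu>)\<^sup>2) = Q k"
  unfolding power2_eq_square
  by (rule expectation_sum_mult, subst expectation_sum_mult, rule cov_sum_shift)

lemma block_mean_centred:
  assumes "0 < l"
  shows "block_mean X i l \<omega> - \<mu> = (\<Sum>s\<in>{i..<i+l}. X s \<omega> - \<mu>) / real l"
proof -
  have "{i..i+l-1} = {i..<i+l}" using assms by auto
  then show ?thesis
    using assms by (simp add: block_mean_def sum_subtractf field_simps)
qed

lemma sample_mean_eq_block_mean: "0 < n \<Longrightarrow> sample_mean X n = block_mean X 1 n"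
  by (simp add: sample_mean_def block_mean_def fun_eq_iff)

lemma block_mean_variance:
  assumes "0 < l"
  shows "integrable M (\<lambda>\<omega>. (block_mean X i l \<omega> - \<mu>)\<^sup>2)"
    and "expectation (\<lambda>\<omega>. (block_mean X i l \<omega> - \<mu>)\<^sup>2) = Q l / (real l)\<^sup>2"
  unfolding block_mean_centred[OF assms] power_divide
  using expectation_block_sq[of i l] by simp_all

lemma variance_sample_mean:
  assumes "0 < n"
  shows "variance (sample_mean X n) = Q n / (real n)\<^sup>2"
proof -
  have "expectation (sample_mean X n) = \<mu>"
    using assms unfolding sample_mean_def by (simp add: X_integrable X_mean)
  then show ?thesis
    using block_mean_variance(2)[OF assms, of 1] assms by (simp add: sample_mean_eq_block_mean)
qed

text \<open>Decomposition of squares about their own mean: the cross term collapses to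
  \<open>- 2 * card I * (mn \<omega> - \<mu>)\<^sup>2\<close>. It holds for each
  \<open>\<omega>\<close>, whatever the dependence between the \<open>Y i\<close>, so both
  estimators share it.\<close>

lemma expectation_centred_squares:
  assumes I: "finite I" "I \<noteq> {}"
    and Y2: "\<And>i. i \<in> I \<Longrightarrow> integrable M (\<lambda>\<omega>. (Y i \<omega> - \<mu>)\<^sup>2)"
    and v: "\<And>i. i \<in> I \<Longrightarrow> expectation (\<lambda>\<omega>. (Y i \<omega> - \<mu>)\<^sup>2) = v"
    and m: "\<And>\<omega>. mn \<omega> = (\<Sum>i\<in>I. Y i \<omega>) / real (card I)"
    and m2: "integrable M (\<lambda>\<omega>. (mn \<omega> - \<mu>)\<^sup>2)"
  shows "expectation (\<lambda>\<omega>. (\<Sum>i\<in>I. A * (Y i \<omega> - mn \<omega>)\<^sup>2) / real (card I))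
     = A * (v - expectation (\<lambda>\<omega>. (mn \<omega> - \<mu>)\<^sup>2))"
proof -
  have c: "real (card I) > 0" using I by (simp add: card_gt_0_iff)
  have eq: "(\<Sum>i\<in>I. A * (Y i \<omega> - mn \<omega>)\<^sup>2) / real (card I)
      = A * ((\<Sum>i\<in>I. (Y i \<omega> - \<mu>)\<^sup>2) / real (card I) - (mn \<omega> - \<mu>)\<^sup>2)" for \<omega>
  proof -
    have s: "(\<Sum>i\<in>I. Y i \<omega> - \<mu>) = real (card I) * (mn \<omega> - \<mu>)"
      using c by (simp add: m sum_subtractf field_simps)
    have "(\<Sum>i\<in>I. (Y i \<omega> - mn \<omega>)\<^sup>2)
        = (\<Sum>i\<in>I. (Y i \<omega> - \<mu>)\<^sup>2 - 2 * (mn \<omega> - \<mu>) * (Y i \<omega> - \<mu>) + (mn \<omega> - \<mu>)\<^sup>2)"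
      by (intro sum.cong refl) (simp add: power2_eq_square algebra_simps)
    also have "\<dots> = (\<Sum>i\<in>I. (Y i \<omega> - \<mu>)\<^sup>2) - 2 * (mn \<omega> - \<mu>) * (\<Sum>i\<in>I. Y i \<omega> - \<mu>) + real (card I) * (mn \<omega> - \<mu>)\<^sup>2"
      by (simp only: sum.distrib sum_subtractf[of "\<lambda>i. (Y i \<omega> - \<mu>)\<^sup>2" "\<lambda>i. 2 * (mn \<omega> - \<mu>) * (Y i \<omega> - \<mu>)"] sum_distrib_left[symmetric] sum_constant)
    also have "\<dots> = (\<Sum>i\<in>I. (Y i \<omega> - \<mu>)\<^sup>2) - real (card I) * (mn \<omega> - \<mu>)\<^sup>2"
      unfolding s by (simp add: power2_eq_square algebra_simps)
    finally have e: "(\<Sum>i\<in>I. (Y i \<omega> - mn \<omega>)\<^sup>2) = (\<Sum>i\<in>I. (Y i \<omega> - \<mu>)\<^sup>2) - real (card I) * (mn \<omega> - \<mu>)\<^sup>2" .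
    show ?thesis
      unfolding sum_distrib_left[symmetric] e using c by (simp add: field_simps)
  qed
  have "expectation (\<lambda>\<omega>. (\<Sum>i\<in>I. (Y i \<omega> - \<mu>)\<^sup>2) / real (card I)) = v"
    using c Y2 v by simp
  then show ?thesis
    unfolding eq using Y2 m2 by simp
qed

text \<open>Non-overlapping blocks tile the first \<open>n div l * l\<close> observations, so the
  mean of the block means is exactly a sample mean of that length.\<close>

lemma expectation_V_NOL:
  assumes "0 < l" "l \<le> n"
  shows "expectation (V_NOL X a n l)
     = real l powr a * (Q l / (real l)\<^sup>2 - Q (n div l * l) / (real (n div l * l))\<^sup>2)"
proof -
  define b where "b = n div l"
  have b: "0 < b" using assms by (simp add: b_def div_greater_zero_iff)
  have bl: "0 < b * l" using b assms by simp
  have "mu_NOL X n l \<omega> = block_mean X 1 (b * l) \<omega>" for \<omega>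
  proof -
    have "(\<Sum>i=1..b. \<Sum>j=1+(i-1)*l..1+(i-1)*l+l-1. X j \<omega>) = (\<Sum>i<b. \<Sum>j=1+i*l..1+i*l+l-1. X j \<omega>)"
      by (rule sum.reindex_bij_witness[of _ Suc "\<lambda>i. i - 1"]) auto
    also have "\<dots> = (\<Sum>i<b. \<Sum>j\<in>{i*l..<i*l+l}. X (Suc j) \<omega>)"
    proof (rule sum.cong[OF refl])
      fix i
      have "{1+i*l..1+i*l+l-1} = {Suc (i*l)..<Suc (i*l+l)}" using assms by auto
      then show "(\<Sum>j=1+i*l..1+i*l+l-1. X j \<omega>) = (\<Sum>j\<in>{i*l..<i*l+l}. X (Suc j) \<omega>)"
        by (simp only: sum.shift_bounds_Suc_ivl)
    qed
    also have "\<dots> = (\<Sum>j<b*l. X (Suc j) \<omega>)"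
      by (rule sum.nat_group)
    also have "\<dots> = (\<Sum>j=1..1+b*l-1. X j \<omega>)"
      by (rule sum.reindex_bij_witness[of _ "\<lambda>i. i - 1" Suc]) auto
    finally show ?thesis
      by (simp add: mu_NOL_def block_mean_def b_def[symmetric] sum_divide_distrib[symmetric])
  qed
  then have mu: "mu_NOL X n l = block_mean X 1 (b * l)" by blast
  have muN: "block_mean X 1 (b * l) \<omega> = (\<Sum>i\<in>{1..b}. block_mean X (1 + (i - 1) * l) l \<omega>) / real (card {1..b})" for \<omega>
    unfolding mu[symmetric] mu_NOL_def b_def[symmetric] by simp
  have "expectation (\<lambda>\<omega>. (\<Sum>i\<in>{1..b}. real l powr a * (block_mean X (1 + (i - 1) * l) l \<omega> - block_mean X 1 (b * l) \<omega>)\<^sup>2) / real (card {1..b}))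
     = real l powr a * (Q l / (real l)\<^sup>2 - expectation (\<lambda>\<omega>. (block_mean X 1 (b * l) \<omega> - \<mu>)\<^sup>2))"
    by (rule expectation_centred_squares[OF _ _ _ _ muN])
       (use b bl assms(1) in \<open>auto simp: block_mean_variance\<close>)
  then show ?thesis
    unfolding V_NOL_def[abs_def] mu using block_mean_variance(2)[OF bl, of 1] by (simp add: b_def)
qed

text \<open>The mean of all block means averages the sums over the windows \<open>{1+d..N+d}\<close> with \<open>d < l\<close>, where
  \<open>N = n - l + 1\<close>; each window lies in \<open>{1..n}\<close> and contains \<open>{l..N}\<close>.\<close>

lemma expectation_V_OL:
  assumes r: "\<And>k. 0 \<le> r k" and l: "0 < l" "l \<le> n"
  obtains W where "expectation (V_OL X a n l) = real l powr a * (Q l / (real l)\<^sup>2 - W)"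
    and "Q (n + 2 - 2 * l) \<le> (real (n - l + 1))\<^sup>2 * W" and "(real (n - l + 1))\<^sup>2 * W \<le> Q n"
proof -
  define N where "N = n - l + 1"
  have N: "0 < N" by (simp add: N_def)
  define w where "w d = {1+d..<1+d+N}" for d
  have mu: "mu_OL X n l \<omega> - \<mu> = (\<Sum>d<l. \<Sum>s\<in>w d. X s \<omega> - \<mu>) / (real N * real l)" for \<omega>
  proof -
    have "mu_OL X n l \<omega> - \<mu> = (\<Sum>i=1..N. block_mean X i l \<omega> - \<mu>) / real N"
      using N by (simp only: mu_OL_def N_def[symmetric] sum_subtractf) (simp add: field_simps)
    also have "\<dots> = (\<Sum>i=1..N. \<Sum>s\<in>{i..<i+l}. X s \<omega> - \<mu>) / (real N * real l)"
      by (simp add: block_mean_centred[OF l(1)] sum_divide_distrib[symmetric])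
    also have "(\<Sum>i=1..N. \<Sum>s\<in>{i..<i+l}. X s \<omega> - \<mu>) = (\<Sum>i=1..N. \<Sum>d<l. X (i + d) \<omega> - \<mu>)"
    proof (rule sum.cong[OF refl])
      fix i show "(\<Sum>s\<in>{i..<i+l}. X s \<omega> - \<mu>) = (\<Sum>d<l. X (i + d) \<omega> - \<mu>)"
        by (rule sum.reindex_bij_witness[of _ "\<lambda>d. i + d" "\<lambda>s. s - i"]) auto
    qed
    \<comment> \<open>The position inside the block becomes the outer index: for a fixed offset
      \<open>d\<close> the starting points sweep out the window \<open>w d\<close>.\<close>
    also have "\<dots> = (\<Sum>d<l. \<Sum>i=1..N. X (i + d) \<omega> - \<mu>)"
      by (rule sum.swap)
    also have "\<dots> = (\<Sum>d<l. \<Sum>s\<in>w d. X s \<omega> - \<mu>)"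
    proof (rule sum.cong[OF refl])
      fix d show "(\<Sum>i=1..N. X (i + d) \<omega> - \<mu>) = (\<Sum>s\<in>w d. X s \<omega> - \<mu>)"
        unfolding w_def by (rule sum.reindex_bij_witness[of _ "\<lambda>s. s - d" "\<lambda>i. i + d"]) auto
    qed
    finally show ?thesis .
  qed
  have sq: "(mu_OL X n l \<omega> - \<mu>)\<^sup>2
     = (\<Sum>d<l. \<Sum>d'<l. (\<Sum>s\<in>w d. X s \<omega> - \<mu>) * (\<Sum>s\<in>w d'. X s \<omega> - \<mu>)) / (real N * real l)\<^sup>2" for \<omega>
    unfolding mu power_divide power2_eq_square[of "sum _ _"] sum_product ..
  define W where "W = expectation (\<lambda>\<omega>. (mu_OL X n l \<omega> - \<mu>)\<^sup>2)"
  have int: "integrable M (\<lambda>\<omega>. (mu_OL X n l \<omega> - \<mu>)\<^sup>2)"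
    unfolding sq by (intro integrable_divide Bochner_Integration.integrable_sum expectation_sum_mult)
  have "W = (\<Sum>d<l. \<Sum>d'<l. cov_sum (w d) (w d')) / (real N * real l)\<^sup>2"
    unfolding W_def sq by (simp add: expectation_sum_mult)
  then have W: "(real N)\<^sup>2 * W = (\<Sum>d<l. \<Sum>d'<l. cov_sum (w d) (w d')) / (real l)\<^sup>2"
    using N by (simp add: power_mult_distrib)
  have up: "cov_sum (w d) (w d') \<le> Q n" if "d < l" "d' < l" for d d'
    unfolding cov_sum_shift[of 1 n, symmetric]
    using that l by (intro cov_sum_mono r) (auto simp: w_def N_def)
  \<comment> \<open>The common part \<open>{l..N}\<close> has \<open>n + 2 - 2 * l\<close> elements;
    for long blocks truncated subtraction turns the bound into \<open>Q 0 = 0\<close>.\<close>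
  have lo: "Q (n + 2 - 2 * l) \<le> cov_sum (w d) (w d')" if "d < l" "d' < l" for d d'
    unfolding cov_sum_shift[of l "n + 2 - 2 * l", symmetric]
    using that l by (intro cov_sum_mono r) (auto simp: w_def N_def)
  have "(\<Sum>d<l. \<Sum>d'<l. cov_sum (w d) (w d')) \<le> (\<Sum>d<l. \<Sum>d'<l. Q n)"
    by (intro sum_mono up) auto
  then have 1: "(real N)\<^sup>2 * W \<le> Q n"
    unfolding W using l by (simp add: divide_le_eq power2_eq_square mult_ac)
  have "(\<Sum>d<l. \<Sum>d'<l. Q (n + 2 - 2 * l)) \<le> (\<Sum>d<l. \<Sum>d'<l. cov_sum (w d) (w d'))"
    by (intro sum_mono lo) auto
  then have 2: "Q (n + 2 - 2 * l) \<le> (real N)\<^sup>2 * W"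
    unfolding W using l by (simp add: le_divide_eq power2_eq_square mult_ac)
  have muN: "mu_OL X n l \<omega> = (\<Sum>i\<in>{1..N}. block_mean X i l \<omega>) / real (card {1..N})" for \<omega>
    unfolding mu_OL_def N_def[symmetric] by simp
  have "expectation (\<lambda>\<omega>. (\<Sum>i\<in>{1..N}. real l powr a * (block_mean X i l \<omega> - mu_OL X n l \<omega>)\<^sup>2) / real (card {1..N}))
     = real l powr a * (Q l / (real l)\<^sup>2 - expectation (\<lambda>\<omega>. (mu_OL X n l \<omega> - \<mu>)\<^sup>2))"
    by (rule expectation_centred_squares[OF _ _ _ _ muN int])
       (use N l in \<open>auto simp: block_mean_variance\<close>)
  then have "expectation (V_OL X a n l) = real l powr a * (Q l / (real l)\<^sup>2 - W)"
    unfolding V_OL_def[abs_def] W_def by (simp add: N_def)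
  from that[OF this] 1 2 show ?thesis by (simp add: N_def)
qed

end


section \<open>Asymptotics of Cesaro sums\<close>

lemma stolz_cesaro:
  fixes x b :: "nat \<Rightarrow> real"
  assumes inc: "\<forall>\<^sub>F n in sequentially. b n < b (Suc n)" and b: "filterlim b at_top sequentially"
    and lim: "(\<lambda>n. (x (Suc n) - x n) / (b (Suc n) - b n)) \<longlonglongrightarrow> c"
  shows "(\<lambda>n. x n / b n) \<longlonglongrightarrow> c"
proof -
  \<comment> \<open>Reduces the claim to the limit \<open>0\<close>. Half of \<open>e\<close> pays
    for the telescoped increments, the other half for the starting value \<open>y N\<close>.\<close>
  define y where "y n = x n - c * b n" for n
  have "(\<lambda>n. y n / b n) \<longlonglongrightarrow> 0"
  proof (rule tendstoI)
    fix e :: real assume "0 < e"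
    then have e2: "0 < e / 2" by simp
    have "\<forall>\<^sub>F n in sequentially. 0 \<le> b n"
      using b by (auto simp: filterlim_at_top)
    moreover have "\<forall>\<^sub>F n in sequentially. \<bar>(x (Suc n) - x n) / (b (Suc n) - b n) - c\<bar> < e / 2"
      using tendstoD[OF lim e2] by (simp add: dist_real_def)
    ultimately have "\<forall>\<^sub>F n in sequentially. 0 \<le> b n \<and> \<bar>y (Suc n) - y n\<bar> \<le> e / 2 * (b (Suc n) - b n)"
      using inc
    proof eventually_elim
      case (elim n)
      have "\<bar>y (Suc n) - y n\<bar> = \<bar>(x (Suc n) - x n) / (b (Suc n) - b n) - c\<bar> * (b (Suc n) - b n)"
        using elim by (simp add: y_def abs_mult_pos' field_simps)
      then show ?case
        using elim by (simp add: mult_right_mono)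
    qed
    then obtain N where N: "\<And>n. n \<ge> N \<Longrightarrow> 0 \<le> b n"
        "\<And>n. n \<ge> N \<Longrightarrow> \<bar>y (Suc n) - y n\<bar> \<le> e / 2 * (b (Suc n) - b n)"
      by (auto simp: eventually_sequentially)
    have y: "\<bar>y n\<bar> \<le> \<bar>y N\<bar> + e / 2 * (b n - b N)" if "n \<ge> N" for n
      using that
    proof (induction n rule: dec_induct)
      case (step n)
      have "\<bar>y (Suc n)\<bar> \<le> \<bar>y n\<bar> + \<bar>y (Suc n) - y n\<bar>" by simp
      also have "\<dots> \<le> \<bar>y N\<bar> + e / 2 * (b n - b N) + e / 2 * (b (Suc n) - b n)"
        using step N(2)[of n] by linarith
      finally show ?case by (simp add: field_simps)
    qed simp
    have "\<forall>\<^sub>F n in sequentially. 2 * \<bar>y N\<bar> / e + 1 \<le> b n"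
      using b by (auto simp: filterlim_at_top)
    then show "\<forall>\<^sub>F n in sequentially. dist (y n / b n) 0 < e"
      using eventually_ge_at_top[of N]
    proof eventually_elim
      case (elim n)
      have bn: "0 < b n"
        using elim \<open>0 < e\<close> by (smt (verit) divide_nonneg_pos)
      have "\<bar>y n\<bar> \<le> \<bar>y N\<bar> + e / 2 * (b n - b N)" by (rule y) fact
      also have "\<dots> \<le> \<bar>y N\<bar> + e / 2 * b n"
        using N(1)[of N] \<open>0 < e\<close> by simp
      also have "\<bar>y N\<bar> < e / 2 * b n"
        using elim(1) \<open>0 < e\<close> by (simp add: field_simps)
      finally have "\<bar>y n\<bar> < e * b n" by simp
      then show ?case using bn by (simp add: dist_real_def field_simps)
    qed
  qed
  moreover have "\<forall>\<^sub>F n in sequentially. b n \<noteq> 0"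
    using b by (auto simp: filterlim_at_top_dense elim!: allE[of _ 0] eventually_mono)
  ultimately have "(\<lambda>n. y n / b n + c) \<longlonglongrightarrow> 0 + c"
    by (intro tendsto_intros)
  moreover have "\<forall>\<^sub>F n in sequentially. y n / b n + c = x n / b n"
    using \<open>\<forall>\<^sub>F n in sequentially. b n \<noteq> 0\<close> by eventually_elim (simp add: y_def field_simps)
  ultimately show ?thesis
    by (simp add: tendsto_cong)
qed

section \<open>Iterated sums of covariances\<close>

definition partial_sum :: "(nat \<Rightarrow> real) \<Rightarrow> nat \<Rightarrow> real" where
  "partial_sum x n = (\<Sum>k=1..n. x k)"

text \<open>Equals the sum of \<open>(n - k) * x k\<close> over \<open>1 \<le> k < n\<close>, that
  is, half of the off-diagonal part of the variance of a sum of \<open>n\<close> terms with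
  covariances \<open>x\<close>.\<close>

definition cesaro_sum :: "(nat \<Rightarrow> real) \<Rightarrow> nat \<Rightarrow> real" where
  "cesaro_sum x n = (\<Sum>i<n. partial_sum x i)"

lemma partial_sum_Suc: "partial_sum x (Suc n) - partial_sum x n = x (Suc n)"
  by (simp add: partial_sum_def)

lemma cesaro_sum_Suc: "cesaro_sum x (Suc n) - cesaro_sum x n = partial_sum x n"
  by (simp add: cesaro_sum_def)

lemma cesaro_sum_linear:
  "cesaro_sum (\<lambda>k. c * x k + d * y k) n = c * cesaro_sum x n + d * cesaro_sum y n"
  by (simp add: cesaro_sum_def partial_sum_def sum.distrib sum_distrib_left)

lemma cesaro_sum_cong:
  "(\<And>k. 0 < k \<Longrightarrow> x k = y k) \<Longrightarrow> cesaro_sum x n = cesaro_sum y n"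
  by (simp add: cesaro_sum_def partial_sum_def)

lemma cesaro_sum_summable:
  assumes "summable (\<lambda>k. x (Suc k))"
  shows "(\<lambda>n. cesaro_sum x n / real n) \<longlonglongrightarrow> (\<Sum>k. x (Suc k))"
proof (rule stolz_cesaro)
  have "partial_sum x n = (\<Sum>k<n. x (Suc k))" for n
    unfolding partial_sum_def by (rule sum.reindex_bij_witness[of _ Suc "\<lambda>k. k - 1"]) auto
  then show "(\<lambda>n. (cesaro_sum x (Suc n) - cesaro_sum x n) / (real (Suc n) - real n)) \<longlonglongrightarrow> (\<Sum>k. x (Suc k))"
    using summable_LIMSEQ[OF assms] by (simp add: cesaro_sum_Suc)
qed (auto intro: filterlim_real_sequentially)

text \<open>Each of two applications of Stolz-Cesaro raises the exponent by one and divides by the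
  new exponent, whence \<open>(1 - \<beta>) * (2 - \<beta>)\<close>.\<close>

lemma cesaro_sum_powr:
  assumes \<beta>: "0 \<le> \<beta>" "\<beta> < 1" and x: "(\<lambda>n. x n * real n powr \<beta>) \<longlonglongrightarrow> c"
  shows "(\<lambda>n. cesaro_sum x n / real n powr (2 - \<beta>)) \<longlonglongrightarrow> c / ((1 - \<beta>) * (2 - \<beta>))"
proof -
  have "(\<lambda>n. partial_sum x n / real n powr (1 - \<beta>)) \<longlonglongrightarrow> c * (1 / (1 - \<beta>))"
  proof (rule stolz_cesaro)
    show "\<forall>\<^sub>F n in sequentially. real n powr (1 - \<beta>) < real (Suc n) powr (1 - \<beta>)"
      using \<beta> by (intro always_eventually allI powr_less_mono2) auto
    show "filterlim (\<lambda>n. real n powr (1 - \<beta>)) at_top sequentially"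
      using \<beta> by real_asymp
    have *: "(\<lambda>n. real (Suc n) powr - \<beta> / (real (Suc n) powr (1 - \<beta>) - real n powr (1 - \<beta>))) \<longlonglongrightarrow> 1 / (1 - \<beta>)"
      using \<beta> by real_asymp (simp add: field_simps)
    have "x (Suc n) * real (Suc n) powr \<beta> * (real (Suc n) powr - \<beta> / D) = x (Suc n) / D" for n D
      by (simp add: powr_minus field_simps)
    then show "(\<lambda>n. (partial_sum x (Suc n) - partial_sum x n) / (real (Suc n) powr (1 - \<beta>) - real n powr (1 - \<beta>))) \<longlonglongrightarrow> c * (1 / (1 - \<beta>))"
      using tendsto_mult[OF LIMSEQ_Suc[OF x] *] by (simp only: partial_sum_Suc)
  qed
  then have "(\<lambda>n. partial_sum x n / real n powr (1 - \<beta>)) \<longlonglongrightarrow> c / (1 - \<beta>)"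
    by simp
  note T = this
  have "(\<lambda>n. cesaro_sum x n / real n powr (2 - \<beta>)) \<longlonglongrightarrow> c / (1 - \<beta>) * (1 / (2 - \<beta>))"
  proof (rule stolz_cesaro)
    show "\<forall>\<^sub>F n in sequentially. real n powr (2 - \<beta>) < real (Suc n) powr (2 - \<beta>)"
      using \<beta> by (intro always_eventually allI powr_less_mono2) auto
    show "filterlim (\<lambda>n. real n powr (2 - \<beta>)) at_top sequentially"
      using \<beta> by real_asymp
    have "(\<lambda>n. real n powr (1 - \<beta>) / (real (Suc n) powr (2 - \<beta>) - real n powr (2 - \<beta>))) \<longlonglongrightarrow> 1 / (2 - \<beta>)"
      using \<beta> by real_asymp (simp add: field_simps)
    from tendsto_mult[OF T this]
    have "(\<lambda>n. partial_sum x n / real n powr (1 - \<beta>) * (real n powr (1 - \<beta>) / (real (Suc n) powr (2 - \<beta>) - real n powr (2 - \<beta>)))) \<longlonglongrightarrow> c / (1 - \<beta>) * (1 / (2 - \<beta>))" .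
    then show "(\<lambda>n. (cesaro_sum x (Suc n) - cesaro_sum x n) / (real (Suc n) powr (2 - \<beta>) - real n powr (2 - \<beta>))) \<longlonglongrightarrow> c / (1 - \<beta>) * (1 / (2 - \<beta>))"
      by (rule Lim_transform_eventually, intro eventually_mono[OF eventually_gt_at_top[of 0]]) (simp add: cesaro_sum_Suc)
  qed
  then show ?thesis by simp
qed

text \<open>The boundary exponent 1: the inner sums grow like \<open>c * ln n\<close>, and summing
  them gives \<open>c * n * ln n\<close> without a further constant.\<close>

lemma cesaro_sum_ln:
  assumes x: "(\<lambda>n. x n * real n) \<longlonglongrightarrow> c"
  shows "(\<lambda>n. cesaro_sum x n / (real n * ln (real n))) \<longlonglongrightarrow> c"
proof -
  have T: "(\<lambda>n. partial_sum x n / ln (real n)) \<longlonglongrightarrow> c"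
  proof (rule stolz_cesaro)
    show "\<forall>\<^sub>F n in sequentially. ln (real n) < ln (real (Suc n))"
      using eventually_gt_at_top[of 0] by eventually_elim simp
    show "filterlim (\<lambda>n. ln (real n)) at_top sequentially"
      by real_asymp
    have "(\<lambda>n. 1 / real (Suc n) / (ln (real (Suc n)) - ln (real n))) \<longlonglongrightarrow> 1"
      by real_asymp
    from tendsto_mult[OF LIMSEQ_Suc[OF x] this]
    show "(\<lambda>n. (partial_sum x (Suc n) - partial_sum x n) / (ln (real (Suc n)) - ln (real n))) \<longlonglongrightarrow> c"
      by (simp add: partial_sum_Suc)
  qed
  have "(\<lambda>n. cesaro_sum x n / (real n * ln (real n))) \<longlonglongrightarrow> c * 1"
  proof (rule stolz_cesaro)
    show "\<forall>\<^sub>F n in sequentially. real n * ln (real n) < real (Suc n) * ln (real (Suc n))"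
      by real_asymp
    show "filterlim (\<lambda>n. real n * ln (real n)) at_top sequentially"
      by real_asymp
    have "(\<lambda>n. ln (real n) / (real (Suc n) * ln (real (Suc n)) - real n * ln (real n))) \<longlonglongrightarrow> 1"
      by real_asymp
    from tendsto_mult[OF T this]
    show "(\<lambda>n. (cesaro_sum x (Suc n) - cesaro_sum x n) / (real (Suc n) * ln (real (Suc n)) - real n * ln (real n))) \<longlonglongrightarrow> c * 1"
      by (rule Lim_transform_eventually, intro eventually_mono[OF eventually_gt_at_top[of 1]]) (simp add: cesaro_sum_Suc)
  qed
  then show ?thesis by simp
qed

text \<open>\<open>I_const\<close> is defined by \<open>lim\<close>, so convergence has to be shown
  before its value means anything.\<close>

lemma I_const_LIMSEQ:
  assumes a: "0 < a" "a < 1"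
  shows "(\<lambda>n. partial_sum (\<lambda>k. real k powr - a) n - real n powr (1 - a) / (1 - a)) \<longlonglongrightarrow> I_const a"
proof -
  \<comment> \<open>The sum-integral comparison is applied to the function shifted by one, as
    \<open>x powr - a\<close> blows up near \<open>0\<close>; the integral over
    \<open>{0..1}\<close> that the shift drops is \<open>1 / (1 - a)\<close>.\<close>
  interpret D: antimono_fun_sum_integral_diff "\<lambda>x. (x + 1) powr - a"
    using a by unfold_locales (auto intro!: powr_mono2' continuous_intros)
  have int0: "integral {0..real n} (\<lambda>x. x powr - a) = real n powr (1 - a) / (1 - a)" for n
    using has_integral_powr_from_0[of "- a" "real n"] a by (simp add: integral_unique)
  have int1: "integral {0..real n} (\<lambda>x. (x + 1) powr - a) = real (Suc n) powr (1 - a) / (1 - a) - 1 / (1 - a)" for n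
  proof (rule integral_unique)
    have "((\<lambda>x. (x + 1) powr - a) has_integral ((real n + 1) powr (1 - a) / (1 - a) - (0 + 1) powr (1 - a) / (1 - a))) {0..real n}"
    proof (rule fundamental_theorem_of_calculus)
      fix x assume "x \<in> {0..real n}"
      then show "((\<lambda>x. (x + 1) powr (1 - a) / (1 - a)) has_vector_derivative (x + 1) powr - a) (at x within {0..real n})"
        using a by (auto intro!: derivative_eq_intros simp flip: has_real_derivative_iff_has_vector_derivative)
    qed simp
    then show "((\<lambda>x. (x + 1) powr - a) has_integral (real (Suc n) powr (1 - a) / (1 - a) - 1 / (1 - a))) {0..real n}"
      by (simp add: add.commute)
  qed
  define d where "d n = partial_sum (\<lambda>k. real k powr - a) n - real n powr (1 - a) / (1 - a)" for n
  have "D.sum_integral_diff_series n = d (Suc n) + 1 / (1 - a)" for n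
  proof -
    have "(\<Sum>k\<le>n. (real k + 1) powr - a) = partial_sum (\<lambda>k. real k powr - a) (Suc n)"
      unfolding partial_sum_def
      by (rule sum.reindex_bij_witness[of _ "\<lambda>k. k - 1" Suc]) (auto simp: add.commute)
    then show ?thesis
      by (simp add: D.sum_integral_diff_series_def int1 d_def)
  qed
  then have "convergent (\<lambda>n. d (Suc n) + 1 / (1 - a))"
    using D.sum_integral_diff_series_convergent by presburger
  then have "convergent d"
    by (simp add: convergent_add_const_right_iff convergent_Suc_iff)
  moreover have "I_const a = lim d"
    by (simp add: I_const_def int0 d_def[abs_def] partial_sum_def)
  ultimately show ?thesis
    by (simp add: convergent_LIMSEQ_iff d_def[abs_def])
qed

text \<open>Second-order refinement of \<open>cesaro_sum_powr\<close>. An increment of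
  \<open>n powr (2 - a) / ((1 - a) * (2 - a))\<close> differs from
  \<open>n powr (1 - a) / (1 - a)\<close> by a term of order \<open>n powr - a\<close>, so the
  constant of the inner sums survives unchanged.\<close>

lemma cesaro_sum_powr_correction:
  assumes a: "0 < a" "a < 1"
  shows "(\<lambda>n. cesaro_sum (\<lambda>k. real k powr - a) n / real n - real n powr (1 - a) / ((1 - a) * (2 - a))) \<longlonglongrightarrow> I_const a"
proof -
  let ?x = "\<lambda>k::nat. real k powr - a"
  have "(\<lambda>n. (cesaro_sum ?x n - real n powr (2 - a) / ((1 - a) * (2 - a))) / real n) \<longlonglongrightarrow> I_const a + 0"
  proof (rule stolz_cesaro)
    have "(\<lambda>n. real n powr (1 - a) / (1 - a) - (real (Suc n) powr (2 - a) - real n powr (2 - a)) / ((1 - a) * (2 - a))) \<longlonglongrightarrow> 0"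
      using a by real_asymp
    from tendsto_add[OF I_const_LIMSEQ[OF a] this]
    show "(\<lambda>n. (cesaro_sum ?x (Suc n) - real (Suc n) powr (2 - a) / ((1 - a) * (2 - a)) -
          (cesaro_sum ?x n - real n powr (2 - a) / ((1 - a) * (2 - a)))) / (real (Suc n) - real n)) \<longlonglongrightarrow> I_const a + 0"
      by (simp add: cesaro_sum_Suc[symmetric] diff_divide_distrib algebra_simps)
  qed (auto intro: filterlim_real_sequentially)
  then have "(\<lambda>n. (cesaro_sum ?x n - real n powr (2 - a) / ((1 - a) * (2 - a))) / real n) \<longlonglongrightarrow> I_const a"
    by simp
  moreover have "\<forall>\<^sub>F n in sequentially. (cesaro_sum ?x n - real n powr (2 - a) / ((1 - a) * (2 - a))) / real n
      = cesaro_sum ?x n / real n - real n powr (1 - a) / ((1 - a) * (2 - a))"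
    using eventually_gt_at_top[of 0]
  proof eventually_elim
    case (elim n)
    have "real n powr (2 - a) = real n powr (1 - a) * real n"
      using elim powr_add[of "real n" "1 - a" 1] by simp
    then show ?case using elim by (simp add: diff_divide_distrib)
  qed
  ultimately show ?thesis
    by (rule Lim_transform_eventually)
qed

text \<open>The leading power yields the limit variance and \<open>I_const\<close>; the summable
  correction \<open>g\<close> and the lag 0 value \<open>r0\<close> yield further constants. The sum
  over \<open>\<rho>\<close> stays on the left because its order depends on the second rank.\<close>

lemma scaled_variance_expansion:
  assumes a: "0 < a" "a < 1"
    and r: "\<And>k. 0 < k \<Longrightarrow> r k = \<kappa> * (real k powr - a + g k) + \<rho> k"
    and g: "summable (\<lambda>k. g (Suc k))"
  shows "(\<lambda>n. real n powr (1 - a) * (real n powr a * ((real n * r0 + 2 * cesaro_sum r n) / (real n)\<^sup>2)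
             - 2 * \<kappa> / ((1 - a) * (2 - a))) - 2 * (cesaro_sum \<rho> n / real n))
       \<longlonglongrightarrow> r0 + 2 * \<kappa> * (I_const a + (\<Sum>k. g (Suc k)))"
proof -
  let ?p = "\<lambda>k::nat. real k powr - a"
  have ces: "cesaro_sum r n = \<kappa> * cesaro_sum ?p n + \<kappa> * cesaro_sum g n + cesaro_sum \<rho> n" for n
  proof -
    have "cesaro_sum r n = cesaro_sum (\<lambda>k. 1 * (\<kappa> * ?p k + \<kappa> * g k) + 1 * \<rho> k) n"
      by (rule cesaro_sum_cong) (simp add: r distrib_left)
    then show ?thesis
      by (simp only: cesaro_sum_linear) simp
  qed
  have "(\<lambda>n. r0 + 2 * \<kappa> * ((cesaro_sum ?p n / real n - real n powr (1 - a) / ((1 - a) * (2 - a))) + cesaro_sum g n / real n))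
      \<longlonglongrightarrow> r0 + 2 * \<kappa> * (I_const a + (\<Sum>k. g (Suc k)))"
    by (intro tendsto_intros cesaro_sum_powr_correction a cesaro_sum_summable g)
  then show ?thesis
  proof (rule Lim_transform_eventually)
    show "\<forall>\<^sub>F n in sequentially. r0 + 2 * \<kappa> * ((cesaro_sum ?p n / real n - real n powr (1 - a) / ((1 - a) * (2 - a))) + cesaro_sum g n / real n)
      = real n powr (1 - a) * (real n powr a * ((real n * r0 + 2 * cesaro_sum r n) / (real n)\<^sup>2)
             - 2 * \<kappa> / ((1 - a) * (2 - a))) - 2 * (cesaro_sum \<rho> n / real n)"
      using eventually_gt_at_top[of 0]
    proof eventually_elim
      case (elim n)
      have p: "real n powr (1 - a) * real n powr a = real n"
        using elim by (simp flip: powr_add)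
      have "real n powr (1 - a) * (real n powr a * ((real n * r0 + 2 * cesaro_sum r n) / (real n)\<^sup>2) - 2 * \<kappa> / ((1 - a) * (2 - a)))
          = (real n powr (1 - a) * real n powr a) * ((real n * r0 + 2 * cesaro_sum r n) / (real n)\<^sup>2) - real n powr (1 - a) * (2 * \<kappa> / ((1 - a) * (2 - a)))"
        by (simp only: right_diff_distrib mult.assoc)
      also have "(real n powr (1 - a) * real n powr a) * ((real n * r0 + 2 * cesaro_sum r n) / (real n)\<^sup>2) = r0 + 2 * (cesaro_sum r n / real n)"
        unfolding p using elim by (simp add: power2_eq_square field_simps)
      finally show ?case
        unfolding ces by (simp add: algebra_simps add_divide_distrib)
    qed
  qed
qed

section \<open>The scale of the second-rank term\<close>

definition rate :: "real \<Rightarrow> real \<Rightarrow> nat \<Rightarrow> real" where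
  "rate a \<beta> n = real n powr a / real n powr min 1 \<beta> * (if \<beta> = 1 then ln (real n) else 1)"

lemma rate_pos: "2 \<le> n \<Longrightarrow> 0 < rate a \<beta> n"
  by (simp add: rate_def)

lemma rate_tendsto_0:
  assumes "a < 1" "a < \<beta>"
  shows "rate a \<beta> \<longlonglongrightarrow> 0"
proof -
  consider "\<beta> = 1" | "\<beta> < 1" | "\<beta> > 1" by linarith
  then show ?thesis
  proof cases
    case 1
    then show ?thesis using assms unfolding rate_def by simp real_asymp
  next
    case 2
    then have "rate a \<beta> = (\<lambda>n. real n powr a / real n powr \<beta>)" by (simp add: rate_def fun_eq_iff)
    then show ?thesis using assms by simp real_asymp
  next
    case 3
    then have "rate a \<beta> = (\<lambda>n. real n powr a / real n)" by (simp add: rate_def fun_eq_iff)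
    then show ?thesis using assms by simp real_asymp
  qed
qed

text \<open>Makes second-order terms at \<open>n\<close> negligible against those at
  \<open>l n\<close>. With \<open>x = n / l n\<close> the powers contribute
  \<open>x powr - p\<close>; as \<open>l n \<ge> 2\<close>, the quotient of the logarithms is at
  most \<open>1 + ln x / ln 2\<close>, which cannot compensate this decay.\<close>

lemma rate_ratio:
  assumes a: "a < 1" "a < \<beta>" and l: "filterlim l at_top sequentially"
    and x: "filterlim (\<lambda>n. real n / real (l n)) at_top sequentially"
  shows "(\<lambda>n. rate a \<beta> n / rate a \<beta> (l n)) \<longlonglongrightarrow> 0"
proof -
  define p where "p = min 1 \<beta> - a"
  have p: "0 < p" using a by (simp add: p_def)
  have "((\<lambda>x. x powr - p * (1 + ln x / ln 2)) \<longlongrightarrow> 0) at_top"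
    using p by real_asymp
  from filterlim_compose[OF this x]
  have lim: "(\<lambda>n. (real n / real (l n)) powr - p * (1 + ln (real n / real (l n)) / ln 2)) \<longlonglongrightarrow> 0" .
  have "\<forall>\<^sub>F n in sequentially. 2 \<le> l n" "\<forall>\<^sub>F n in sequentially. 1 \<le> real n / real (l n)"
    using l x by (auto simp: filterlim_at_top)
  then have "\<forall>\<^sub>F n in sequentially. norm (rate a \<beta> n / rate a \<beta> (l n))
      \<le> (real n / real (l n)) powr - p * (1 + ln (real n / real (l n)) / ln 2)"
  proof eventually_elim
    case (elim n)
    then have ln: "2 \<le> l n" "l n \<le> n" by (simp_all add: le_divide_eq)
    let ?x = "real n / real (l n)"
    have pw: "real n powr a / real n powr min 1 \<beta> / (real (l n) powr a / real (l n) powr min 1 \<beta>) = ?x powr - p"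
      using ln by (simp add: p_def powr_divide powr_diff powr_minus divide_simps)
    have lnx: "0 \<le> ln ?x" "ln 2 \<le> ln (real (l n))" using elim ln by (simp_all add: ln_ge_zero)
    have lnn: "ln (real n) = ln (real (l n)) + ln ?x"
      using ln by (simp add: ln_div)
    have "ln (real n) / ln (real (l n)) = 1 + ln ?x / ln (real (l n))"
      unfolding lnn using ln by (simp add: add_divide_distrib)
    also have "\<dots> \<le> 1 + ln ?x / ln 2"
      using lnx ln by (intro add_left_mono divide_left_mono) auto
    finally have "(if \<beta> = 1 then ln (real n) / ln (real (l n)) else 1) \<le> 1 + ln ?x / ln 2"
      using lnx by simp
    then have "?x powr - p * (if \<beta> = 1 then ln (real n) / ln (real (l n)) else 1) \<le> ?x powr - p * (1 + ln ?x / ln 2)"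
      by (intro mult_left_mono) auto
    moreover have "rate a \<beta> n / rate a \<beta> (l n) = ?x powr - p * (if \<beta> = 1 then ln (real n) / ln (real (l n)) else 1)"
      unfolding rate_def pw[symmetric] by (simp add: mult_ac)
    moreover have "0 \<le> rate a \<beta> n / rate a \<beta> (l n)"
      using rate_pos[of n a \<beta>] rate_pos[of "l n" a \<beta>] ln by simp
    ultimately show ?case by simp
  qed
  then show ?thesis
    by (rule Lim_null_comparison[OF _ lim])
qed

text \<open>\<open>D n\<close> is of order \<open>h n\<close> and hence \<open>o(h (l n))\<close>,
  so only the value of \<open>D\<close> at the block length counts.\<close>

lemma difference_expansion:
  fixes D E h :: "nat \<Rightarrow> real"
  assumes l: "filterlim l at_top sequentially"
    and ratio: "(\<lambda>n. h n / h (l n)) \<longlonglongrightarrow> 0" and h: "\<forall>\<^sub>F n in sequentially. h n \<noteq> 0"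
    and D: "(\<lambda>n. D n / h n) \<longlonglongrightarrow> d" and DE: "(\<lambda>n. (D n - E n) / h n) \<longlonglongrightarrow> b"
  shows "(\<lambda>n. (D (l n) - D n - E (l n)) / h (l n)) \<longlonglongrightarrow> b"
proof -
  have "(\<lambda>n. (D (l n) - E (l n)) / h (l n) - (D n / h n) * (h n / h (l n))) \<longlonglongrightarrow> b - d * 0"
    by (intro tendsto_intros filterlim_compose[OF DE l] D ratio)
  then have "(\<lambda>n. (D (l n) - E (l n)) / h (l n) - (D n / h n) * (h n / h (l n))) \<longlonglongrightarrow> b"
    by simp
  then show ?thesis
    by (rule Lim_transform_eventually) (use h in \<open>eventually_elim, simp add: diff_divide_distrib\<close>)
qed

text \<open>The contribution of the second Hermite rank, \<open>\<beta> = \<alpha> * m2\<close>.\<close>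

lemma rate_cesaro_sum:
  assumes a: "0 < a" "a < 1" and \<beta>: "0 < \<beta>"
    and c: "\<beta> > 1 \<Longrightarrow> summable (\<lambda>k. \<rho> (Suc k))" "\<beta> \<le> 1 \<Longrightarrow> (\<lambda>n. \<rho> n * real n powr \<beta>) \<longlonglongrightarrow> c"
  shows "(\<lambda>n. real n powr (a - 1) * (2 * (cesaro_sum \<rho> n / real n)) / rate a \<beta> n) \<longlonglongrightarrow>
     (if \<beta> > 1 then 2 * (\<Sum>k. \<rho> (Suc k)) else if \<beta> = 1 then 2 * c else 2 * c / ((1 - \<beta>) * (2 - \<beta>)))"
proof -
  consider "\<beta> > 1" | "\<beta> = 1" | "\<beta> < 1" by linarith
  then show ?thesis
  proof cases
    case 1
    have "(\<lambda>n. 2 * (cesaro_sum \<rho> n / real n)) \<longlonglongrightarrow> 2 * (\<Sum>k. \<rho> (Suc k))"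
      by (intro tendsto_intros cesaro_sum_summable c 1)
    moreover have "\<forall>\<^sub>F n in sequentially. 2 * (cesaro_sum \<rho> n / real n) = real n powr (a - 1) * (2 * (cesaro_sum \<rho> n / real n)) / rate a \<beta> n"
      using eventually_gt_at_top[of 0] by eventually_elim (use 1 in \<open>simp add: rate_def powr_diff\<close>)
    ultimately show ?thesis
      using 1 by (auto intro: Lim_transform_eventually)
  next
    case 2
    have "(\<lambda>n. \<rho> n * real n powr \<beta>) = (\<lambda>n. \<rho> n * real n)"
      using 2 by (simp add: fun_eq_iff)
    with c(2) 2 have "(\<lambda>n. \<rho> n * real n) \<longlonglongrightarrow> c" by simp
    then have "(\<lambda>n. 2 * (cesaro_sum \<rho> n / (real n * ln (real n)))) \<longlonglongrightarrow> 2 * c"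
      by (intro tendsto_intros cesaro_sum_ln)
    moreover have "\<forall>\<^sub>F n in sequentially. 2 * (cesaro_sum \<rho> n / (real n * ln (real n)))
        = real n powr (a - 1) * (2 * (cesaro_sum \<rho> n / real n)) / rate a \<beta> n"
      using eventually_gt_at_top[of 1] by eventually_elim (use 2 in \<open>simp add: rate_def powr_diff\<close>)
    ultimately show ?thesis
      using 2 by (auto intro: Lim_transform_eventually)
  next
    case 3
    have "(\<lambda>n. 2 * (cesaro_sum \<rho> n / real n powr (2 - \<beta>))) \<longlonglongrightarrow> 2 * (c / ((1 - \<beta>) * (2 - \<beta>)))"
      using 3 \<beta> by (intro tendsto_intros cesaro_sum_powr c) auto
    moreover have "\<forall>\<^sub>F n in sequentially. 2 * (cesaro_sum \<rho> n / real n powr (2 - \<beta>))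
        = real n powr (a - 1) * (2 * (cesaro_sum \<rho> n / real n)) / rate a \<beta> n"
      using eventually_gt_at_top[of 0]
    proof eventually_elim
      case (elim n)
      have "real n powr (2 - \<beta>) = real n * real n / real n powr \<beta>"
        using elim powr_add[of "real n" 1 1] by (simp add: powr_diff)
      then show ?case
        using elim 3 by (simp add: rate_def powr_diff)
    qed
    ultimately show ?thesis
      using 3 by (auto intro: Lim_transform_eventually)
  qed
qed

text \<open>The limit is \<open>1\<close> for \<open>\<beta> > 1\<close> and \<open>0\<close>
  otherwise: the scale of the \<open>B0\<close> term never has larger order than
  \<open>rate\<close>. Existence is enough to absorb errors that are
  \<open>o(n powr (a - 1))\<close>.\<close>

lemma rate_power_ratio:
  assumes "a < 1" "0 < \<beta>"
  shows "\<exists>d. (\<lambda>n. real n powr (a - 1) / rate a \<beta> n) \<longlonglongrightarrow> d"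
proof -
  consider "\<beta> > 1" | "\<beta> = 1" | "\<beta> < 1" by linarith
  then show ?thesis
  proof cases
    case 1
    have "\<forall>\<^sub>F n in sequentially. 1 = real n powr (a - 1) / rate a \<beta> n"
      using eventually_gt_at_top[of 0] by eventually_elim (use 1 in \<open>simp add: rate_def powr_diff\<close>)
    from Lim_transform_eventually[OF tendsto_const this] show ?thesis by blast
  next
    case 2
    have ev: "\<forall>\<^sub>F n in sequentially. 1 / ln (real n) = real n powr (a - 1) / rate a \<beta> n"
      using eventually_gt_at_top[of 1] by eventually_elim (use 2 in \<open>simp add: rate_def powr_diff\<close>)
    have "(\<lambda>n. 1 / ln (real n)) \<longlonglongrightarrow> 0" by real_asymp
    from Lim_transform_eventually[OF this ev] show ?thesis by blast
  next
    case 3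
    have ev: "\<forall>\<^sub>F n in sequentially. real n powr (\<beta> - 1) = real n powr (a - 1) / rate a \<beta> n"
      using eventually_gt_at_top[of 0] by eventually_elim (use 3 in \<open>simp add: rate_def powr_diff\<close>)
    have "(\<lambda>n. real n powr (\<beta> - 1)) \<longlonglongrightarrow> 0" using 3 by real_asymp
    from Lim_transform_eventually[OF this ev] show ?thesis by blast
  qed
qed

text \<open>The remainder of \<open>D\<close> is \<open>o(n powr (a - 1))\<close> and therefore
  \<open>o(rate a \<beta> n)\<close>, which leaves the contribution of \<open>\<rho>\<close>. The
  second claim supplies the limit that \<open>difference_expansion\<close> asks for.\<close>

lemma rate_expansion:
  fixes D \<rho> :: "nat \<Rightarrow> real"
  assumes a: "0 < a" "a < 1" "a < \<beta>"
    and D: "(\<lambda>n. real n powr (1 - a) * D n - 2 * (cesaro_sum \<rho> n / real n)) \<longlonglongrightarrow> B"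
    and c: "\<beta> > 1 \<Longrightarrow> summable (\<lambda>k. \<rho> (Suc k))" "\<beta> \<le> 1 \<Longrightarrow> (\<lambda>n. \<rho> n * real n powr \<beta>) \<longlonglongrightarrow> c"
  defines "K \<equiv> (if \<beta> > 1 then 2 * (\<Sum>k. \<rho> (Suc k)) else if \<beta> = 1 then 2 * c else 2 * c / ((1 - \<beta>) * (2 - \<beta>)))"
  shows "(\<lambda>n. (D n - B * (real n powr a / real n)) / rate a \<beta> n) \<longlonglongrightarrow> K"
    and "\<exists>d. (\<lambda>n. D n / rate a \<beta> n) \<longlonglongrightarrow> d"
proof -
  obtain d where d: "(\<lambda>n. real n powr (a - 1) / rate a \<beta> n) \<longlonglongrightarrow> d"
    using rate_power_ratio a by fastforce
  let ?U = "\<lambda>n. 2 * (cesaro_sum \<rho> n / real n)"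
  have cs: "(\<lambda>n. real n powr (a - 1) * ?U n / rate a \<beta> n) \<longlonglongrightarrow> K"
    unfolding K_def
  proof (rule rate_cesaro_sum)
    show "0 < \<beta>" using a by simp
  qed (use a c in blast)+
  have "(\<lambda>n. (real n powr (1 - a) * D n - ?U n - B) * (real n powr (a - 1) / rate a \<beta> n)
      + real n powr (a - 1) * ?U n / rate a \<beta> n) \<longlonglongrightarrow> (B - B) * d + K"
    by (intro tendsto_intros D d cs)
  then have "(\<lambda>n. (real n powr (1 - a) * D n - ?U n - B) * (real n powr (a - 1) / rate a \<beta> n)
      + real n powr (a - 1) * ?U n / rate a \<beta> n) \<longlonglongrightarrow> K" by simp
  then show 1: "(\<lambda>n. (D n - B * (real n powr a / real n)) / rate a \<beta> n) \<longlonglongrightarrow> K"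
  proof (rule Lim_transform_eventually)
    show "\<forall>\<^sub>F n in sequentially. (real n powr (1 - a) * D n - ?U n - B) * (real n powr (a - 1) / rate a \<beta> n)
      + real n powr (a - 1) * ?U n / rate a \<beta> n = (D n - B * (real n powr a / real n)) / rate a \<beta> n"
      using eventually_gt_at_top[of 0]
    proof eventually_elim
      case (elim n)
      have p: "real n powr (1 - a) * real n powr (a - 1) = 1"
        using elim by (simp flip: powr_add)
      have q: "real n powr a / real n = real n powr (a - 1)"
        using elim by (simp add: powr_diff)
      have "(real n powr (1 - a) * D n - ?U n - B) * (real n powr (a - 1) / rate a \<beta> n) + real n powr (a - 1) * ?U n / rate a \<beta> n
         = ((real n powr (1 - a) * real n powr (a - 1)) * D n - B * real n powr (a - 1)) / rate a \<beta> n"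
        by (simp only: left_diff_distrib times_divide_eq_right add_divide_distrib[symmetric] diff_divide_distrib[symmetric])
           (simp add: algebra_simps)
      then show ?case unfolding p q by simp
    qed
  qed
  have lim: "(\<lambda>n. (D n - B * (real n powr a / real n)) / rate a \<beta> n + B * (real n powr (a - 1) / rate a \<beta> n)) \<longlonglongrightarrow> K + B * d"
    by (intro tendsto_intros 1 d)
  have ev: "\<forall>\<^sub>F n in sequentially. (D n - B * (real n powr a / real n)) / rate a \<beta> n + B * (real n powr (a - 1) / rate a \<beta> n) = D n / rate a \<beta> n"
    using eventually_gt_at_top[of 0] by eventually_elim (simp add: powr_diff diff_divide_distrib)
  from Lim_transform_eventually[OF lim ev] show "\<exists>d. (\<lambda>n. D n / rate a \<beta> n) \<longlonglongrightarrow> d"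
    by blast
qed


section \<open>Bias expansion\<close>

context weakly_stationary
begin

text \<open>\<open>Q n\<close> behaves like \<open>v * n powr (2 - a)\<close>, so lengths and
  normalisations asymptotic to \<open>n\<close> may be exchanged for \<open>n\<close>.\<close>

lemma Q_ratio_limit:
  fixes k :: "nat \<Rightarrow> nat" and N :: "nat \<Rightarrow> real"
  assumes v: "(\<lambda>n. real n powr a * (Q n / (real n)\<^sup>2)) \<longlonglongrightarrow> v"
    and k: "(\<lambda>n. real (k n) / real n) \<longlonglongrightarrow> 1" and N: "(\<lambda>n. N n / real n) \<longlonglongrightarrow> 1"
  shows "(\<lambda>n. real n powr a * (Q (k n) / (N n)\<^sup>2)) \<longlonglongrightarrow> v"
proof -
  have "\<forall>\<^sub>F n in sequentially. 1 / 2 < real (k n) / real n"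
    using k by (rule order_tendstoD) simp
  then have half: "\<forall>\<^sub>F n in sequentially. real n / 2 < real (k n)"
    using eventually_gt_at_top[of 0] by eventually_elim (simp add: field_simps)
  have kinf: "filterlim k at_top sequentially"
  proof -
    have "filterlim (\<lambda>n. real (k n)) at_top sequentially"
    proof (rule filterlim_at_top_mono)
      show "filterlim (\<lambda>n. real n / 2) at_top sequentially" by real_asymp
      show "\<forall>\<^sub>F n in sequentially. real n / 2 \<le> real (k n)"
        using half by eventually_elim simp
    qed
    then show ?thesis by (simp add: filterlim_sequentially_iff_filterlim_real)
  qed
  have "(\<lambda>n. (real (k n) powr a * (Q (k n) / (real (k n))\<^sup>2)) * (real (k n) / real n) powr (2 - a) / (N n / real n)\<^sup>2)
      \<longlonglongrightarrow> v * 1 powr (2 - a) / 1\<^sup>2"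
    by (intro tendsto_intros filterlim_compose[OF v kinf] k N) auto
  then have "(\<lambda>n. (real (k n) powr a * (Q (k n) / (real (k n))\<^sup>2)) * (real (k n) / real n) powr (2 - a) / (N n / real n)\<^sup>2) \<longlonglongrightarrow> v"
    by simp
  then show ?thesis
  proof (rule Lim_transform_eventually)
    show "\<forall>\<^sub>F n in sequentially. (real (k n) powr a * (Q (k n) / (real (k n))\<^sup>2)) * (real (k n) / real n) powr (2 - a) / (N n / real n)\<^sup>2
       = real n powr a * (Q (k n) / (N n)\<^sup>2)"
      using half eventually_gt_at_top[of 0]
    proof eventually_elim
      case (elim n)
      then have p: "0 < real n" "0 < real (k n)" by simp_all
      have e: "(real (k n) / real n) powr (2 - a) = (real (k n))\<^sup>2 / real (k n) powr a * (real n powr a / (real n)\<^sup>2)"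
        using p by (simp add: powr_divide powr_diff)
      show ?case unfolding e using p by (simp add: field_simps)
    qed
  qed
qed

lemma block_estimator_mean:
  fixes l :: "nat \<Rightarrow> nat"
  assumes r: "\<And>k. 0 \<le> r k" and V: "V = V_OL X a \<or> V = V_NOL X a"
    and v: "(\<lambda>n. real n powr a * (Q n / (real n)\<^sup>2)) \<longlonglongrightarrow> v"
    and l: "\<And>n. 0 < l n" and ln: "(\<lambda>n. real (l n) / real n) \<longlonglongrightarrow> 0"
  shows "\<exists>W. (\<lambda>n. real n powr a * W n) \<longlonglongrightarrow> v \<and>
     (\<forall>\<^sub>F n in sequentially. expectation (V n (l n)) = real (l n) powr a * (Q (l n) / (real (l n))\<^sup>2 - W n))"
proof -
  have "\<forall>\<^sub>F n in sequentially. real (l n) / real n < 1 / 2"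
    using ln by (rule order_tendstoD) simp
  then have small: "\<forall>\<^sub>F n in sequentially. 2 * l n < n"
    using eventually_gt_at_top[of 0]
  proof eventually_elim
    case (elim n)
    then have "2 * real (l n) < real n" by (simp add: field_simps)
    then show ?case by linarith
  qed
  have inv: "(\<lambda>n. 1 / real n) \<longlonglongrightarrow> 0" by real_asymp
  from V show ?thesis
  proof
    assume V: "V = V_NOL X a"
    define k where "k n = n div l n * l n" for n
    have k1: "(\<lambda>n. real (k n) / real n) \<longlonglongrightarrow> 1"
    proof (rule tendsto_sandwich)
      have "(\<lambda>n. 1 - real (l n) / real n) \<longlonglongrightarrow> 1 - 0"
        by (intro tendsto_intros ln)
      then show "(\<lambda>n. 1 - real (l n) / real n) \<longlonglongrightarrow> 1" by simp
      have kn: "k n \<le> n" "n \<le> k n + l n" for n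
      proof -
        have "n = k n + n mod l n" by (simp add: k_def)
        then show "k n \<le> n" "n \<le> k n + l n"
          using mod_less_divisor[OF l, of n n] by linarith+
      qed
      show "\<forall>\<^sub>F n in sequentially. real (k n) / real n \<le> 1"
        using eventually_gt_at_top[of 0] by eventually_elim (simp add: kn(1))
      show "\<forall>\<^sub>F n in sequentially. 1 - real (l n) / real n \<le> real (k n) / real n"
        using eventually_gt_at_top[of 0]
      proof eventually_elim
        case (elim n)
        have "real n \<le> real (k n) + real (l n)" using kn(2)[of n] by linarith
        then have "(real n - real (l n)) / real n \<le> real (k n) / real n"
          by (intro divide_right_mono) auto
        then show ?case using elim by (simp add: diff_divide_distrib)
      qed
    qed simp
    have "\<forall>\<^sub>F n in sequentially. expectation (V n (l n)) = real (l n) powr a * (Q (l n) / (real (l n))\<^sup>2 - Q (k n) / (real (k n))\<^sup>2)"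
      using small by eventually_elim (simp add: V expectation_V_NOL l k_def)
    with Q_ratio_limit[OF v k1 k1] show ?thesis
      by (intro exI[of _ "\<lambda>n. Q (k n) / (real (k n))\<^sup>2"] conjI)
  next
    assume V: "V = V_OL X a"
    \<comment> \<open>\<open>expectation_V_OL\<close> supplies its \<open>W\<close> separately for
      each large \<open>n\<close>; solving the identity for it defines one sequence.\<close>
    define W where "W n = Q (l n) / (real (l n))\<^sup>2 - expectation (V n (l n)) / real (l n) powr a" for n
    let ?N = "\<lambda>n. real (n - l n + 1)"
    have W: "\<forall>\<^sub>F n in sequentially. expectation (V n (l n)) = real (l n) powr a * (Q (l n) / (real (l n))\<^sup>2 - W n)"
      using l by (simp add: W_def)
    have WQ: "\<forall>\<^sub>F n in sequentially. Q (n + 2 - 2 * l n) / (?N n)\<^sup>2 \<le> W n \<and> W n \<le> Q n / (?N n)\<^sup>2"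
      using small
    proof eventually_elim
      case (elim n)
      then have "l n \<le> n" by simp
      from expectation_V_OL[OF r l this, of a] obtain w
        where w: "expectation (V_OL X a n (l n)) = real (l n) powr a * (Q (l n) / (real (l n))\<^sup>2 - w)"
          "Q (n + 2 - 2 * l n) \<le> (?N n)\<^sup>2 * w" "(?N n)\<^sup>2 * w \<le> Q n" by blast
      have "W n = w" using l[of n] by (simp add: W_def V w(1))
      then show ?case using w by (simp add: field_simps)
    qed
    have N1: "(\<lambda>n. ?N n / real n) \<longlonglongrightarrow> 1"
    proof (rule Lim_transform_eventually)
      have "(\<lambda>n. 1 - real (l n) / real n + 1 / real n) \<longlonglongrightarrow> 1 - 0 + 0"
        by (intro tendsto_intros ln inv)
      then show "(\<lambda>n. 1 - real (l n) / real n + 1 / real n) \<longlonglongrightarrow> 1" by simp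
      show "\<forall>\<^sub>F n in sequentially. 1 - real (l n) / real n + 1 / real n = ?N n / real n"
        using small by eventually_elim (simp add: field_simps)
    qed
    have k1: "(\<lambda>n. real (n + 2 - 2 * l n) / real n) \<longlonglongrightarrow> 1"
    proof (rule Lim_transform_eventually)
      have "(\<lambda>n. 1 - 2 * (real (l n) / real n) + 2 * (1 / real n)) \<longlonglongrightarrow> 1 - 2 * 0 + 2 * 0"
        by (intro tendsto_intros ln inv)
      then show "(\<lambda>n. 1 - 2 * (real (l n) / real n) + 2 * (1 / real n)) \<longlonglongrightarrow> 1" by simp
      show "\<forall>\<^sub>F n in sequentially. 1 - 2 * (real (l n) / real n) + 2 * (1 / real n) = real (n + 2 - 2 * l n) / real n"
        using small by eventually_elim (simp add: field_simps)
    qed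
    have n1: "(\<lambda>n. real n / real n) \<longlonglongrightarrow> 1" by real_asymp
    have "(\<lambda>n. real n powr a * W n) \<longlonglongrightarrow> v"
    proof (rule tendsto_sandwich[OF _ _ Q_ratio_limit[OF v k1 N1] Q_ratio_limit[OF v n1 N1]])
      show "\<forall>\<^sub>F n in sequentially. real n powr a * (Q (n + 2 - 2 * l n) / (?N n)\<^sup>2) \<le> real n powr a * W n"
        using WQ by eventually_elim (simp only: mult_left_mono powr_ge_zero)
      show "\<forall>\<^sub>F n in sequentially. real n powr a * W n \<le> real n powr a * (Q n / (?N n)\<^sup>2)"
        using WQ by eventually_elim (simp only: mult_left_mono powr_ge_zero)
    qed
    with W show ?thesis by blast
  qed
qed

end

lemma slowly_varying_remainder:
  assumes L: "slowly_varying L" and a: "0 < a" "a < 1" and \<tau>: "1 - a < \<tau>"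
  shows "(\<lambda>k. L (real k) * real k powr - \<tau>) \<longlonglongrightarrow> 0"
    and "summable (\<lambda>k. real (Suc k) powr - a * (\<Sum>j=1..m. real (m choose j) * (L (real (Suc k)) * real (Suc k) powr - \<tau>) ^ j))"
proof -
  \<comment> \<open>Half of the slack in \<open>1 - a < \<tau>\<close>: the exponent
    \<open>\<delta> - \<tau> - a\<close> then equals \<open>- 1 - \<delta>\<close>, which makes the
    correction summable.\<close>
  define \<delta> where "\<delta> = (a + \<tau> - 1) / 2"
  have \<delta>: "0 < \<delta>" using \<tau> by (simp add: \<delta>_def)
  define x where "x k = L (real k) * real k powr - \<tau>" for k :: nat
  have pos: "0 < x k" if "0 < k" for k
    using L that by (simp add: x_def slowly_varying_def)
  obtain C where "\<forall>\<^sub>F y in at_top. L y \<le> C * y powr \<delta>"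
    using slowly_varying_bound[OF L \<delta>] by blast
  then have "\<forall>\<^sub>F k in sequentially. L (real k) \<le> C * real k powr \<delta>"
    by (rule eventually_compose_filterlim[OF _ filterlim_real_sequentially])
  then have xle: "\<forall>\<^sub>F k in sequentially. x k \<le> C * real k powr (\<delta> - \<tau>)"
  proof eventually_elim
    case (elim k)
    then have "x k \<le> C * real k powr \<delta> * real k powr - \<tau>"
      unfolding x_def by (intro mult_right_mono) auto
    also have "\<dots> = C * real k powr (\<delta> - \<tau>)"
      by (simp add: mult.assoc flip: powr_add)
    finally show ?case .
  qed
  have "\<delta> - \<tau> < 0" using a \<tau> by (simp add: \<delta>_def)
  then have "(\<lambda>k. C * real k powr (\<delta> - \<tau>)) \<longlonglongrightarrow> C * 0"
    by (intro tendsto_intros) real_asymp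
  then have C0: "(\<lambda>k. C * real k powr (\<delta> - \<tau>)) \<longlonglongrightarrow> 0" by simp
  have "\<forall>\<^sub>F k in sequentially. 0 \<le> x k"
    using eventually_gt_at_top[of 0] by eventually_elim (simp add: pos less_imp_le)
  then have x0: "x \<longlonglongrightarrow> 0"
    by (rule tendsto_sandwich[OF _ xle tendsto_const C0])
  then show "(\<lambda>k. L (real k) * real k powr - \<tau>) \<longlonglongrightarrow> 0"
    by (simp add: x_def[abs_def])
  define K where "K = (\<Sum>j=1..m. real (m choose j))"
  \<comment> \<open>Once \<open>x k < 1\<close>, all powers with \<open>j \<ge> 1\<close> are at
    most \<open>x k\<close>, so the first power decides.\<close>
  have "\<forall>\<^sub>F k in sequentially. x k < 1"
    using x0 by (rule order_tendstoD) simp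
  then have "\<forall>\<^sub>F k in sequentially. norm (real k powr - a * (\<Sum>j=1..m. real (m choose j) * x k ^ j)) \<le> K * C * real k powr (\<delta> - \<tau> - a)"
    using xle eventually_gt_at_top[of 0]
  proof eventually_elim
    case (elim k)
    have "(\<Sum>j=1..m. real (m choose j) * x k ^ j) \<le> (\<Sum>j=1..m. real (m choose j) * x k)"
    proof (intro sum_mono mult_left_mono)
      fix j assume "j \<in> {1..m}"
      then show "x k ^ j \<le> x k"
        using power_decreasing[of 1 j "x k"] elim pos[of k] by simp
    qed simp
    also have "\<dots> = K * x k" by (simp add: K_def sum_distrib_right)
    also have "\<dots> \<le> K * (C * real k powr (\<delta> - \<tau>))"
      using elim by (intro mult_left_mono) (auto simp: K_def intro: sum_nonneg)
    finally have "real k powr - a * (\<Sum>j=1..m. real (m choose j) * x k ^ j) \<le> real k powr - a * (K * (C * real k powr (\<delta> - \<tau>)))"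
      by (intro mult_left_mono) auto
    also have "\<dots> = K * C * (real k powr (\<delta> - \<tau>) * real k powr - a)"
      by (simp add: mult_ac)
    also have "real k powr (\<delta> - \<tau>) * real k powr - a = real k powr (\<delta> - \<tau> - a)"
      by (simp flip: powr_add)
    finally show ?case
      using pos[of k] elim by (simp add: sum_nonneg)
  qed
  moreover have "summable (\<lambda>k. K * C * real k powr (\<delta> - \<tau> - a))"
  proof (intro summable_mult)
    have "\<delta> - \<tau> - a < - 1" using \<tau> by (simp add: \<delta>_def field_simps)
    then show "summable (\<lambda>k. real k powr (\<delta> - \<tau> - a))"
      by (simp add: summable_real_powr_iff)
  qed
  ultimately have "summable (\<lambda>k. real k powr - a * (\<Sum>j=1..m. real (m choose j) * x k ^ j))"
    by (rule summable_comparison_test_ev)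
  then show "summable (\<lambda>k. real (Suc k) powr - a * (\<Sum>j=1..m. real (m choose j) * (L (real (Suc k)) * real (Suc k) powr - \<tau>) ^ j))"
    unfolding x_def by (subst (asm) summable_Suc_iff[symmetric])
qed

section \<open>Ranks and the subordinated sequence\<close>

lemma Inf_enat_eqD:
  assumes "Inf {enat j | j. P j} = enat m"
  shows "P m" and "j < m \<Longrightarrow> \<not> P j"
proof -
  have ne: "{enat j | j. P j} \<noteq> {}"
    using assms by (auto simp: Inf_enat_def split: if_splits)
  then have "Inf {enat j | j. P j} \<in> {enat j | j. P j}"
    unfolding Inf_enat_def by (auto intro: LeastI)
  then show "P m" unfolding assms by auto
  show "\<not> P j" if "j < m"
  proof
    assume "P j"
    then have "Inf {enat j | j. P j} \<le> enat j" by (intro Inf_lower) auto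
    then show False using that unfolding assms by simp
  qed
qed

lemma Inf_enat_eq_infinityD:
  assumes "Inf {enat j | j. P j} = \<infinity>"
  shows "\<not> P j"
proof
  assume "P j"
  then have "Inf {enat j | j. P j} \<le> enat j" by (intro Inf_lower) auto
  then show False unfolding assms by simp
qed

text \<open>The term \<open>k = 0\<close> of Mehler's series is the squared mean, which the
  covariance removes.\<close>

lemma (in standard_gaussian_sequence) weakly_stationary_subordinated:
  fixes G :: "real \<Rightarrow> real"
  assumes [measurable]: "G \<in> borel_measurable borel" and G2: "integrable M (\<lambda>\<omega>. (G (Z 0 \<omega>))\<^sup>2)"
  defines "J \<equiv> hermite_coeff M Z G"
  shows "weakly_stationary M (\<lambda>t \<omega>. G (Z t \<omega>)) (J 0)
           (\<lambda>d. (\<Sum>k. (J k)\<^sup>2 / fact k * autocov M Z d ^ k) - (J 0)\<^sup>2)"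
proof unfold_locales
  note GG = assms(1) G2
  fix s t
  show "(\<lambda>\<omega>. G (Z t \<omega>)) \<in> borel_measurable M" by measurable
  show int: "integrable M (\<lambda>\<omega>. G (Z t \<omega>))" for t by (rule GZ_integrable[OF GG])
  show mean: "expectation (\<lambda>\<omega>. G (Z t \<omega>)) = J 0" for t unfolding J_def by (rule GZ_mean[OF GG])
  have prod: "integrable M (\<lambda>\<omega>. G (Z s \<omega>) * G (Z t \<omega>))"
    by (intro integrable_mult_L2 GZ_sq_integrable[OF GG]) measurable
  have eq: "(G (Z s \<omega>) - J 0) * (G (Z t \<omega>) - J 0)
      = G (Z s \<omega>) * G (Z t \<omega>) - J 0 * G (Z s \<omega>) - J 0 * G (Z t \<omega>) + (J 0)\<^sup>2" for \<omega>
    by (simp add: power2_eq_square algebra_simps)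
  show "integrable M (\<lambda>\<omega>. (G (Z s \<omega>) - J 0) * (G (Z t \<omega>) - J 0))"
    unfolding eq using prod int by simp
  have "expectation (\<lambda>\<omega>. (G (Z s \<omega>) - J 0) * (G (Z t \<omega>) - J 0))
      = expectation (\<lambda>\<omega>. G (Z s \<omega>) * G (Z t \<omega>)) - (J 0)\<^sup>2"
    unfolding eq using prod int by (simp add: mean prob_space power2_eq_square)
  also have "expectation (\<lambda>\<omega>. G (Z s \<omega>) * G (Z t \<omega>)) = (\<Sum>k. (J k)\<^sup>2 / fact k * autocov M Z (nat \<bar>int s - int t\<bar>) ^ k)"
    using GZ_prod_sums[OF GG, of s t] by (simp add: J_def sums_iff)
  finally show "expectation (\<lambda>\<omega>. (G (Z s \<omega>) - J 0) * (G (Z t \<omega>) - J 0))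
     = (\<Sum>k. (J k)\<^sup>2 / fact k * autocov M Z (nat \<bar>int s - int t\<bar>) ^ k) - (J 0)\<^sup>2" .
qed

section \<open>Tails of the Hermite expansion of the covariance\<close>

lemma suminf_swap_nonneg:
  fixes f :: "nat \<Rightarrow> nat \<Rightarrow> real"
  assumes nonneg: "\<And>j d. 0 \<le> f j d" and row: "\<And>j. summable (f j)" and col: "\<And>d. summable (\<lambda>j. f j d)"
    and total: "summable (\<lambda>j. \<Sum>d. f j d)"
  shows "(\<Sum>j. \<Sum>d. f j d) = (\<Sum>d. \<Sum>j. f j d)"
proof -
  have int: "integrable (count_space UNIV) (f j)" for j
    using row nonneg by (simp add: integrable_count_space_nat_iff)
  have E: "(\<integral>d. f j d \<partial>count_space UNIV) = (\<Sum>d. f j d)" for j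
    by (rule integral_count_space_nat[OF int])
  have "integrable (count_space UNIV) (\<lambda>d. \<Sum>j. f j d)"
    using total col nonneg by (intro integrable_suminf int) (simp_all add: E AE_count_space)
  then have "(\<integral>d. (\<Sum>j. f j d) \<partial>count_space UNIV) = (\<Sum>d. \<Sum>j. f j d)"
    by (rule integral_count_space_nat)
  moreover have "(\<integral>d. (\<Sum>j. f j d) \<partial>count_space UNIV) = (\<Sum>j. \<integral>d. f j d \<partial>count_space UNIV)"
    using total col nonneg by (intro integral_suminf int) (simp_all add: E AE_count_space)
  ultimately show ?thesis by (simp add: E)
qed

text \<open>The part of the covariance of \<open>G (Z 0)\<close> and \<open>G (Z d)\<close> due to the Hermite coefficients of
  order at least \<open>k\<close>, where \<open>q j = (J j)\<^sup>2 / fact j\<close>.\<close>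

locale hermite_tail =
  fixes q \<gamma> x :: "nat \<Rightarrow> real" and \<alpha> C0 :: real and k :: nat
  assumes q_nonneg: "\<And>j. 0 \<le> q j" and q_summable: "summable q"
    and \<alpha>: "0 < \<alpha>" and C0: "0 < C0" and k: "0 < k"
    and \<gamma>: "\<And>d. 0 < d \<Longrightarrow> \<gamma> d = C0 * real d powr - \<alpha> * (1 + x d)"
    and \<gamma>_pos: "\<And>d. 0 < d \<Longrightarrow> 0 < \<gamma> d" and \<gamma>_le: "\<And>d. \<gamma> d \<le> 1"
    and x: "x \<longlonglongrightarrow> 0"
begin

definition tail :: "nat \<Rightarrow> real" where "tail d = (\<Sum>j. q (j + k) * \<gamma> d ^ (j + k))"

text \<open>The shifts \<open>i\<close> and \<open>p\<close> are independent because the series also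
  occurs after a power of \<open>\<gamma> d\<close> has been factored out.\<close>

lemma summable_powers: "0 < d \<Longrightarrow> summable (\<lambda>j. q (j + i) * \<gamma> d ^ (j + p))"
proof -
  assume d: "0 < d"
  have le: "norm (q (j + i) * \<gamma> d ^ (j + p)) \<le> q (j + i)" for j
  proof -
    have "norm (q (j + i) * \<gamma> d ^ (j + p)) = q (j + i) * \<gamma> d ^ (j + p)"
      using q_nonneg[of "j + i"] \<gamma>_pos[OF d] by simp
    also have "\<dots> \<le> q (j + i)"
      using q_nonneg[of "j + i"] \<gamma>_pos[OF d] \<gamma>_le[of d] by (intro mult_left_le power_le_one) simp_all
    finally show ?thesis .
  qed
  have "summable (\<lambda>j. q (j + i))" using q_summable by (simp add: summable_iff_shift)
  then show ?thesis by (rule summable_comparison_test'[OF _ le])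
qed

lemma tail_nonneg: "0 < d \<Longrightarrow> 0 \<le> tail d"
  unfolding tail_def using q_nonneg \<gamma>_pos[of d]
  by (intro suminf_nonneg summable_powers) (auto simp: less_imp_le)

lemma tail_pos: "0 < d \<Longrightarrow> q k \<noteq> 0 \<Longrightarrow> 0 < tail d"
proof -
  assume d: "0 < d" and "q k \<noteq> 0"
  then have "0 < q k" using q_nonneg[of k] by simp
  then show ?thesis
    unfolding tail_def using q_nonneg \<gamma>_pos[OF d] d
    by (intro suminf_pos2[where i = 0] summable_powers) (auto simp: less_imp_le)
qed

lemma \<gamma>_powr: "(\<lambda>d. \<gamma> d * real d powr \<alpha>) \<longlonglongrightarrow> C0"
proof (rule Lim_transform_eventually)
  have "(\<lambda>d. C0 * (1 + x d)) \<longlonglongrightarrow> C0 * (1 + 0)" by (intro tendsto_intros x)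
  then show "(\<lambda>d. C0 * (1 + x d)) \<longlonglongrightarrow> C0" by simp
  show "\<forall>\<^sub>F d in sequentially. C0 * (1 + x d) = \<gamma> d * real d powr \<alpha>"
    using eventually_gt_at_top[of 0] by eventually_elim (simp add: \<gamma> powr_minus field_simps)
qed

lemma \<gamma>_tendsto_0: "\<gamma> \<longlonglongrightarrow> 0"
proof (rule Lim_transform_eventually)
  have "(\<lambda>d. real d powr - \<alpha>) \<longlonglongrightarrow> 0" using \<alpha> by real_asymp
  from tendsto_mult[OF \<gamma>_powr this]
  show "(\<lambda>d. \<gamma> d * real d powr \<alpha> * real d powr - \<alpha>) \<longlonglongrightarrow> 0" by simp
  show "\<forall>\<^sub>F d in sequentially. \<gamma> d * real d powr \<alpha> * real d powr - \<alpha> = \<gamma> d"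
    using eventually_gt_at_top[of 0] by eventually_elim (simp add: powr_minus)
qed

text \<open>With \<open>\<gamma> d ^ k\<close> taken out, the rest is a power series in
  \<open>\<gamma> d\<close>, which tends to \<open>0\<close>; only the constant term
  \<open>q k\<close> survives.\<close>

lemma tail_powr: "(\<lambda>d. tail d * real d powr (\<alpha> * real k)) \<longlonglongrightarrow> C0 ^ k * q k"
proof (rule Lim_transform_eventually)
  have S: "(\<lambda>d. \<Sum>j. q (j + k) * \<gamma> d ^ j) \<longlonglongrightarrow> q k"
  proof -
    have "(\<lambda>d. \<gamma> d * (\<Sum>j. q (j + Suc k))) \<longlonglongrightarrow> 0 * (\<Sum>j. q (j + Suc k))"
      by (intro tendsto_intros \<gamma>_tendsto_0)
    then have lim: "(\<lambda>d. \<gamma> d * (\<Sum>j. q (j + Suc k))) \<longlonglongrightarrow> 0" by simp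
    have "\<forall>\<^sub>F d in sequentially. norm ((\<Sum>j. q (j + k) * \<gamma> d ^ j) - q k) \<le> \<gamma> d * (\<Sum>j. q (j + Suc k))"
      using eventually_gt_at_top[of 0]
    proof eventually_elim
      case (elim d)
      note pos = \<gamma>_pos[OF elim]
      have "(\<Sum>j. q (j + k) * \<gamma> d ^ j) = q k + (\<Sum>j. q (Suc j + k) * \<gamma> d ^ Suc j)"
        using suminf_split_head[of "\<lambda>j. q (j + k) * \<gamma> d ^ j"] summable_powers[OF elim, of k 0] by simp
      also have "(\<Sum>j. q (Suc j + k) * \<gamma> d ^ Suc j) = \<gamma> d * (\<Sum>j. q (j + Suc k) * \<gamma> d ^ j)"
        using suminf_mult[OF summable_powers[OF elim, of "Suc k" 0], of "\<gamma> d"] by (simp add: mult_ac)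
      finally have "(\<Sum>j. q (j + k) * \<gamma> d ^ j) - q k = \<gamma> d * (\<Sum>j. q (j + Suc k) * \<gamma> d ^ j)" by simp
      moreover have "0 \<le> (\<Sum>j. q (j + Suc k) * \<gamma> d ^ j)"
        using summable_powers[OF elim, of "Suc k" 0] q_nonneg pos by (intro suminf_nonneg) auto
      moreover have "(\<Sum>j. q (j + Suc k) * \<gamma> d ^ j) \<le> (\<Sum>j. q (j + Suc k))"
      proof (rule suminf_le)
        show "summable (\<lambda>j. q (j + Suc k))" using q_summable by (simp only: summable_iff_shift)
        show "q (j + Suc k) * \<gamma> d ^ j \<le> q (j + Suc k)" for j
          using q_nonneg[of "j + Suc k"] pos \<gamma>_le[of d] by (intro mult_left_le power_le_one) auto
      qed (use summable_powers[OF elim, of "Suc k" 0] in simp)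
      ultimately show ?case using pos by (simp add: abs_mult mult_left_mono)
    qed
    from Lim_null_comparison[OF this lim] show ?thesis by (simp add: LIM_zero_iff)
  qed
  have "(\<lambda>d. (\<gamma> d * real d powr \<alpha>) ^ k * (\<Sum>j. q (j + k) * \<gamma> d ^ j)) \<longlonglongrightarrow> C0 ^ k * q k"
    by (intro tendsto_intros \<gamma>_powr S)
  then show "(\<lambda>d. (\<gamma> d * real d powr \<alpha>) ^ k * (\<Sum>j. q (j + k) * \<gamma> d ^ j)) \<longlonglongrightarrow> C0 ^ k * q k" .
  show "\<forall>\<^sub>F d in sequentially. (\<gamma> d * real d powr \<alpha>) ^ k * (\<Sum>j. q (j + k) * \<gamma> d ^ j) = tail d * real d powr (\<alpha> * real k)"
    using eventually_gt_at_top[of 0]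
  proof eventually_elim
    case (elim d)
    have "tail d = \<gamma> d ^ k * (\<Sum>j. q (j + k) * \<gamma> d ^ j)"
      unfolding tail_def
      using suminf_mult[OF summable_powers[OF elim, of k 0], of "\<gamma> d ^ k"] by (simp add: power_add mult_ac)
    moreover have "(real d powr \<alpha>) ^ k = real d powr (\<alpha> * real k)"
      using elim by (simp add: powr_power mult.commute)
    ultimately show ?case by (simp add: power_mult_distrib mult_ac)
  qed
qed

lemma summable_dominated:
  assumes "1 < \<alpha> * real k"
  shows "summable (\<lambda>d. tail (Suc d))" and "summable (\<lambda>d. \<gamma> (Suc d) ^ k)"
proof -
  have *: "summable (\<lambda>d. y (Suc d))" if y: "(\<lambda>d. y d * real d powr (\<alpha> * real k)) \<longlonglongrightarrow> c" for y c
  proof -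
    obtain K where K: "\<And>d. norm (y d * real d powr (\<alpha> * real k)) \<le> K"
      using BseqE[OF convergent_imp_Bseq[OF convergentI[OF y]]] by blast
    have "\<forall>\<^sub>F d in sequentially. norm (y d) \<le> K * real d powr - (\<alpha> * real k)"
      using eventually_gt_at_top[of 0]
    proof eventually_elim
      case (elim d)
      then show ?case using K[of d] by (simp add: powr_minus field_simps abs_mult)
    qed
    moreover have "summable (\<lambda>d. K * real d powr - (\<alpha> * real k))"
      using assms by (intro summable_mult) (simp add: summable_real_powr_iff)
    ultimately have "summable y" by (rule summable_comparison_test_ev)
    then show ?thesis by (simp only: summable_Suc_iff)
  qed
  show "summable (\<lambda>d. tail (Suc d))" by (rule *[OF tail_powr])
  have "(\<lambda>d. (\<gamma> d * real d powr \<alpha>) ^ k) \<longlonglongrightarrow> C0 ^ k"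
    by (intro tendsto_intros \<gamma>_powr)
  then have "(\<lambda>d. \<gamma> d ^ k * real d powr (\<alpha> * real k)) \<longlonglongrightarrow> C0 ^ k"
  proof (rule Lim_transform_eventually)
    show "\<forall>\<^sub>F d in sequentially. (\<gamma> d * real d powr \<alpha>) ^ k = \<gamma> d ^ k * real d powr (\<alpha> * real k)"
      using eventually_gt_at_top[of 0] by eventually_elim (simp add: power_mult_distrib powr_power mult.commute)
  qed
  then show "summable (\<lambda>d. \<gamma> (Suc d) ^ k)" by (rule *)
qed

text \<open>\<open>B1\<close> sums over the lags inside, the variance expansion sums over them
  outside. All terms are nonnegative, and \<open>\<gamma> (Suc d) ^ k\<close> dominates the higher
  powers, so the order may be exchanged.\<close>

lemma suminf_tail:
  assumes "1 < \<alpha> * real k"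
  shows "(\<Sum>j. q (j + k) * (\<Sum>d. \<gamma> (Suc d) ^ (j + k))) = (\<Sum>d. tail (Suc d))"
proof -
  note sk = summable_dominated(2)[OF assms]
  have le: "0 \<le> \<gamma> (Suc d) ^ (j + k) \<and> \<gamma> (Suc d) ^ (j + k) \<le> \<gamma> (Suc d) ^ k" for j d
    using \<gamma>_pos[of "Suc d"] \<gamma>_le[of "Suc d"] by (auto intro: power_decreasing)
  have sj: "summable (\<lambda>d. \<gamma> (Suc d) ^ (j + k))" for j
    using le by (intro summable_comparison_test'[OF sk, of 0]) simp
  have le': "(\<Sum>d. \<gamma> (Suc d) ^ (j + k)) \<le> (\<Sum>d. \<gamma> (Suc d) ^ k)" for j
    using le by (intro suminf_le sj sk) auto
  have nn: "0 \<le> (\<Sum>d. \<gamma> (Suc d) ^ (j + k))" for j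
    using le by (intro suminf_nonneg sj) auto
  have "(\<Sum>j. \<Sum>d. q (j + k) * \<gamma> (Suc d) ^ (j + k)) = (\<Sum>d. \<Sum>j. q (j + k) * \<gamma> (Suc d) ^ (j + k))"
  proof (rule suminf_swap_nonneg)
    show "0 \<le> q (j + k) * \<gamma> (Suc d) ^ (j + k)" for j d using le q_nonneg by simp
    show "summable (\<lambda>d. q (j + k) * \<gamma> (Suc d) ^ (j + k))" for j by (intro summable_mult sj)
    show "summable (\<lambda>j. q (j + k) * \<gamma> (Suc d) ^ (j + k))" for d by (rule summable_powers) simp
    have "summable (\<lambda>j. q (j + k) * (\<Sum>d. \<gamma> (Suc d) ^ k))"
      using q_summable by (intro summable_mult2) (simp add: summable_iff_shift)
    then have "summable (\<lambda>j. q (j + k) * (\<Sum>d. \<gamma> (Suc d) ^ (j + k)))"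
      by (rule summable_comparison_test'[of _ 0]) (use q_nonneg nn le' in \<open>simp add: mult_left_mono\<close>)
    then show "summable (\<lambda>j. \<Sum>d. q (j + k) * \<gamma> (Suc d) ^ (j + k))"
      by (simp add: suminf_mult sj)
  qed
  then show ?thesis
    by (simp add: suminf_mult sj tail_def)
qed

end

text \<open>The limit \<open>v\<close> cancels between block and full sample. \<open>\<eta>\<close>
  collects the second-rank term together with all second-order errors, measured on the scale
  \<open>rate\<close>; \<open>\<epsilon>\<close> is the relative error of the variance of the
  overall mean.\<close>

lemma (in weakly_stationary) block_estimator_expansion:
  fixes l :: "nat \<Rightarrow> nat"
  assumes a: "0 < a" "a < 1" "a < \<beta>" and \<kappa>: "0 < \<kappa>"
    and r: "\<And>d. 0 \<le> r d"
    and r_eq: "\<And>d. 0 < d \<Longrightarrow> r d = \<kappa> * (real d powr - a + g d) + \<rho> d"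
    and g: "summable (\<lambda>d. g (Suc d))"
    and c: "\<beta> > 1 \<Longrightarrow> summable (\<lambda>d. \<rho> (Suc d))" "\<beta> \<le> 1 \<Longrightarrow> (\<lambda>d. \<rho> d * real d powr \<beta>) \<longlonglongrightarrow> c"
    and V: "V = V_OL X a \<or> V = V_NOL X a"
    and l_pos: "\<And>n. 0 < l n" and l_lim: "(\<lambda>n. 1 / real (l n) + real (l n) / real n) \<longlonglongrightarrow> 0"
  defines "v \<equiv> 2 * \<kappa> / ((1 - a) * (2 - a))"
    and "B \<equiv> r 0 + 2 * \<kappa> * (I_const a + (\<Sum>d. g (Suc d)))"
  shows "\<exists>\<eta> \<epsilon>. \<eta> \<longlonglongrightarrow> (if \<beta> > 1 then 2 * (\<Sum>d. \<rho> (Suc d)) else if \<beta> = 1 then 2 * c else 2 * c / ((1 - \<beta>) * (2 - \<beta>)))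
     \<and> \<epsilon> \<longlonglongrightarrow> 0 \<and> (\<forall>\<^sub>F n in sequentially. expectation (V n (l n)) - target_var M X a n =
        B * (real (l n) powr a / real (l n)) + \<eta> n * rate a \<beta> (l n) - v * (real (l n) / real n) powr a * (1 + \<epsilon> n))"
proof -
  define D where "D n = real n powr a * (Q n / (real n)\<^sup>2) - v" for n
  have v: "0 < v" using a \<kappa> by (simp add: v_def)
  have lim1: "(\<lambda>n. 1 / real (l n)) \<longlonglongrightarrow> 0" and lim2: "(\<lambda>n. real (l n) / real n) \<longlonglongrightarrow> 0"
    by (rule tendsto_sandwich[OF _ _ tendsto_const l_lim]; simp)+
  have "filterlim (\<lambda>n. inverse (1 / real (l n))) at_top sequentially"
    by (rule filterlim_inverse_at_top[OF lim1]) (simp add: l_pos)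
  then have l_inf: "filterlim l at_top sequentially"
    by (simp add: filterlim_sequentially_iff_filterlim_real)
  have "\<forall>\<^sub>F n in sequentially. 0 < real (l n) / real n"
    using eventually_gt_at_top[of 0] by eventually_elim (simp add: l_pos)
  then have "filterlim (\<lambda>n. inverse (real (l n) / real n)) at_top sequentially"
    by (rule filterlim_inverse_at_top[OF lim2])
  then have x_inf: "filterlim (\<lambda>n. real n / real (l n)) at_top sequentially"
    by simp
  have Q: "Q n = real n * r 0 + 2 * cesaro_sum r n" for n
    by (simp add: Q_eq cesaro_sum_def partial_sum_def)
  have "(\<lambda>n. real n powr (1 - a) * D n - 2 * (cesaro_sum \<rho> n / real n)) \<longlonglongrightarrow> B"
    unfolding D_def Q v_def B_def by (rule scaled_variance_expansion[OF a(1,2) r_eq g])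
  note ex = rate_expansion[OF a this c]
  obtain d where d: "(\<lambda>n. D n / rate a \<beta> n) \<longlonglongrightarrow> d"
    using ex(2) by blast
  have rate_nz: "\<forall>\<^sub>F n in sequentially. rate a \<beta> n \<noteq> 0"
    using eventually_ge_at_top[of 2] by eventually_elim (rule less_imp_neq[OF rate_pos, symmetric])
  \<comment> \<open>Defined as the exact remainder, so that the expansion becomes an identity and
    only the limit of \<open>\<eta>\<close> has to be proved.\<close>
  define \<eta> where "\<eta> n = (D (l n) - D n - B * (real (l n) powr a / real (l n))) / rate a \<beta> (l n)" for n
  have \<eta>: "\<eta> \<longlonglongrightarrow> (if \<beta> > 1 then 2 * (\<Sum>d. \<rho> (Suc d)) else if \<beta> = 1 then 2 * c else 2 * c / ((1 - \<beta>) * (2 - \<beta>)))"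
    unfolding \<eta>_def[abs_def]
    by (rule difference_expansion[OF l_inf rate_ratio[OF a(2,3) l_inf x_inf] rate_nz d ex(1)])
  have "(\<lambda>n. D n / rate a \<beta> n * rate a \<beta> n) \<longlonglongrightarrow> d * 0"
    by (intro tendsto_intros d rate_tendsto_0 a)
  moreover have "\<forall>\<^sub>F n in sequentially. D n / rate a \<beta> n * rate a \<beta> n = D n"
    using rate_nz by eventually_elim simp
  ultimately have "D \<longlonglongrightarrow> d * 0"
    by (rule Lim_transform_eventually)
  then have "(\<lambda>n. D n + v) \<longlonglongrightarrow> d * 0 + v"
    by (intro tendsto_intros)
  then have vl: "(\<lambda>n. real n powr a * (Q n / (real n)\<^sup>2)) \<longlonglongrightarrow> v"
    by (simp add: D_def)
  obtain W where W: "(\<lambda>n. real n powr a * W n) \<longlonglongrightarrow> v"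
    and EV: "\<forall>\<^sub>F n in sequentially. expectation (V n (l n)) = real (l n) powr a * (Q (l n) / (real (l n))\<^sup>2 - W n)"
    using block_estimator_mean[OF r V vl l_pos lim2] by blast
  define \<epsilon> where "\<epsilon> n = real n powr a * W n / v - 1" for n
  have "\<epsilon> \<longlonglongrightarrow> v / v - 1"
    unfolding \<epsilon>_def[abs_def] using v by (intro tendsto_intros W) simp
  then have \<epsilon>: "\<epsilon> \<longlonglongrightarrow> 0" using v by simp
  have l2: "\<forall>\<^sub>F n in sequentially. 2 \<le> l n"
    using l_inf by (simp add: filterlim_at_top)
  have "\<forall>\<^sub>F n in sequentially. expectation (V n (l n)) - target_var M X a n =
        B * (real (l n) powr a / real (l n)) + \<eta> n * rate a \<beta> (l n) - v * (real (l n) / real n) powr a * (1 + \<epsilon> n)"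
    using EV eventually_gt_at_top[of 0] l2
  proof eventually_elim
    case (elim n)
    have tv: "target_var M X a n = D n + v"
      using elim by (simp add: target_var_def variance_sample_mean D_def)
    have lW: "v * (real (l n) / real n) powr a * (1 + \<epsilon> n) = real (l n) powr a * W n"
      using elim v by (simp add: \<epsilon>_def powr_divide)
    have "\<eta> n * rate a \<beta> (l n) = D (l n) - D n - B * (real (l n) powr a / real (l n))"
      using rate_pos[OF elim(3), of a \<beta>] by (simp add: \<eta>_def)
    then show ?case
      unfolding elim(1) tv lW by (simp add: D_def right_diff_distrib)
  qed
  with \<eta> \<epsilon> show ?thesis by blast
qed

theorem theorem3p1:
  fixes M :: "'a measure"
    and Z X :: "nat \<Rightarrow> 'a \<Rightarrow> real"
    and G L :: "real \<Rightarrow> real"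
    and m :: nat and m2 :: enat
    and \<alpha> C0 \<tau> :: real
    and J \<gamma> :: "nat \<Rightarrow> real"
    and l :: "nat \<Rightarrow> nat"
    and V :: "nat \<Rightarrow> nat \<Rightarrow> 'a \<Rightarrow> real"
  assumes "prob_space M"
    and "gaussian_sequence M Z" and "stationary M Z"
    and "\<And>t. prob_space.expectation M (Z t) = 0"
    and "\<And>t. prob_space.variance M (Z t) = 1"
    and "G \<in> borel_measurable borel"
    and "integrable M (\<lambda>\<omega>. (G (Z 0 \<omega>))\<^sup>2)"
    and "prob_space.variance M (\<lambda>\<omega>. G (Z 0 \<omega>)) > 0"
    and J_def: "J = hermite_coeff M Z G"
    and "hermite_rank J = enat m"
    and "hermite_rank2 J = m2"
    and "0 < \<alpha>" and "\<alpha> < 1 / real m"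
    and "0 < C0"
    and "1 - \<alpha> * real m < \<tau>"
    and "slowly_varying L"
    and \<gamma>_def: "\<gamma> = autocov M Z"
    and "\<And>k. 0 < k \<Longrightarrow>
           \<gamma> k = C0 * real k powr - \<alpha> * (1 + real k powr - \<tau> * L (real k))"
    and X_def: "X = (\<lambda>t \<omega>. G (Z t \<omega>))"
    and "V = V_OL X (\<alpha> * real m) \<or> V = V_NOL X (\<alpha> * real m)"
    and "\<And>n. 0 < l n"
    and "(\<lambda>n. 1 / real (l n) + real (l n) / real n) \<longlonglongrightarrow> 0"
  shows "\<exists>e0 e1 e2 :: nat \<Rightarrow> real.
    e0 \<longlonglongrightarrow> 0 \<and> e1 \<longlonglongrightarrow> 0 \<and> e2 \<longlonglongrightarrow> 0 \<and>
    (\<forall>\<^sub>F n in sequentially.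
      prob_space.expectation M (V n (l n)) - target_var M X (\<alpha> * real m) n =
        (if B0 J \<alpha> C0 \<tau> L m = 0 \<and> m2 = \<infinity> then e0 n
         else B0 J \<alpha> C0 \<tau> L m * (1 + e0 n))
          * (real (l n) powr (\<alpha> * real m) / real (l n))
        - v_inf J \<alpha> C0 m * (real (l n) / real n) powr (\<alpha> * real m) * (1 + e1 n)
        + (case m2 of
             \<infinity> \<Rightarrow> 0
           | enat k \<Rightarrow>
               B1 J \<gamma> \<alpha> C0 k
                 * (real (l n) powr (\<alpha> * real m) / real (l n) powr (min 1 (\<alpha> * real k)))
                 * (if \<alpha> * real k = 1 then ln (real (l n)) else 1)
                 * (1 + e2 n)))"
proof -
  define q where "q j = (J j)\<^sup>2 / fact j" for j
  define a where "a = \<alpha> * real m"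
  define x where "x d = L (real d) * real d powr - \<tau>" for d :: nat
  interpret S: standard_gaussian_sequence M Z
    using assms(1-5) by (simp add: standard_gaussian_sequence_def standard_gaussian_sequence_axioms_def)
  have "1 \<le> m \<and> J m \<noteq> 0" and Jm: "\<And>j. j < m \<Longrightarrow> \<not> (1 \<le> j \<and> J j \<noteq> 0)"
    using Inf_enat_eqD[of "\<lambda>j. 1 \<le> j \<and> J j \<noteq> 0" m] \<open>hermite_rank J = enat m\<close>
    unfolding hermite_rank_def by blast+
  then have m: "0 < m" "J m \<noteq> 0" by auto
  have a: "0 < a" "a < 1"
    using \<open>0 < \<alpha>\<close> \<open>\<alpha> < 1 / real m\<close> m by (simp_all add: a_def field_simps)
  have L_pos: "0 < L y" if "0 < y" for y
    using \<open>slowly_varying L\<close> that by (simp add: slowly_varying_def)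
  have \<tau>: "1 - a < \<tau>" using \<open>1 - \<alpha> * real m < \<tau>\<close> by (simp add: a_def)
  have x_lim: "x \<longlonglongrightarrow> 0"
    unfolding x_def[abs_def] by (rule slowly_varying_remainder(1)[OF \<open>slowly_varying L\<close> a \<tau>])
  have x_pos: "0 < x d" if "0 < d" for d
    using that L_pos by (simp add: x_def)
  have \<gamma>_eq: "\<gamma> d = C0 * real d powr - \<alpha> * (1 + x d)" if "0 < d" for d
    using assms(18)[OF that] by (simp add: x_def mult.commute)
  have \<gamma>_pos: "0 < \<gamma> d" if "0 < d" for d
    using \<gamma>_eq[OF that] x_pos[OF that] \<open>0 < C0\<close> that by simp
  have \<gamma>_le: "\<gamma> d \<le> 1" for d
    using S.autocov_abs_le_1[of d] by (simp add: \<gamma>_def abs_le_iff)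
  have q_nonneg: "0 \<le> q j" for j by (simp add: q_def)
  have q_summable: "summable q"
    using S.summable_hermite_coeff[OF \<open>G \<in> borel_measurable borel\<close> \<open>integrable M (\<lambda>\<omega>. (G (Z 0 \<omega>))\<^sup>2)\<close>]
    by (simp add: q_def[abs_def] J_def)
  have qm: "0 < q m" using m by (simp add: q_def)
  have q0: "q j = 0" if "0 < j" "j < m" for j
    using Jm[of j] that by (simp add: q_def)
  define r where "r d = (\<Sum>j. q j * \<gamma> d ^ j) - q 0" for d
  have "weakly_stationary M X (J 0) r"
    using S.weakly_stationary_subordinated[OF \<open>G \<in> borel_measurable borel\<close> \<open>integrable M (\<lambda>\<omega>. (G (Z 0 \<omega>))\<^sup>2)\<close>]
    by (simp add: r_def[abs_def] q_def X_def J_def \<gamma>_def)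
  then interpret X: weakly_stationary M X "J 0" r .
  have r0: "r 0 = (\<Sum>j. q (j + m))"
  proof -
    have "r 0 = (\<Sum>j. q j) - q 0"
      by (simp add: r_def \<gamma>_def S.autocov_0)
    also have "(\<Sum>j. q j) = (\<Sum>j. q (j + m)) + (\<Sum>j<m. q j)"
      by (rule suminf_split_initial_segment[OF q_summable])
    also have "(\<Sum>j<m. q j) = (\<Sum>j\<in>{0}. q j)"
      using m q0 by (intro sum.mono_neutral_right) auto
    finally show ?thesis by simp
  qed
  define \<rho> where "\<rho> d = (case m2 of enat k \<Rightarrow> hermite_tail.tail q \<gamma> k d | \<infinity> \<Rightarrow> 0)" for d
  define g where "g d = real d powr - a * (\<Sum>j=1..m. real (m choose j) * x d ^ j)" for d
  define \<kappa> where "\<kappa> = q m * C0 ^ m"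
  have \<kappa>: "0 < \<kappa>" using qm \<open>0 < C0\<close> by (simp add: \<kappa>_def)
  have tail: "hermite_tail q \<gamma> x \<alpha> C0 k" if "0 < k" for k
    by unfold_locales (use that q_nonneg q_summable \<open>0 < \<alpha>\<close> \<open>0 < C0\<close> \<gamma>_eq \<gamma>_pos \<gamma>_le x_lim in auto)
  have m2: "m < k \<and> J k \<noteq> 0 \<and> (\<forall>j. m < j \<longrightarrow> j < k \<longrightarrow> J j = 0)" if "m2 = enat k" for k
    using Inf_enat_eqD[of "\<lambda>j. enat m < enat j \<and> J j \<noteq> 0" k] that
      \<open>hermite_rank J = enat m\<close> \<open>hermite_rank2 J = m2\<close>
    unfolding hermite_rank2_def by auto
  have m2_inf: "J j = 0" if "m2 = \<infinity>" "m < j" for j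
    using Inf_enat_eq_infinityD[of "\<lambda>j. enat m < enat j \<and> J j \<noteq> 0" j] that
      \<open>hermite_rank J = enat m\<close> \<open>hermite_rank2 J = m2\<close>
    unfolding hermite_rank2_def by auto
  \<comment> \<open>Strictly between \<open>0\<close> and \<open>m\<close>, and strictly between
    \<open>m\<close> and the second rank, all coefficients vanish; what remains below the tail is
    \<open>{0, m}\<close>, and the index \<open>0\<close> cancels against
    \<open>q 0\<close>.\<close>
  have r_split: "r d = q m * \<gamma> d ^ m + \<rho> d" if d: "0 < d" for d
  proof (cases m2)
    case (enat k)
    note k = m2[OF enat]
    interpret T: hermite_tail q \<gamma> x \<alpha> C0 k using tail k by simp
    have "(\<Sum>j. q j * \<gamma> d ^ j) = T.tail d + (\<Sum>j<k. q j * \<gamma> d ^ j)"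
      unfolding T.tail_def
      using T.summable_powers[OF d, of 0 0] by (intro suminf_split_initial_segment) simp
    also have "(\<Sum>j<k. q j * \<gamma> d ^ j) = (\<Sum>j\<in>{0, m}. q j * \<gamma> d ^ j)"
    proof (rule sum.mono_neutral_right)
      show "\<forall>j\<in>{..<k} - {0, m}. q j * \<gamma> d ^ j = 0"
      proof
        fix j assume "j \<in> {..<k} - {0, m}"
        then have "0 < j \<and> j < m \<or> m < j \<and> j < k" by auto
        then have "q j = 0" using q0 k by (auto simp: q_def)
        then show "q j * \<gamma> d ^ j = 0" by simp
      qed
    qed (use k in auto)
    finally show ?thesis using m by (simp add: r_def \<rho>_def enat)
  next
    case infinity
    have "(\<Sum>j. q j * \<gamma> d ^ j) = (\<Sum>j\<in>{0, m}. q j * \<gamma> d ^ j)"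
    proof (rule suminf_finite)
      fix j assume "j \<notin> {0, m}"
      then have "0 < j \<and> j < m \<or> m < j" by auto
      then have "q j = 0" using q0 m2_inf[OF infinity] by (auto simp: q_def)
      then show "q j * \<gamma> d ^ j = 0" by simp
    qed simp
    then show ?thesis using m by (simp add: r_def \<rho>_def infinity)
  qed
  \<comment> \<open>Binomial expansion of \<open>(1 + x d) ^ m\<close>: the term
    \<open>j = 0\<close> is the pure power, the others form \<open>g\<close>.\<close>
  have \<gamma>_pow: "q m * \<gamma> d ^ m = \<kappa> * (real d powr - a + g d)" if d: "0 < d" for d
  proof -
    have "(1 + x d) ^ m = (\<Sum>j\<le>m. real (m choose j) * x d ^ j)"
      using binomial_ring[of "x d" 1 m] by (simp add: add.commute)
    also have "\<dots> = 1 + (\<Sum>j=1..m. real (m choose j) * x d ^ j)"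
      by (simp add: atMost_atLeast0 sum.atLeast_Suc_atMost)
    finally have "(1 + x d) ^ m = 1 + (\<Sum>j=1..m. real (m choose j) * x d ^ j)" .
    moreover have "(real d powr - \<alpha>) ^ m = real d powr - a"
      using d by (simp add: powr_power a_def mult.commute)
    ultimately show ?thesis
      unfolding \<gamma>_eq[OF d] power_mult_distrib \<kappa>_def g_def by (simp add: algebra_simps)
  qed
  have r_eq: "r d = \<kappa> * (real d powr - a + g d) + \<rho> d" if "0 < d" for d
    using r_split[OF that] \<gamma>_pow[OF that] by simp
  have \<rho>_nonneg: "0 \<le> \<rho> d" if "0 < d" for d
    using hermite_tail.tail_nonneg[OF tail that] m2 by (auto simp: \<rho>_def split: enat.split)
  \<comment> \<open>At positive lags this goes back to \<open>L > 0\<close>; the squeeze for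
    overlapping blocks relies on it.\<close>
  have r_nonneg: "0 \<le> r d" for d
  proof (cases "d = 0")
    case True
    then show ?thesis
      unfolding r0 True using q_nonneg q_summable by (auto simp: r0 summable_iff_shift intro!: suminf_nonneg)
  next
    case False
    then show ?thesis
      using r_split[of d] \<rho>_nonneg[of d] \<gamma>_pos[of d] qm by simp
  qed
  have g_sum: "summable (\<lambda>d. g (Suc d))"
    unfolding g_def x_def by (rule slowly_varying_remainder(2)[OF \<open>slowly_varying L\<close> a \<tau>])
  have V: "V = V_OL X a \<or> V = V_NOL X a"
    using assms(20) by (simp add: a_def)
  have v_inf: "v_inf J \<alpha> C0 m = 2 * \<kappa> / ((1 - a) * (2 - a))"
    by (simp add: v_inf_def \<kappa>_def q_def a_def mult.assoc)
  have B0: "B0 J \<alpha> C0 \<tau> L m = r 0 + 2 * \<kappa> * (I_const a + (\<Sum>d. g (Suc d)))"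
    unfolding B0_def r0 by (simp add: \<kappa>_def q_def g_def x_def a_def mult_ac)
  note expansion = X.block_estimator_expansion[OF a _ \<kappa> r_nonneg r_eq g_sum _ _ V assms(21,22), folded v_inf B0, folded a_def]
  show ?thesis
  proof (cases m2)
    case infinity
    \<comment> \<open>Any exponent above 1 can stand for the absent second rank:
      \<open>rate a 2\<close> is the scale of the \<open>B0\<close> term, and
      \<open>\<rho> = 0\<close> makes the limit of \<open>\<eta>\<close> vanish. The branches
      containing \<open>c = 0\<close> are never taken.\<close>
    have "\<exists>\<eta> \<epsilon>. \<eta> \<longlonglongrightarrow> (if (2::real) > 1 then 2 * (\<Sum>d. \<rho> (Suc d)) else if (2::real) = 1 then 2 * 0 else 2 * 0 / ((1 - 2) * (2 - 2)))
     \<and> \<epsilon> \<longlonglongrightarrow> 0 \<and> (\<forall>\<^sub>F n in sequentially. prob_space.expectation M (V n (l n)) - target_var M X a n =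
        B0 J \<alpha> C0 \<tau> L m * (real (l n) powr a / real (l n)) + \<eta> n * rate a 2 (l n) - v_inf J \<alpha> C0 m * (real (l n) / real n) powr a * (1 + \<epsilon> n))"
      by (rule expansion) (use a in \<open>simp_all add: \<rho>_def infinity\<close>)
    then obtain \<eta> \<epsilon> where \<eta>: "\<eta> \<longlonglongrightarrow> 0" and \<epsilon>: "\<epsilon> \<longlonglongrightarrow> 0"
      and ev: "\<forall>\<^sub>F n in sequentially. prob_space.expectation M (V n (l n)) - target_var M X a n =
        B0 J \<alpha> C0 \<tau> L m * (real (l n) powr a / real (l n)) + \<eta> n * rate a 2 (l n) - v_inf J \<alpha> C0 m * (real (l n) / real n) powr a * (1 + \<epsilon> n)"
      by (auto simp: \<rho>_def infinity)
    \<comment> \<open>For \<open>B0 = 0\<close> the error enters as \<open>e0\<close> itself,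
      otherwise relative to \<open>B0\<close>; the value \<open>1\<close> lets one formula serve
      both cases.\<close>
    define c where "c = (if B0 J \<alpha> C0 \<tau> L m = 0 then 1 else B0 J \<alpha> C0 \<tau> L m)"
    have "(\<lambda>n. \<eta> n / c) \<longlonglongrightarrow> 0 / c"
      by (intro tendsto_intros \<eta>) (simp add: c_def)
    then have e0: "(\<lambda>n. \<eta> n / c) \<longlonglongrightarrow> 0" by simp
    show ?thesis
    proof (intro exI conjI)
      show "(\<lambda>n. \<eta> n / c) \<longlonglongrightarrow> 0" by (rule e0)
      show "\<epsilon> \<longlonglongrightarrow> 0" by (rule \<epsilon>)
      show "(\<lambda>_. 0 :: real) \<longlonglongrightarrow> 0" by simp
    next
      show "\<forall>\<^sub>F n in sequentially.
      prob_space.expectation M (V n (l n)) - target_var M X (\<alpha> * real m) n =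
        (if B0 J \<alpha> C0 \<tau> L m = 0 \<and> m2 = \<infinity> then \<eta> n / c
         else B0 J \<alpha> C0 \<tau> L m * (1 + \<eta> n / c))
          * (real (l n) powr (\<alpha> * real m) / real (l n))
        - v_inf J \<alpha> C0 m * (real (l n) / real n) powr (\<alpha> * real m) * (1 + \<epsilon> n)
        + (case m2 of
             \<infinity> \<Rightarrow> 0
           | enat k \<Rightarrow>
               B1 J \<gamma> \<alpha> C0 k
                 * (real (l n) powr (\<alpha> * real m) / real (l n) powr (min 1 (\<alpha> * real k)))
                 * (if \<alpha> * real k = 1 then ln (real (l n)) else 1)
                 * (1 + 0))"
        using ev unfolding a_def[symmetric]
      proof eventually_elim
        case (elim n)
        have "rate a 2 (l n) = real (l n) powr a / real (l n)"
          by (simp add: rate_def)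
        then show ?case
          unfolding elim by (simp add: c_def infinity algebra_simps add_divide_distrib)
      qed
    qed
  next
    case (enat k)
    note k = m2[OF enat]
    interpret T: hermite_tail q \<gamma> x \<alpha> C0 k using tail k by simp
    define \<beta> where "\<beta> = \<alpha> * real k"
    have \<rho>: "\<rho> = T.tail" by (simp add: \<rho>_def[abs_def] enat)
    have \<beta>: "a < \<beta>" using k \<open>0 < \<alpha>\<close> by (simp add: a_def \<beta>_def)
    have qk: "0 < q k" using k by (simp add: q_def)
    have K: "B1 J \<gamma> \<alpha> C0 k = (if \<beta> > 1 then 2 * (\<Sum>d. \<rho> (Suc d)) else if \<beta> = 1 then 2 * (C0 ^ k * q k) else 2 * (C0 ^ k * q k) / ((1 - \<beta>) * (2 - \<beta>)))"
      using T.suminf_tail unfolding B1_def \<rho> by (auto simp: \<beta>_def q_def mult_ac)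
    \<comment> \<open>Permits writing the error as a factor \<open>1 + e2\<close>. For
      \<open>\<beta> > 1\<close> one positive summand suffices, and \<open>q k > 0\<close> provides
      it.\<close>
    have B1: "B1 J \<gamma> \<alpha> C0 k \<noteq> 0"
    proof -
      have "0 < (\<Sum>d. T.tail (Suc d))" if "1 < \<beta>"
        using T.summable_dominated(1) that T.tail_nonneg T.tail_pos qk
        by (intro suminf_pos2[where i = 0]) (auto simp: \<beta>_def)
      then show ?thesis
        unfolding K \<rho> using qk \<open>0 < C0\<close> by auto
    qed
    have "\<exists>\<eta> \<epsilon>. \<eta> \<longlonglongrightarrow> B1 J \<gamma> \<alpha> C0 k
     \<and> \<epsilon> \<longlonglongrightarrow> 0 \<and> (\<forall>\<^sub>F n in sequentially. prob_space.expectation M (V n (l n)) - target_var M X a n =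
        B0 J \<alpha> C0 \<tau> L m * (real (l n) powr a / real (l n)) + \<eta> n * rate a \<beta> (l n) - v_inf J \<alpha> C0 m * (real (l n) / real n) powr a * (1 + \<epsilon> n))"
      unfolding K
      by (rule expansion) (use \<beta> T.summable_dominated(1) T.tail_powr in \<open>simp_all add: \<rho> \<beta>_def\<close>)
    then obtain \<eta> \<epsilon> where \<eta>: "\<eta> \<longlonglongrightarrow> B1 J \<gamma> \<alpha> C0 k" and \<epsilon>: "\<epsilon> \<longlonglongrightarrow> 0"
      and ev: "\<forall>\<^sub>F n in sequentially. prob_space.expectation M (V n (l n)) - target_var M X a n =
        B0 J \<alpha> C0 \<tau> L m * (real (l n) powr a / real (l n)) + \<eta> n * rate a \<beta> (l n) - v_inf J \<alpha> C0 m * (real (l n) / real n) powr a * (1 + \<epsilon> n)"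
      by blast
    have "(\<lambda>n. \<eta> n / B1 J \<gamma> \<alpha> C0 k - 1) \<longlonglongrightarrow> B1 J \<gamma> \<alpha> C0 k / B1 J \<gamma> \<alpha> C0 k - 1"
      by (intro tendsto_intros \<eta> B1)
    then have e2: "(\<lambda>n. \<eta> n / B1 J \<gamma> \<alpha> C0 k - 1) \<longlonglongrightarrow> 0" using B1 by simp
    show ?thesis
    proof (intro exI conjI)
      \<comment> \<open>The nonzero \<open>B1\<close> term has at least the order of the
        \<open>B0\<close> term, so all second-order errors go into \<open>e2\<close> and
        \<open>e0\<close> is zero.\<close>
      show "(\<lambda>_. 0 :: real) \<longlonglongrightarrow> 0" by simp
      show "\<epsilon> \<longlonglongrightarrow> 0" by (rule \<epsilon>)
      show "(\<lambda>n. \<eta> n / B1 J \<gamma> \<alpha> C0 k - 1) \<longlonglongrightarrow> 0" by (rule e2)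
    next
      show "\<forall>\<^sub>F n in sequentially.
      prob_space.expectation M (V n (l n)) - target_var M X (\<alpha> * real m) n =
        (if B0 J \<alpha> C0 \<tau> L m = 0 \<and> m2 = \<infinity> then 0
         else B0 J \<alpha> C0 \<tau> L m * (1 + 0))
          * (real (l n) powr (\<alpha> * real m) / real (l n))
        - v_inf J \<alpha> C0 m * (real (l n) / real n) powr (\<alpha> * real m) * (1 + \<epsilon> n)
        + (case m2 of
             \<infinity> \<Rightarrow> 0
           | enat k' \<Rightarrow>
               B1 J \<gamma> \<alpha> C0 k'
                 * (real (l n) powr (\<alpha> * real m) / real (l n) powr (min 1 (\<alpha> * real k')))
                 * (if \<alpha> * real k' = 1 then ln (real (l n)) else 1)
                 * (1 + (\<eta> n / B1 J \<gamma> \<alpha> C0 k - 1)))"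
        using ev unfolding a_def[symmetric]
      proof eventually_elim
        case (elim n)
        have "\<eta> n * rate a \<beta> (l n) = B1 J \<gamma> \<alpha> C0 k * (real (l n) powr a / real (l n) powr (min 1 (\<alpha> * real k)))
            * (if \<alpha> * real k = 1 then ln (real (l n)) else 1) * (1 + (\<eta> n / B1 J \<gamma> \<alpha> C0 k - 1))"
          using B1 by (simp add: rate_def \<beta>_def)
        then show ?case
          unfolding elim by (simp add: enat)
      qed
    qed
  qed
qed

end
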